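(* Let $(X,\omega)$ be a compact connected Kähler manifold with $\dim_{\mathbb{C}}X=n$, let $m\in\{1,\dots,n\}$, and suppose there exists a real form $\Omega\in C^\infty_{n-m,\,n-m}(X,\mathbb{R})$ such that $\partial\bar\partial\Omega=0$ and $\Omega>0$ (metrically weakly) on $X$. Let $E\to X$ be a holomorphic vector bundle of rank $r\geq 1$. (a) If there exists a $C^\infty$ Hermitian fibre metric $h$ on $E$ such that $(E,h)$ is $(\omega,\Omega)$-$m$-semi-negative at every point of $X$ and $(\omega,\Omega)$-$m$-negative at some point $x_0\in X$, then $H^0(X,E)=\{0\}$. (b) If $h$ is a $C^\infty$ Hermitian fibre metric on $E$ such that $(E,h)$ is $(\omega,\Omega)$-$m$-semi-negative at every point of $X$, then every $s\in H^0(X,E)$ satisfies $D_hs=0$ on $X$, i.e. $s$ is parallel with respect to the Chern connection $D_h$ of $(E,h)$.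
   Context: Weak positivity: a real $(p,p)$-form $\Gamma$ at a point $x\in X$ is weakly $\geq 0$ if $\Gamma\wedge i\alpha_1\wedge\bar\alpha_1\wedge\dots\wedge i\alpha_{n-p}\wedge\bar\alpha_{n-p}\geq 0$ for all $(1,0)$-covectors $\alpha_1,\dots,\alpha_{n-p}$ at $x$. "$\Omega>0$ (metrically weakly)" on $X$ means that there is a constant $\varepsilon>0$ such that $\Omega-\varepsilon\,\omega^{n-m}$ is weakly $\geq 0$ at every point of $X$. Notation: $i\Theta_h(E)\in C^\infty_{1,1}(X,\operatorname{End}E)$ is the curvature form of the Chern connection $D_h=D_h'+\bar\partial$ of $(E,h)$. For $E$-valued forms $u,v$, $\{u,v\}_h$ is the scalar-valued form obtained by wedging the scalar part of $u$ with the conjugate of the scalar part of $v$ and multiplying by the $h$-inner product of the $E$-parts. $(E,h)$ is $(\omega,\Omega)$-$m$-semi-negative at $x$ if $\{(-i\Theta_h(E)\wedge\omega^{m-1}\wedge\Omega)\,u,\,u\}_h\geq 0$ (as a real $(n,n)$-form at $x$) for every $u\in E_x$; it is $(\omega,\Omega)$-$m$-negative at $x$ if this quantity is $>0$ for every $u\in E_x\setminus\{0\}$. *)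

theory Defs
  imports "HOL-Analysis.Analysis"
begin

section \<open>Exterior algebra of \<open>\<complex>\<^sup>n\<close>\<close>

text \<open>
  A complex-valued exterior form on the real vector space underlying \<open>\<complex>\<^sup>n\<close> is a function of the
  list of its vector arguments; a form of degree \<open>k\<close> is multilinear and alternating on lists of
  length \<open>k\<close> and vanishes on lists of any other length. This makes the wedge product total and
  graded without carrying degrees around.
\<close>

type_synonym 'n form = "(complex^'n) list \<Rightarrow> complex"

definition const_form :: "complex \<Rightarrow> 'n::finite form" where
  "const_form a = (\<lambda>vs. if vs = [] then a else 0)"

text \<open>
  Shuffle formula: the sum over the \<open>(p,q)\<close>-shuffles, which for alternating \<open>\<alpha>\<close>, \<open>\<beta>\<close> of degrees
  \<open>p\<close>, \<open>q\<close> is \<open>1/(p! q!)\<close> times the full antisymmetrization. The set \<open>S\<close> collects the argument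
  positions handed to \<open>\<alpha>\<close>; the sign counts the inversions of the shuffle.
\<close>

definition wedge :: "'n::finite form \<Rightarrow> 'n form \<Rightarrow> 'n form" (infixr \<open>\<and>\<^sub>w\<close> 70) where
  "\<alpha> \<and>\<^sub>w \<beta> = (\<lambda>vs. \<Sum>S\<in>Pow {..<length vs}.
     (-1) ^ card {(i, j). i \<in> S \<and> j \<in> {..<length vs} - S \<and> j < i} *
     \<alpha> (nths vs S) * \<beta> (nths vs (- S)))"

definition wedge_list :: "'n::finite form list \<Rightarrow> 'n form" where
  "wedge_list \<alpha>s = foldr (\<and>\<^sub>w) \<alpha>s (const_form 1)"

definition wedge_pow :: "'n::finite form \<Rightarrow> nat \<Rightarrow> 'n form" where
  "wedge_pow \<alpha> k = wedge_list (replicate k \<alpha>)"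

definition scale_form :: "complex \<Rightarrow> 'n::finite form \<Rightarrow> 'n form" where
  "scale_form a \<alpha> = (\<lambda>vs. a * \<alpha> vs)"

definition cnj_form :: "'n::finite form \<Rightarrow> 'n form" where
  "cnj_form \<alpha> = (\<lambda>vs. cnj (\<alpha> vs))"

definition real_form :: "'n::finite form \<Rightarrow> bool" where
  "real_form \<alpha> \<longleftrightarrow> cnj_form \<alpha> = \<alpha>"

definition dz :: "'n::finite \<Rightarrow> 'n form" where
  "dz j = (\<lambda>vs. case vs of [v] \<Rightarrow> v $ j | _ \<Rightarrow> 0)"

definition dzbar :: "'n::finite \<Rightarrow> 'n form" where
  "dzbar j = cnj_form (dz j)"

text \<open>\<open>\<alpha> = \<Sum> c\<^bsub>I J\<^esub> dz\<^bsub>I\<^esub> \<and> dz\<^bsub>J\<^esub>\<close> (the second factor conjugated), over all multi-indices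
  of lengths \<open>p\<close> and \<open>q\<close>.\<close>

definition bidegree :: "nat \<Rightarrow> nat \<Rightarrow> 'n::finite form \<Rightarrow> bool" where
  "bidegree p q \<alpha> \<longleftrightarrow> (\<exists>c :: 'n list \<Rightarrow> 'n list \<Rightarrow> complex. \<forall>vs.
     \<alpha> vs = (\<Sum>I | length I = p. \<Sum>J | length J = q.
               c I J * wedge_list (map dz I @ map dzbar J) vs))"

text \<open>
  Signs of forms of bidegree \<open>(n,n)\<close>, with respect to the orientation given by the complex
  structure: \<open>(v\<^sub>1, i v\<^sub>1, \<dots>, v\<^sub>n, i v\<^sub>n)\<close> is a positively oriented real basis for every complex
  basis \<open>v\<^sub>1, \<dots>, v\<^sub>n\<close>.
\<close>

definition complex_basis :: "(complex^'n::finite) list \<Rightarrow> bool" where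
  "complex_basis vs \<longleftrightarrow>
     distinct vs \<and> vec.independent (set vs) \<and> vec.span (set vs) = UNIV"

definition real_basis_of :: "(complex^'n::finite) list \<Rightarrow> (complex^'n) list" where
  "real_basis_of vs = concat (map (\<lambda>v. [v, \<i> *s v]) vs)"

definition top_nonneg :: "'n::finite form \<Rightarrow> bool" where
  "top_nonneg \<sigma> \<longleftrightarrow> (\<forall>vs. complex_basis vs \<longrightarrow>
     Im (\<sigma> (real_basis_of vs)) = 0 \<and> Re (\<sigma> (real_basis_of vs)) \<ge> 0)"

definition top_pos :: "'n::finite form \<Rightarrow> bool" where
  "top_pos \<sigma> \<longleftrightarrow> (\<forall>vs. complex_basis vs \<longrightarrow>
     Im (\<sigma> (real_basis_of vs)) = 0 \<and> Re (\<sigma> (real_basis_of vs)) > 0)"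

definition weakly_nonneg :: "nat \<Rightarrow> 'n::finite form \<Rightarrow> bool" where
  "weakly_nonneg p \<Gamma> \<longleftrightarrow>
     (\<forall>\<alpha>s. length \<alpha>s = CARD('n) - p \<and> (\<forall>\<alpha>\<in>set \<alpha>s. bidegree 1 0 \<alpha>) \<longrightarrow>
        top_nonneg (\<Gamma> \<and>\<^sub>w wedge_list (map (\<lambda>\<alpha>. scale_form \<i> \<alpha> \<and>\<^sub>w cnj_form \<alpha>) \<alpha>s)))"


section \<open>Calculus on open subsets of \<open>\<complex>\<^sup>n\<close>\<close>

primrec Ck_on :: "nat \<Rightarrow> (complex^'n::finite) set \<Rightarrow> (complex^'n \<Rightarrow> complex) \<Rightarrow> bool" where
  "Ck_on 0 U f \<longleftrightarrow> continuous_on U f"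
| "Ck_on (Suc k) U f \<longleftrightarrow> (\<forall>z\<in>U. f differentiable (at z)) \<and>
     (\<forall>v. Ck_on k U (\<lambda>z. frechet_derivative f (at z) v))"

definition Cinf_on :: "(complex^'n::finite) set \<Rightarrow> (complex^'n \<Rightarrow> complex) \<Rightarrow> bool" where
  "Cinf_on U f \<longleftrightarrow> (\<forall>k. Ck_on k U f)"

definition holo_on :: "(complex^'n::finite) set \<Rightarrow> (complex^'n \<Rightarrow> complex) \<Rightarrow> bool" where
  "holo_on U f \<longleftrightarrow> (\<forall>z\<in>U. \<exists>f'. (f has_derivative f') (at z) \<and>
     (\<forall>a v. f' (a *s v) = a * f' v))"

definition partial_z :: "'n::finite \<Rightarrow> (complex^'n \<Rightarrow> complex) \<Rightarrow> complex^'n \<Rightarrow> complex" where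
  "partial_z j f z = (frechet_derivative f (at z) (axis j 1)
                      - \<i> * frechet_derivative f (at z) (axis j \<i>)) / 2"

definition partial_zbar :: "'n::finite \<Rightarrow> (complex^'n \<Rightarrow> complex) \<Rightarrow> complex^'n \<Rightarrow> complex" where
  "partial_zbar j f z = (frechet_derivative f (at z) (axis j 1)
                         + \<i> * frechet_derivative f (at z) (axis j \<i>)) / 2"

definition del_local :: "(complex^'n::finite \<Rightarrow> 'n form) \<Rightarrow> complex^'n \<Rightarrow> 'n form" where
  "del_local \<alpha> z = (\<lambda>vs. \<Sum>j\<in>UNIV. (dz j \<and>\<^sub>w (\<lambda>ws. partial_z j (\<lambda>y. \<alpha> y ws) z)) vs)"

definition delbar_local :: "(complex^'n::finite \<Rightarrow> 'n form) \<Rightarrow> complex^'n \<Rightarrow> 'n form" where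
  "delbar_local \<alpha> z = (\<lambda>vs. \<Sum>j\<in>UNIV. (dzbar j \<and>\<^sub>w (\<lambda>ws. partial_zbar j (\<lambda>y. \<alpha> y ws) z)) vs)"


section \<open>Complex manifolds\<close>

type_synonym ('x, 'n) chart = "'x set \<times> ('x \<Rightarrow> complex^'n)"

record ('x, 'n::finite) cmfd =
  mtop :: "'x topology"
  atlas :: "('x, 'n) chart set"

definition chart_inv :: "('x, 'n::finite) chart \<Rightarrow> complex^'n \<Rightarrow> 'x" where
  "chart_inv c = inv_into (fst c) (snd c)"

definition in_chart :: "('x, 'n::finite) chart \<Rightarrow> ('x \<Rightarrow> 'b) \<Rightarrow> complex^'n \<Rightarrow> 'b" where
  "in_chart c f = (\<lambda>z. f (chart_inv c z))"

definition complex_manifold :: "('x, 'n::finite) cmfd \<Rightarrow> bool" where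
  "complex_manifold X \<longleftrightarrow>
     Hausdorff_space (mtop X) \<and> second_countable (mtop X) \<and>
     (\<Union>(fst ` atlas X) = topspace (mtop X)) \<and>
     (\<forall>(U, \<phi>)\<in>atlas X. openin (mtop X) U \<and> open (\<phi> ` U) \<and>
        homeomorphic_map (subtopology (mtop X) U) (top_of_set (\<phi> ` U)) \<phi>) \<and>
     (\<forall>(U, \<phi>)\<in>atlas X. \<forall>(V, \<psi>)\<in>atlas X. \<forall>j.
        holo_on (\<phi> ` (U \<inter> V)) (\<lambda>z. \<psi> (inv_into U \<phi> z) $ j))"

definition holo_fun :: "('x, 'n::finite) cmfd \<Rightarrow> 'x set \<Rightarrow> ('x \<Rightarrow> complex) \<Rightarrow> bool" where
  "holo_fun X W f \<longleftrightarrow> (\<forall>c\<in>atlas X. holo_on (snd c ` (fst c \<inter> W)) (in_chart c f))"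

definition Cinf_fun :: "('x, 'n::finite) cmfd \<Rightarrow> 'x set \<Rightarrow> ('x \<Rightarrow> complex) \<Rightarrow> bool" where
  "Cinf_fun X W f \<longleftrightarrow> (\<forall>c\<in>atlas X. Cinf_on (snd c ` (fst c \<inter> W)) (in_chart c f))"


section \<open>Differential forms on a complex manifold\<close>

text \<open>
  A differential form is given by its expressions in the charts of the atlas: \<open>\<alpha> c x\<close> is the
  form at the point \<open>x\<close>, where the tangent space at \<open>x\<close> is identified with \<open>\<complex>\<^sup>n\<close> by the
  chart \<open>c\<close>. The expressions in two charts must agree under the differential of the transition
  map.
\<close>

type_synonym ('x, 'n) mform = "('x, 'n) chart \<Rightarrow> 'x \<Rightarrow> 'n form"

definition Cinf_form :: "('x, 'n::finite) cmfd \<Rightarrow> nat \<Rightarrow> nat \<Rightarrow> ('x, 'n) mform \<Rightarrow> bool" where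
  "Cinf_form X p q \<alpha> \<longleftrightarrow>
     (\<forall>c\<in>atlas X. \<forall>x\<in>fst c. bidegree p q (\<alpha> c x)) \<and>
     (\<forall>c\<in>atlas X. \<forall>vs. Cinf_on (snd c ` fst c) (\<lambda>z. in_chart c (\<alpha> c) z vs)) \<and>
     (\<forall>c\<in>atlas X. \<forall>c'\<in>atlas X. \<forall>x\<in>fst c \<inter> fst c'. \<forall>vs.
        \<alpha> c x vs =
        \<alpha> c' x (map (frechet_derivative (in_chart c (snd c')) (at (snd c x))) vs))"

definition del_at :: "('x, 'n::finite) chart \<Rightarrow> ('x \<Rightarrow> 'n form) \<Rightarrow> 'x \<Rightarrow> 'n form" where
  "del_at c \<alpha> x = del_local (in_chart c \<alpha>) (snd c x)"

definition delbar_at :: "('x, 'n::finite) chart \<Rightarrow> ('x \<Rightarrow> 'n form) \<Rightarrow> 'x \<Rightarrow> 'n form" where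
  "delbar_at c \<alpha> x = delbar_local (in_chart c \<alpha>) (snd c x)"

definition d_at :: "('x, 'n::finite) chart \<Rightarrow> ('x \<Rightarrow> 'n form) \<Rightarrow> 'x \<Rightarrow> 'n form" where
  "d_at c \<alpha> x = (\<lambda>vs. del_at c \<alpha> x vs + delbar_at c \<alpha> x vs)"

definition real_mform :: "('x, 'n::finite) cmfd \<Rightarrow> ('x, 'n) mform \<Rightarrow> bool" where
  "real_mform X \<alpha> \<longleftrightarrow> (\<forall>c\<in>atlas X. \<forall>x\<in>fst c. real_form (\<alpha> c x))"

definition d_closed :: "('x, 'n::finite) cmfd \<Rightarrow> ('x, 'n) mform \<Rightarrow> bool" where
  "d_closed X \<alpha> \<longleftrightarrow> (\<forall>c\<in>atlas X. \<forall>x\<in>fst c. \<forall>vs. d_at c (\<alpha> c) x vs = 0)"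

definition del_delbar_closed :: "('x, 'n::finite) cmfd \<Rightarrow> ('x, 'n) mform \<Rightarrow> bool" where
  "del_delbar_closed X \<alpha> \<longleftrightarrow>
     (\<forall>c\<in>atlas X. \<forall>x\<in>fst c. \<forall>vs. del_at c (delbar_at c (\<alpha> c)) x vs = 0)"

definition kaehler_form :: "('x, 'n::finite) cmfd \<Rightarrow> ('x, 'n) mform \<Rightarrow> bool" where
  "kaehler_form X \<omega> \<longleftrightarrow> Cinf_form X 1 1 \<omega> \<and> real_mform X \<omega> \<and> d_closed X \<omega> \<and>
     (\<forall>c\<in>atlas X. \<forall>x\<in>fst c. \<forall>v. v \<noteq> 0 \<longrightarrow> Re (\<omega> c x [v, \<i> *s v]) > 0)"

definition metrically_weakly_pos ::
    "('x, 'n::finite) cmfd \<Rightarrow> ('x, 'n) mform \<Rightarrow> nat \<Rightarrow> ('x, 'n) mform \<Rightarrow> bool" where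
  "metrically_weakly_pos X \<omega> p \<Omega> \<longleftrightarrow> (\<exists>\<epsilon>::real. \<epsilon> > 0 \<and>
     (\<forall>c\<in>atlas X. \<forall>x\<in>fst c.
        weakly_nonneg p (\<lambda>vs. \<Omega> c x vs - of_real \<epsilon> * wedge_pow (\<omega> c x) p vs)))"


section \<open>Holomorphic vector bundles\<close>

text \<open>
  A trivialization \<open>(V, \<psi>)\<close> over \<open>V\<close> consists of the fibre coordinates \<open>\<psi>\<close> on the part of the
  total space lying over \<open>V\<close>. The topology and complex structure of the total space and the
  vector space structure of the fibres are the ones transported by the trivializations.
\<close>

type_synonym ('x, 'e, 'r) triv = "'x set \<times> ('e \<Rightarrow> complex^'r)"

record ('x, 'e, 'r::finite) vbundle =
  total :: "'e set"
  proj :: "'e \<Rightarrow> 'x"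
  trivs :: "('x, 'e, 'r) triv set"

definition fibre :: "('x, 'e, 'r::finite) vbundle \<Rightarrow> 'x \<Rightarrow> 'e set" where
  "fibre E x = {e \<in> total E. proj E e = x}"

definition holo_vector_bundle ::
    "('x, 'n::finite) cmfd \<Rightarrow> ('x, 'e, 'r::finite) vbundle \<Rightarrow> bool" where
  "holo_vector_bundle X E \<longleftrightarrow>
     proj E ` total E \<subseteq> topspace (mtop X) \<and>
     \<Union>(fst ` trivs E) = topspace (mtop X) \<and>
     (\<forall>(V, \<psi>)\<in>trivs E. openin (mtop X) V \<and>
        bij_betw (\<lambda>e. (proj E e, \<psi> e)) {e \<in> total E. proj E e \<in> V} (V \<times> UNIV)) \<and>
     (\<forall>(V, \<psi>)\<in>trivs E. \<forall>(V', \<psi>')\<in>trivs E. \<exists>g :: 'x \<Rightarrow> complex^'r^'r.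
        (\<forall>x\<in>V \<inter> V'. invertible (g x) \<and> (\<forall>e\<in>fibre E x. \<psi>' e = g x *v \<psi> e)) \<and>
        (\<forall>i j. holo_fun X (V \<inter> V') (\<lambda>x. g x $ i $ j)))"

text \<open>Sections are functions on the carrier of \<open>X\<close>, extended by \<open>undefined\<close> outside of it.\<close>

definition H0 :: "('x, 'n::finite) cmfd \<Rightarrow> ('x, 'e, 'r::finite) vbundle \<Rightarrow> ('x \<Rightarrow> 'e) set" where
  "H0 X E = {s \<in> (\<Pi>\<^sub>E x\<in>topspace (mtop X). fibre E x).
     \<forall>(V, \<psi>)\<in>trivs E. \<forall>i. holo_fun X V (\<lambda>x. \<psi> (s x) $ i)}"

definition zero_section ::
    "('x, 'n::finite) cmfd \<Rightarrow> ('x, 'e, 'r::finite) vbundle \<Rightarrow> 'x \<Rightarrow> 'e" where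
  "zero_section X E = (\<lambda>x\<in>topspace (mtop X).
     THE e. e \<in> fibre E x \<and> (\<forall>(V, \<psi>)\<in>trivs E. x \<in> V \<longrightarrow> \<psi> e = 0))"

text \<open>The vectors \<open>e\<^sub>i\<close> of the local holomorphic frame belonging to a trivialization.\<close>

definition frame ::
    "('x, 'e, 'r::finite) vbundle \<Rightarrow> ('x, 'e, 'r) triv \<Rightarrow> 'r \<Rightarrow> 'x \<Rightarrow> 'e" where
  "frame E t i x = (THE e. e \<in> fibre E x \<and> snd t e = axis i 1)"


section \<open>Hermitian metrics, the Chern connection and its curvature\<close>

text \<open>A fibre metric \<open>h\<close> is linear in its first argument; it is only evaluated on pairs of
  vectors in the same fibre.\<close>

definition gram :: "('x, 'e, 'r::finite) vbundle \<Rightarrow> ('e \<Rightarrow> 'e \<Rightarrow> complex) \<Rightarrow>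
    ('x, 'e, 'r) triv \<Rightarrow> 'x \<Rightarrow> 'r \<Rightarrow> 'r \<Rightarrow> complex" where
  "gram E h t x i j = h (frame E t i x) (frame E t j x)"

definition hermitian_metric :: "('x, 'n::finite) cmfd \<Rightarrow> ('x, 'e, 'r::finite) vbundle \<Rightarrow>
    ('e \<Rightarrow> 'e \<Rightarrow> complex) \<Rightarrow> bool" where
  "hermitian_metric X E h \<longleftrightarrow> (\<forall>t\<in>trivs E.
     (\<forall>x\<in>fst t. \<forall>u\<in>fibre E x. \<forall>v\<in>fibre E x.
        h u v = (\<Sum>i\<in>UNIV. \<Sum>j\<in>UNIV. gram E h t x i j * snd t u $ i * cnj (snd t v $ j)) \<and>
        h v u = cnj (h u v) \<and>
        (snd t u \<noteq> 0 \<longrightarrow> Re (h u u) > 0)) \<and>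
     (\<forall>i j. Cinf_fun X (fst t) (\<lambda>x. gram E h t x i j)))"

text \<open>
  The connection matrix \<open>A\<close> of the Chern connection in the holomorphic frame \<open>(e\<^sub>i)\<close> of \<open>t\<close>,
  \<open>D e\<^sub>j = \<Sum>\<^sub>k A\<^bsub>k j\<^esub> e\<^sub>k\<close>, expressed in the chart \<open>c\<close>. Since the frame is holomorphic,
  the \<open>(0,1)\<close>-part of \<open>D\<close> is the Cauchy-Riemann operator of \<open>E\<close> iff \<open>A\<close> has bidegree
  \<open>(1,0)\<close>; the second condition is compatibility with the metric,
  \<open>d h(e\<^sub>i,e\<^sub>j) = h(D e\<^sub>i, e\<^sub>j) + h(e\<^sub>i, D e\<^sub>j)\<close>.
\<close>

definition chern_matrix :: "('x, 'e, 'r::finite) vbundle \<Rightarrow> ('e \<Rightarrow> 'e \<Rightarrow> complex) \<Rightarrow>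
    ('x, 'n::finite) chart \<Rightarrow> ('x, 'e, 'r) triv \<Rightarrow> 'x \<Rightarrow> 'r \<Rightarrow> 'r \<Rightarrow> 'n form" where
  "chern_matrix E h c t x = (THE A.
     (\<forall>k j. bidegree 1 0 (A k j)) \<and>
     (\<forall>i j vs. d_at c (\<lambda>y. const_form (gram E h t y i j)) x vs =
        (\<Sum>k\<in>UNIV. A k i vs * gram E h t x k j + gram E h t x i k * cnj (A k j vs))))"

text \<open>The components, in the frame of \<open>t\<close>, of the \<open>E\<close>-valued \<open>1\<close>-form \<open>D\<^sub>h s\<close>.\<close>

definition chern_deriv :: "('x, 'e, 'r::finite) vbundle \<Rightarrow> ('e \<Rightarrow> 'e \<Rightarrow> complex) \<Rightarrow>
    ('x, 'n::finite) chart \<Rightarrow> ('x, 'e, 'r) triv \<Rightarrow> ('x \<Rightarrow> 'e) \<Rightarrow> 'x \<Rightarrow> 'r \<Rightarrow> 'n form" where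
  "chern_deriv E h c t s x i = (\<lambda>vs.
     d_at c (\<lambda>y. const_form (snd t (s y) $ i)) x vs +
     (\<Sum>j\<in>UNIV. chern_matrix E h c t x i j vs * (snd t (s x) $ j)))"

definition parallel_section :: "('x, 'n::finite) cmfd \<Rightarrow> ('x, 'e, 'r::finite) vbundle \<Rightarrow>
    ('e \<Rightarrow> 'e \<Rightarrow> complex) \<Rightarrow> ('x \<Rightarrow> 'e) \<Rightarrow> bool" where
  "parallel_section X E h s \<longleftrightarrow>
     (\<forall>c\<in>atlas X. \<forall>t\<in>trivs E. \<forall>x\<in>fst c \<inter> fst t. \<forall>i vs. chern_deriv E h c t s x i vs = 0)"

text \<open>\<open>\<Theta> = dA + A \<and> A\<close>, the matrix of \<open>D\<^sup>2\<close>.\<close>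

definition curvature :: "('x, 'e, 'r::finite) vbundle \<Rightarrow> ('e \<Rightarrow> 'e \<Rightarrow> complex) \<Rightarrow>
    ('x, 'n::finite) chart \<Rightarrow> ('x, 'e, 'r) triv \<Rightarrow> 'x \<Rightarrow> 'r \<Rightarrow> 'r \<Rightarrow> 'n form" where
  "curvature E h c t x i j = (\<lambda>vs.
     d_at c (\<lambda>y. chern_matrix E h c t y i j) x vs +
     (\<Sum>k\<in>UNIV. (chern_matrix E h c t x i k \<and>\<^sub>w chern_matrix E h c t x k j) vs))"

text \<open>\<open>{u,v}\<^sub>h\<close> for \<open>E\<close>-valued forms at \<open>x\<close> given by their components in the frame of \<open>t\<close>.\<close>

definition hpair :: "('x, 'e, 'r::finite) vbundle \<Rightarrow> ('e \<Rightarrow> 'e \<Rightarrow> complex) \<Rightarrow>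
    ('x, 'e, 'r) triv \<Rightarrow> 'x \<Rightarrow> ('r \<Rightarrow> 'n::finite form) \<Rightarrow> ('r \<Rightarrow> 'n form) \<Rightarrow> 'n form" where
  "hpair E h t x u v = (\<lambda>vs. \<Sum>i\<in>UNIV. \<Sum>j\<in>UNIV.
     gram E h t x i j * (u i \<and>\<^sub>w cnj_form (v j)) vs)"

text \<open>The \<open>(n,n)\<close>-form \<open>{(-i\<Theta>\<^sub>h(E) \<and> \<omega>\<^bsup>m-1\<^esup> \<and> \<Omega>) u, u}\<^sub>h\<close> at \<open>x\<close>.\<close>

definition m_curvature_form :: "('x, 'n::finite) mform \<Rightarrow> ('x, 'n) mform \<Rightarrow> nat \<Rightarrow>
    ('x, 'e, 'r::finite) vbundle \<Rightarrow> ('e \<Rightarrow> 'e \<Rightarrow> complex) \<Rightarrow>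
    ('x, 'n) chart \<Rightarrow> ('x, 'e, 'r) triv \<Rightarrow> 'x \<Rightarrow> 'e \<Rightarrow> 'n form" where
  "m_curvature_form \<omega> \<Omega> m E h c t x u = hpair E h t x
     (\<lambda>i vs. \<Sum>j\<in>UNIV.
        (scale_form (- \<i>) (curvature E h c t x i j) \<and>\<^sub>w wedge_pow (\<omega> c x) (m - 1) \<and>\<^sub>w \<Omega> c x) vs
        * (snd t u $ j))
     (\<lambda>i. const_form (snd t u $ i))"

definition m_semi_negative_at :: "('x, 'n::finite) cmfd \<Rightarrow> ('x, 'n) mform \<Rightarrow> ('x, 'n) mform \<Rightarrow>
    nat \<Rightarrow> ('x, 'e, 'r::finite) vbundle \<Rightarrow> ('e \<Rightarrow> 'e \<Rightarrow> complex) \<Rightarrow> 'x \<Rightarrow> bool" where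
  "m_semi_negative_at X \<omega> \<Omega> m E h x \<longleftrightarrow>
     (\<forall>c\<in>atlas X. \<forall>t\<in>trivs E. x \<in> fst c \<inter> fst t \<longrightarrow>
        (\<forall>u\<in>fibre E x. top_nonneg (m_curvature_form \<omega> \<Omega> m E h c t x u)))"

definition m_negative_at :: "('x, 'n::finite) cmfd \<Rightarrow> ('x, 'n) mform \<Rightarrow> ('x, 'n) mform \<Rightarrow>
    nat \<Rightarrow> ('x, 'e, 'r::finite) vbundle \<Rightarrow> ('e \<Rightarrow> 'e \<Rightarrow> complex) \<Rightarrow> 'x \<Rightarrow> bool" where
  "m_negative_at X \<omega> \<Omega> m E h x \<longleftrightarrow>
     (\<forall>c\<in>atlas X. \<forall>t\<in>trivs E. x \<in> fst c \<inter> fst t \<longrightarrow>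
        (\<forall>u\<in>fibre E x - {zero_section X E x}. top_pos (m_curvature_form \<omega> \<Omega> m E h c t x u)))"

end

theory Submission
  imports Defs "HOL-Complex_Analysis.Cauchy_Integral_Formula"
begin

text \<open>
  For a holomorphic section \<open>s\<close> the Bochner identity expresses the Levi form of \<open>|s|\<^sup>2\<close> as the sum of
  \<open>{D's, D's}\<close> and the curvature term \<open>{-i\<Theta> s, s}\<close>. Wedging with \<open>\<omega>\<^bsup>m-1\<^esup> \<and> \<Omega>\<close> turns the Levi
  form into a second order operator without terms of lower order; it is elliptic, because \<open>\<omega>\<close> is
  a sum of squares \<open>i\<gamma> \<and> \<gamma>\<close> (second factor conjugated), so that the weak positivity of
  \<open>\<Omega> - \<epsilon>\<omega>\<^bsup>n-m\<^esup>\<close> bounds its coefficients below by those of \<open>\<epsilon>\<omega>\<^bsup>n-1\<^esup>\<close>. Semi-negativity makes \<open>|s|\<^sup>2\<close> a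
  subsolution, which by the strong maximum principle is constant on the compact connected
  manifold. Both summands then vanish identically: \<open>D's = 0\<close> everywhere, and \<open>s = 0\<close> where the
  curvature is negative, hence everywhere.
\<close>

section \<open>The exterior algebra\<close>

text \<open>A section is only known to have a complex-linear first derivative, so |s|^2 is not
  handled as a C^2 function. The Levi form is instead a matrix \<open>F\<close> tested by second
  derivatives along the real lines in the directions v and iv, whose sum is four times the Hermitian
  form of \<open>F\<close> at v. Holomorphy on each complex line supplies these derivatives, and the
  test at a maximum asks for no more. Top-degree forms are evaluated on one oriented frame. Wedging
  with omega^(m-1) and Omega becomes the pairing \<open>contract\<close> of matrices, which is
  positive on semidefinite matrices once it is positive on those of rank one; weak positivity speaks
  of products of just such rank one forms. Strictness is the delicate point: for every g some term
  must be positive, not merely nonnegative. Hence the decomposition of omega is arranged to contain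
  a nonzero multiple of each coordinate covector, n-1 of which complement g. The Chern matrix is
  given by a description. It is identified with a solution by Cramer's rule, from which
  differentiability of its entries follows; \<open>conn_eq\<close> then makes the (2,0)-part of the
  curvature vanish.\<close>

definition insert_vec :: "complex^'n::finite \<Rightarrow> 'n form \<Rightarrow> 'n form" where
  "insert_vec v \<alpha> = (\<lambda>vs. \<alpha> (v # vs))"

text \<open>The grading automorphism. Forms carry no degree, so the sign in the Leibniz rule has to
  be read off the length of the argument list.\<close>

definition twist :: "'n::finite form \<Rightarrow> 'n form" where
  "twist \<alpha> = (\<lambda>vs. (-1) ^ length vs * \<alpha> vs)"

definition degree_form :: "nat \<Rightarrow> 'n::finite form \<Rightarrow> bool" where
  "degree_form k \<alpha> \<longleftrightarrow> (\<forall>vs. length vs \<noteq> k \<longrightarrow> \<alpha> vs = 0)"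

section \<open>Recursion of the shuffle sum on the first argument\<close>

lemma wedge_Nil: "(\<alpha> \<and>\<^sub>w \<beta>) [] = \<alpha> [] * \<beta> []"
  by (simp add: wedge_def)

text \<open>A shuffle hands the first argument, at position 0, either to the left factor or to the
  right one. This splits the sum in \<open>wedge\<close> into the two terms of the Leibniz
  rule.\<close>

lemma Pow_lessThan_Suc:
  "Pow {..<Suc n} = (\<lambda>T. insert 0 (Suc ` T)) ` Pow {..<n} \<union> image Suc ` Pow {..<n}"
  unfolding lessThan_Suc_eq_insert_0 Pow_insert image_Pow_surj[OF refl, of Suc, symmetric]
  by (auto simp: image_image)

text \<open>Position 0, when given to the left factor, precedes everything and takes part in no
  inversion, so the sign is unchanged.\<close>

lemma inversions_insert_0:
  assumes "T \<subseteq> {..<n}"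
  shows "card {(i, j). i \<in> insert 0 (Suc ` T) \<and> j \<in> {..<Suc n} - insert 0 (Suc ` T) \<and> j < i}
       = card {(i, j). i \<in> T \<and> j \<in> {..<n} - T \<and> j < i}"
proof -
  have "{(i, j). i \<in> insert 0 (Suc ` T) \<and> j \<in> {..<Suc n} - insert 0 (Suc ` T) \<and> j < i}
      = map_prod Suc Suc ` {(i, j). i \<in> T \<and> j \<in> {..<n} - T \<and> j < i}"
    (is "?A = ?B")
  proof (intro set_eqI iffI)
    fix p assume "p \<in> ?A"
    then obtain i j where p: "p = (Suc i, j)" "i \<in> T" "j < Suc n" "j \<noteq> 0" "j \<notin> Suc ` T" "j < Suc i"
      by auto
    then obtain k where "j = Suc k" using not0_implies_Suc by blast
    then show "p \<in> ?B" using p by (auto simp: image_iff intro!: bexI[of _ "(i, k)"])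
  qed auto
  then show ?thesis by (simp add: card_image inj_on_def map_prod_def split_beta prod_eq_iff)
qed

text \<open>Position 0, when given to the right factor, is inverted with each of the positions of
  the left factor. These \<open>card T\<close> extra inversions are the sign recorded by
  \<open>twist\<close>.\<close>

lemma inversions_Suc_image:
  assumes "T \<subseteq> {..<n}"
  shows "card {(i, j). i \<in> Suc ` T \<and> j \<in> {..<Suc n} - Suc ` T \<and> j < i}
       = card T + card {(i, j). i \<in> T \<and> j \<in> {..<n} - T \<and> j < i}"
proof -
  have fT: "finite T" using assms finite_subset by blast
  have eq: "{(i, j). i \<in> Suc ` T \<and> j \<in> {..<Suc n} - Suc ` T \<and> j < i}
      = (\<lambda>i. (Suc i, 0)) ` T \<union> map_prod Suc Suc ` {(i, j). i \<in> T \<and> j \<in> {..<n} - T \<and> j < i}"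
    (is "?A = ?B")
  proof (intro set_eqI iffI)
    fix p assume "p \<in> ?A"
    then obtain i j where p: "p = (Suc i, j)" "i \<in> T" "j < Suc n" "j \<notin> Suc ` T" "j < Suc i"
      by auto
    show "p \<in> ?B"
    proof (cases j)
      case 0 then show ?thesis using p by auto
    next
      case (Suc k)
      then show ?thesis using p by (auto simp: image_iff intro!: bexI[of _ "(i, k)"])
    qed
  qed auto
  have f2: "finite {(i, j). i \<in> T \<and> j \<in> {..<n} - T \<and> j < i}"
    by (rule finite_subset[of _ "T \<times> {..<n}"]) (use fT in auto)
  show ?thesis unfolding eq
    by (subst card_Un_disjoint)
       (use fT f2 in \<open>auto simp: card_image inj_on_def map_prod_def split_beta prod_eq_iff\<close>)
qed

text \<open>Leibniz rule for the interior product. Together with \<open>wedge_Nil\<close> it characterises the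
  wedge product, so that algebraic identities follow by induction on the argument list.\<close>

lemma wedge_Cons:
  "(\<alpha> \<and>\<^sub>w \<beta>) (v # vs) = (insert_vec v \<alpha> \<and>\<^sub>w \<beta>) vs + (twist \<alpha> \<and>\<^sub>w insert_vec v \<beta>) vs"
proof -
  let ?n = "length vs"
  let ?inv = "\<lambda>m S. card {(i, j). i \<in> S \<and> j \<in> {..<m} - S \<and> j < i}"
  let ?g = "\<lambda>S. (-1::complex) ^ ?inv (Suc ?n) S * \<alpha> (nths (v # vs) S) * \<beta> (nths (v # vs) (- S))"
  have inj1: "inj_on (\<lambda>T. insert 0 (Suc ` T)) (Pow {..<?n})"
    by (rule inj_on_inverseI[where g = "\<lambda>S. {j. Suc j \<in> S}"]) auto
  have inj2: "inj_on (image Suc) (Pow {..<?n})"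
    by (simp add: inj_on_def inj_image_eq_iff)
  have "(\<alpha> \<and>\<^sub>w \<beta>) (v # vs) = (\<Sum>S\<in>Pow {..<Suc ?n}. ?g S)"
    by (simp add: wedge_def)
  also have "\<dots> = (\<Sum>T\<in>Pow {..<?n}. ?g (insert 0 (Suc ` T))) + (\<Sum>T\<in>Pow {..<?n}. ?g (Suc ` T))"
    unfolding Pow_lessThan_Suc
    by (subst sum.union_disjoint)
       (auto simp: sum.reindex[OF inj1] sum.reindex[OF inj2] simp del: insert_iff)
  also have "(\<Sum>T\<in>Pow {..<?n}. ?g (insert 0 (Suc ` T))) = (insert_vec v \<alpha> \<and>\<^sub>w \<beta>) vs"
    unfolding wedge_def
  proof (rule sum.cong[OF refl])
    fix T assume "T \<in> Pow {..<?n}"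
    then have "T \<subseteq> {..<?n}" by simp
    moreover have "{j. Suc j \<in> insert 0 (Suc ` T)} = T" "{j. Suc j \<in> - insert 0 (Suc ` T)} = - T"
      by auto
    ultimately show "?g (insert 0 (Suc ` T)) = (-1) ^ ?inv ?n T *
        insert_vec v \<alpha> (nths vs T) * \<beta> (nths vs (- T))"
      by (simp only: inversions_insert_0 nths_Cons insert_vec_def) simp
  qed
  also have "(\<Sum>T\<in>Pow {..<?n}. ?g (Suc ` T)) = (twist \<alpha> \<and>\<^sub>w insert_vec v \<beta>) vs"
    unfolding wedge_def
  proof (rule sum.cong[OF refl])
    fix T assume "T \<in> Pow {..<?n}"
    then have T: "T \<subseteq> {..<?n}" by simp
    moreover have "{j. Suc j \<in> Suc ` T} = T" "{j. Suc j \<in> - (Suc ` T)} = - T"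
      by auto
    moreover have "{i. i < ?n \<and> i \<in> T} = T" using T by auto
    then have "length (nths vs T) = card T" by (simp add: length_nths)
    ultimately show "?g (Suc ` T) = (-1) ^ ?inv ?n T *
        twist \<alpha> (nths vs T) * insert_vec v \<beta> (nths vs (- T))"
      by (simp only: inversions_Suc_image nths_Cons insert_vec_def twist_def) (simp add: power_add)
  qed
  finally show ?thesis .
qed

section \<open>Bilinearity, associativity and graded commutativity\<close>

lemma wedge_sum_left: "((\<lambda>vs. \<Sum>i\<in>I. \<alpha> i vs) \<and>\<^sub>w \<beta>) vs = (\<Sum>i\<in>I. (\<alpha> i \<and>\<^sub>w \<beta>) vs)"
  unfolding wedge_def sum_distrib_left sum_distrib_right by (rule sum.swap)

lemma wedge_sum_right: "(\<beta> \<and>\<^sub>w (\<lambda>vs. \<Sum>i\<in>I. \<alpha> i vs)) vs = (\<Sum>i\<in>I. (\<beta> \<and>\<^sub>w \<alpha> i) vs)"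
  unfolding wedge_def sum_distrib_left by (rule sum.swap)

lemma wedge_scale_left: "((\<lambda>vs. a * \<alpha> vs) \<and>\<^sub>w \<beta>) vs = a * (\<alpha> \<and>\<^sub>w \<beta>) vs"
  unfolding wedge_def sum_distrib_left by (rule sum.cong) auto

lemma wedge_scale_right: "(\<alpha> \<and>\<^sub>w (\<lambda>vs. a * \<beta> vs)) vs = a * (\<alpha> \<and>\<^sub>w \<beta>) vs"
  unfolding wedge_def sum_distrib_left by (rule sum.cong) auto

lemma wedge_add_left: "((\<lambda>vs. \<alpha> vs + \<beta> vs) \<and>\<^sub>w \<gamma>) vs = (\<alpha> \<and>\<^sub>w \<gamma>) vs + (\<beta> \<and>\<^sub>w \<gamma>) vs"
  unfolding wedge_def by (simp add: ring_distribs sum.distrib)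

lemma wedge_add_right: "(\<gamma> \<and>\<^sub>w (\<lambda>vs. \<alpha> vs + \<beta> vs)) vs = (\<gamma> \<and>\<^sub>w \<alpha>) vs + (\<gamma> \<and>\<^sub>w \<beta>) vs"
  unfolding wedge_def by (simp add: ring_distribs sum.distrib)

lemma wedge_diff_left: "((\<lambda>vs. \<alpha> vs - \<beta> vs) \<and>\<^sub>w \<gamma>) vs = (\<alpha> \<and>\<^sub>w \<gamma>) vs - (\<beta> \<and>\<^sub>w \<gamma>) vs"
  unfolding wedge_def by (simp add: ring_distribs sum_subtractf)

lemma wedge_zero_left: "((\<lambda>vs. 0) \<and>\<^sub>w \<beta>) vs = 0"
  by (simp add: wedge_def)

lemma wedge_zero_right: "(\<beta> \<and>\<^sub>w (\<lambda>vs. 0)) vs = 0"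
  by (simp add: wedge_def)

lemma cnj_form_wedge: "cnj_form (\<alpha> \<and>\<^sub>w \<beta>) = cnj_form \<alpha> \<and>\<^sub>w cnj_form \<beta>"
  by (simp add: cnj_form_def wedge_def)

lemma insert_vec_wedge:
  "insert_vec v (\<alpha> \<and>\<^sub>w \<beta>) = (\<lambda>vs. (insert_vec v \<alpha> \<and>\<^sub>w \<beta>) vs + (twist \<alpha> \<and>\<^sub>w insert_vec v \<beta>) vs)"
  by (rule ext) (simp add: insert_vec_def[of v "\<alpha> \<and>\<^sub>w \<beta>"] wedge_Cons)

lemma length_nths_Compl: "length (nths vs S) + length (nths vs (- S)) = length vs"
proof -
  have "{..<length vs} = {i. i < length vs \<and> i \<in> S} \<union> {i. i < length vs \<and> i \<in> - S}" by auto
  moreover have "{i. i < length vs \<and> i \<in> S} \<inter> {i. i < length vs \<and> i \<in> - S} = {}" by auto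
  ultimately have "length vs = card {i. i < length vs \<and> i \<in> S} + card {i. i < length vs \<and> i \<in> - S}"
    by (metis (no_types, lifting) card_Un_disjoint card_lessThan finite_Un finite_lessThan)
  then show ?thesis by (simp add: length_nths)
qed

lemma twist_wedge: "twist (\<alpha> \<and>\<^sub>w \<beta>) = twist \<alpha> \<and>\<^sub>w twist \<beta>"
proof
  fix vs :: "(complex^'a) list"
  have "(-1::complex) ^ length vs = (-1) ^ length (nths vs S) * (-1) ^ length (nths vs (- S))" for S
    unfolding power_add[symmetric] length_nths_Compl ..
  then show "twist (\<alpha> \<and>\<^sub>w \<beta>) vs = (twist \<alpha> \<and>\<^sub>w twist \<beta>) vs"
    unfolding twist_def wedge_def sum_distrib_left by (intro sum.cong) (simp_all add: ac_simps)
qed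

text \<open>Two applications of the Leibniz rule produce the same three terms on both sides, because
  \<open>twist\<close> is multiplicative. The forms are generalised in the induction since
  \<open>insert_vec\<close> and \<open>twist\<close> alter the factors.\<close>

lemma wedge_assoc: "(\<alpha> \<and>\<^sub>w \<beta>) \<and>\<^sub>w \<gamma> = \<alpha> \<and>\<^sub>w \<beta> \<and>\<^sub>w \<gamma>"
proof
  fix vs
  show "((\<alpha> \<and>\<^sub>w \<beta>) \<and>\<^sub>w \<gamma>) vs = (\<alpha> \<and>\<^sub>w \<beta> \<and>\<^sub>w \<gamma>) vs"
  proof (induction vs arbitrary: \<alpha> \<beta> \<gamma>)
    case Nil show ?case by (simp add: wedge_Nil)
  next
    case (Cons v vs)
    show ?case
      unfolding wedge_Cons insert_vec_wedge wedge_add_left wedge_add_right twist_wedge Cons.IH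
      by simp
  qed
qed

lemma degree_form_insert_vec: "degree_form (Suc k) \<alpha> \<Longrightarrow> degree_form k (insert_vec v \<alpha>)"
  by (simp add: degree_form_def insert_vec_def)

lemma insert_vec_degree_0: "degree_form 0 \<alpha> \<Longrightarrow> insert_vec v \<alpha> = (\<lambda>vs. 0)"
  by (auto simp: degree_form_def insert_vec_def)

lemma twist_degree: "degree_form k \<alpha> \<Longrightarrow> twist \<alpha> = (\<lambda>vs. (-1) ^ k * \<alpha> vs)"
  by (rule ext) (auto simp: degree_form_def twist_def)

text \<open>The Leibniz rule exchanges its two terms when the factors are exchanged. The degrees
  vary in the induction because the interior product lowers one of them by one; for a form of degree
  0 it is zero.\<close>

lemma wedge_commute:
  assumes "degree_form p \<alpha>" "degree_form q \<beta>"
  shows "\<alpha> \<and>\<^sub>w \<beta> = (\<lambda>vs. (-1) ^ (p * q) * (\<beta> \<and>\<^sub>w \<alpha>) vs)"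
proof
  fix vs
  show "(\<alpha> \<and>\<^sub>w \<beta>) vs = (-1) ^ (p * q) * (\<beta> \<and>\<^sub>w \<alpha>) vs"
    using assms
  proof (induction vs arbitrary: \<alpha> \<beta> p q)
    case Nil
    then show ?case by (cases p; cases q) (auto simp: wedge_Nil degree_form_def)
  next
    case (Cons v vs)
    have 1: "(insert_vec v \<alpha> \<and>\<^sub>w \<beta>) vs = (-1) ^ (p * q) * (twist \<beta> \<and>\<^sub>w insert_vec v \<alpha>) vs"
    proof (cases p)
      case 0
      then show ?thesis
        using Cons.prems by (simp add: insert_vec_degree_0 wedge_zero_left wedge_zero_right)
    next
      case (Suc p')
      then have "degree_form p' (insert_vec v \<alpha>)"
        using Cons.prems degree_form_insert_vec by blast
      from Cons.IH[OF this Cons.prems(2)] show ?thesis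
        unfolding twist_degree[OF Cons.prems(2)] wedge_scale_left Suc
        by (simp add: power_add flip: mult.assoc power_mult_distrib)
    qed
    have 2: "(twist \<alpha> \<and>\<^sub>w insert_vec v \<beta>) vs = (-1) ^ (p * q) * (insert_vec v \<beta> \<and>\<^sub>w \<alpha>) vs"
    proof (cases q)
      case 0
      then show ?thesis
        using Cons.prems by (simp add: insert_vec_degree_0 wedge_zero_left wedge_zero_right)
    next
      case (Suc q')
      then have "degree_form q' (insert_vec v \<beta>)"
        using Cons.prems degree_form_insert_vec by blast
      from Cons.IH[OF Cons.prems(1) this] show ?thesis
        unfolding twist_degree[OF Cons.prems(1)] wedge_scale_left Suc
        by (simp add: power_add)
    qed
    show ?case unfolding wedge_Cons 1 2 by (simp add: algebra_simps)
  qed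
qed

lemma wedge_commute_even:
  assumes "degree_form p \<alpha>" "degree_form q \<beta>" "even p"
  shows "\<alpha> \<and>\<^sub>w \<beta> = \<beta> \<and>\<^sub>w \<alpha>"
  using wedge_commute[OF assms(1,2)] assms(3) by simp

lemma degree_form_wedge:
  assumes "degree_form p \<alpha>" "degree_form q \<beta>"
  shows "degree_form (p + q) (\<alpha> \<and>\<^sub>w \<beta>)"
  unfolding degree_form_def wedge_def
proof (intro allI impI sum.neutral ballI)
  fix vs :: "(complex^'a) list" and S assume "length vs \<noteq> p + q"
  then have "length (nths vs S) \<noteq> p \<or> length (nths vs (- S)) \<noteq> q"
    using length_nths_Compl[of vs S] by auto
  then show "(-1) ^ card {(i, j). i \<in> S \<and> j \<in> {..<length vs} - S \<and> j < i} *
      \<alpha> (nths vs S) * \<beta> (nths vs (- S)) = 0"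
    using assms by (auto simp: degree_form_def)
qed

lemma degree_form_const: "degree_form 0 (const_form a)"
  by (simp add: degree_form_def const_form_def)

lemma degree_form_cnj: "degree_form k \<alpha> \<Longrightarrow> degree_form k (cnj_form \<alpha>)"
  by (simp add: degree_form_def cnj_form_def)

lemma degree_form_scale: "degree_form k \<alpha> \<Longrightarrow> degree_form k (scale_form a \<alpha>)"
  by (simp add: degree_form_def scale_form_def)

lemma degree_form_sum: "(\<And>i. i \<in> I \<Longrightarrow> degree_form k (\<alpha> i)) \<Longrightarrow> degree_form k (\<lambda>vs. \<Sum>i\<in>I. \<alpha> i vs)"
  by (simp add: degree_form_def)

lemma degree_form_mult: "degree_form k \<alpha> \<Longrightarrow> degree_form k (\<lambda>vs. a * \<alpha> vs)"
  by (simp add: degree_form_def)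

lemma wedge_const_right: "(\<alpha> \<and>\<^sub>w const_form a) vs = a * \<alpha> vs"
proof (induction vs arbitrary: \<alpha>)
  case Nil show ?case by (simp add: wedge_Nil const_form_def)
next
  case (Cons v vs)
  then show ?case
    by (simp add: wedge_Cons insert_vec_degree_0[OF degree_form_const] wedge_zero_right)
       (simp add: insert_vec_def)
qed

lemma wedge_const_left: "(const_form a \<and>\<^sub>w \<alpha>) vs = a * \<alpha> vs"
proof (induction vs arbitrary: \<alpha>)
  case Nil show ?case by (simp add: wedge_Nil const_form_def)
next
  case (Cons v vs)
  then show ?case
    by (simp add: wedge_Cons insert_vec_degree_0[OF degree_form_const] wedge_zero_left
        twist_degree[OF degree_form_const])
       (simp add: insert_vec_def)
qed

lemma wedge_list_Nil: "wedge_list [] = const_form 1"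
  by (simp add: wedge_list_def)

lemma wedge_list_Cons: "wedge_list (\<alpha> # \<alpha>s) = \<alpha> \<and>\<^sub>w wedge_list \<alpha>s"
  by (simp add: wedge_list_def)

lemma wedge_list_append: "wedge_list (\<alpha>s @ \<beta>s) = wedge_list \<alpha>s \<and>\<^sub>w wedge_list \<beta>s"
proof (induction \<alpha>s)
  case Nil show ?case by (rule ext) (simp add: wedge_list_Nil wedge_const_left)
next
  case (Cons a \<alpha>s) then show ?case by (simp add: wedge_list_Cons wedge_assoc)
qed

lemma degree_form_wedge_list:
  "(\<And>\<alpha>. \<alpha> \<in> set \<alpha>s \<Longrightarrow> degree_form k \<alpha>) \<Longrightarrow> degree_form (length \<alpha>s * k) (wedge_list \<alpha>s)"
  by (induction \<alpha>s) (auto simp: wedge_list_Nil degree_form_const wedge_list_Cons intro!: degree_form_wedge)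

lemma degree_form_dz: "degree_form 1 (dz j)"
  by (auto simp: degree_form_def dz_def split: list.splits)

lemma degree_form_dzbar: "degree_form 1 (dzbar j)"
  unfolding dzbar_def by (intro degree_form_cnj degree_form_dz)

lemma degree_form_bidegree:
  assumes "bidegree p q \<alpha>"
  shows "degree_form (p + q) \<alpha>"
proof -
  obtain c where c: "\<And>vs. \<alpha> vs = (\<Sum>I | length I = p. \<Sum>J | length J = q.
               c I J * wedge_list (map dz I @ map dzbar J) vs)"
    using assms unfolding bidegree_def by blast
  have "degree_form (length (map dz I @ map dzbar J) * 1) (wedge_list (map dz I @ map dzbar J))" for I J :: "'a list"
    by (rule degree_form_wedge_list) (auto simp: degree_form_dz degree_form_dzbar simp del: One_nat_def)
  then show ?thesis unfolding c[abs_def]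
    by (intro degree_form_sum degree_form_mult) auto
qed

lemma cnj_form_const: "cnj_form (const_form a) = const_form (cnj a)"
  by (auto simp: cnj_form_def const_form_def)

section \<open>Positive semidefinite Hermitian forms\<close>

text \<open>Hermitian symmetry is not demanded, since it follows from the vanishing imaginary parts.
  The index set is a parameter so that a decomposition can remove one index at a time.\<close>

definition pos_semidef_on :: "'i set \<Rightarrow> ('i \<Rightarrow> 'i \<Rightarrow> complex) \<Rightarrow> bool" where
  "pos_semidef_on S M \<longleftrightarrow> (\<forall>v :: 'i \<Rightarrow> complex.
     Im (\<Sum>j\<in>S. \<Sum>k\<in>S. M j k * v j * cnj (v k)) = 0 \<and>
     Re (\<Sum>j\<in>S. \<Sum>k\<in>S. M j k * v j * cnj (v k)) \<ge> 0)"

lemma double_sum_support2: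
  fixes f :: "'i \<Rightarrow> 'i \<Rightarrow> complex"
  assumes "finite S" "p \<in> S" "q \<in> S" "p \<noteq> q"
    and "\<And>j k. j \<notin> {p, q} \<or> k \<notin> {p, q} \<Longrightarrow> f j k = 0"
  shows "(\<Sum>j\<in>S. \<Sum>k\<in>S. f j k) = f p p + f p q + f q p + f q q"
proof -
  have 1: "(\<Sum>k\<in>S. f j k) = (\<Sum>k\<in>{p,q}. f j k)" for j
    by (rule sum.mono_neutral_right) (use assms in auto)
  have "(\<Sum>j\<in>S. \<Sum>k\<in>S. f j k) = (\<Sum>j\<in>{p,q}. \<Sum>k\<in>{p,q}. f j k)"
    unfolding 1 by (rule sum.mono_neutral_right) (use assms in auto)
  then show ?thesis using assms(4) by simp
qed

lemma pos_semidef_diag: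
  assumes "finite S" "pos_semidef_on S M" "p \<in> S"
  shows "Im (M p p) = 0" "Re (M p p) \<ge> 0"
proof -
  let ?v = "\<lambda>j. if j = p then 1 else 0 :: complex"
  have "(\<Sum>j\<in>S. \<Sum>k\<in>S. M j k * ?v j * cnj (?v k)) = M p p"
  proof -
    have "(\<Sum>k\<in>S. M j k * ?v j * cnj (?v k)) = (if j = p then M p p else 0)" for j
      using assms by (simp add: if_distrib[of cnj] if_distrib[of "(*) _"] sum.delta cong: if_cong)
    then show ?thesis using assms by (simp add: sum.delta)
  qed
  then show "Im (M p p) = 0" "Re (M p p) \<ge> 0"
    using assms(2)[unfolded pos_semidef_on_def, rule_format, of ?v] by simp_all
qed

lemma pos_semidef_pair:
  assumes "finite S" "pos_semidef_on S M" "p \<in> S" "q \<in> S" "p \<noteq> q"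
  shows "Im (M p p * a * cnj a + M p q * a * cnj b + M q p * b * cnj a + M q q * b * cnj b) = 0"
    "Re (M p p * a * cnj a + M p q * a * cnj b + M q p * b * cnj a + M q q * b * cnj b) \<ge> 0"
proof -
  let ?v = "\<lambda>j. if j = p then a else if j = q then b else 0"
  have "(\<Sum>j\<in>S. \<Sum>k\<in>S. M j k * ?v j * cnj (?v k)) =
    M p p * a * cnj a + M p q * a * cnj b + M q p * b * cnj a + M q q * b * cnj b"
    by (subst double_sum_support2[OF assms(1,3,4,5)]) (use assms in auto)
  then show "Im (M p p * a * cnj a + M p q * a * cnj b + M q p * b * cnj a + M q q * b * cnj b) = 0"
    "Re (M p p * a * cnj a + M p q * a * cnj b + M q p * b * cnj a + M q q * b * cnj b) \<ge> 0"
    using assms(2)[unfolded pos_semidef_on_def, rule_format, of ?v] by (simp_all only:)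
qed

text \<open>Polarization: the vectors with entries (1, 1) and (1, i) at p and q give the imaginary
  and the real part of the identity.\<close>

lemma pos_semidef_hermitian:
  assumes "finite S" "pos_semidef_on S M" "p \<in> S" "q \<in> S"
  shows "M q p = cnj (M p q)"
proof (cases "p = q")
  case True
  then show ?thesis using pos_semidef_diag[OF assms(1,2,3)] by (simp add: complex_eq_iff)
next
  case False
  note P = pos_semidef_pair[OF assms False]
  show ?thesis
    using P(1)[of 1 1] P(1)[of 1 \<i>] pos_semidef_diag[OF assms(1,2,3)] pos_semidef_diag[OF assms(1,2,4)]
    by (simp add: complex_eq_iff)
qed

text \<open>With a vanishing diagonal entry the form is affine in a real multiple placed at p, so a
  nonzero off-diagonal entry would let it become negative.\<close>

lemma pos_semidef_zero_diag:
  assumes "finite S" "pos_semidef_on S M" "p \<in> S" "q \<in> S" "M p p = 0"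
  shows "M p q = 0"
proof (cases "p = q")
  case True then show ?thesis using assms by simp
next
  case False
  note P = pos_semidef_pair[OF assms(1-4) False]
  have h: "M q p = cnj (M p q)" by (rule pos_semidef_hermitian[OF assms(1-4)])
  define s where "s = Re (M q q)"
  have s0: "s \<ge> 0" "M q q = of_real s"
    using pos_semidef_diag[OF assms(1,2,4)] by (auto simp: s_def complex_eq_iff)
  define m where "m = (Re (M p q))\<^sup>2 + (Im (M p q))\<^sup>2"
  have m: "m \<ge> 0" by (simp add: m_def)
  \<comment> \<open>The entries are -(s+1) at p and \<open>M p q\<close> at q; the value of the form
    is then -(s+2) m with m = |M p q|^2.\<close>
  have "2 * (- (s + 1)) * m + s * m \<ge> 0"
    using P(2)[of "- of_real (s + 1)" "M p q"] s0
    by (simp add: h assms(5) algebra_simps m_def power2_eq_square)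
  then have "(- s - 2) * m \<ge> 0" by (simp add: algebra_simps)
  then have "m \<le> 0" using s0 by (simp add: zero_le_mult_iff m)
  then show ?thesis by (simp add: m_def sum_power2_le_zero_iff complex_eq_iff)
qed

text \<open>Completing the square, one index at a time.\<close>

lemma pos_semidef_decompose:
  fixes M :: "'i \<Rightarrow> 'i \<Rightarrow> complex"
  assumes "finite S" "pos_semidef_on S M"
  shows "\<exists>B :: ('i \<Rightarrow> complex) list. \<forall>j\<in>S. \<forall>k\<in>S. M j k = (\<Sum>b\<leftarrow>B. b j * cnj (b k))"
  using assms
proof (induction S arbitrary: M rule: finite_induct)
  case empty then show ?case by auto
next
  case (insert p S)
  let ?T = "insert p S"
  have fT: "finite ?T" using insert.hyps by simp
  have herm: "M k j = cnj (M j k)" if "j \<in> ?T" "k \<in> ?T" for j k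
    by (rule pos_semidef_hermitian[OF fT insert.prems that])
  define r where "r = Re (M p p)"
  have r: "M p p = of_real r" "r \<ge> 0"
    using pos_semidef_diag[OF fT insert.prems, of p] by (auto simp: r_def complex_eq_iff)
  \<comment> \<open>The column of the pivot, normalised. If the pivot is 0, division by zero makes
    \<open>b\<close> vanish, in agreement with the vanishing of that row and column, so no separate
    case is needed in the definition.\<close>
  define b where "b = (\<lambda>j. M j p / of_real (sqrt r))"
  have bb: "b j * cnj (b k) = M j p * M p k / of_real r" if "j \<in> ?T" "k \<in> ?T" for j k
  proof -
    have "of_real (sqrt r) * of_real (sqrt r) = (of_real r :: complex)"
      using r(2) by (simp flip: of_real_mult)
    then show ?thesis using herm[of k p] herm[of p k] that by (simp add: b_def)
  qed
  have r0: "M p j = 0" "M j p = 0" if "r = 0" "j \<in> ?T" for j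
    using pos_semidef_zero_diag[OF fT insert.prems, of p j] herm[of p j] that r by auto
  let ?N = "\<lambda>j k. M j k - b j * cnj (b k)"
  have N0: "?N p k = 0" "?N k p = 0" if "k \<in> ?T" for k
    using bb[of p k] bb[of k p] that r r0[OF _ that] by (cases "r = 0"; simp)+
  have "pos_semidef_on S ?N"
    unfolding pos_semidef_on_def
  proof
    fix v :: "'i \<Rightarrow> complex"
    \<comment> \<open>The value at p that makes the pairing of w with \<open>b\<close> vanish. The
      rank one term then contributes nothing at w, and the remainder at v equals \<open>M\<close> at
      w. For a zero pivot the default value 0 serves.\<close>
    define c where "c = - (\<Sum>j\<in>S. M j p * v j) / of_real r"
    define w where "w = (\<lambda>j. if j = p then c else v j)"
    have "(\<Sum>j\<in>?T. \<Sum>k\<in>?T. ?N j k * w j * cnj (w k)) = (\<Sum>j\<in>S. \<Sum>k\<in>S. ?N j k * v j * cnj (v k))"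
    proof -
      have "(\<Sum>j\<in>?T. \<Sum>k\<in>?T. ?N j k * w j * cnj (w k)) = (\<Sum>j\<in>S. \<Sum>k\<in>S. ?N j k * w j * cnj (w k))"
        using insert.hyps N0 by (simp add: sum.distrib)
      also have "\<dots> = (\<Sum>j\<in>S. \<Sum>k\<in>S. ?N j k * v j * cnj (v k))"
        using insert.hyps by (intro sum.cong refl) (auto simp: w_def)
      finally show ?thesis .
    qed
    moreover have "(\<Sum>j\<in>?T. \<Sum>k\<in>?T. b j * cnj (b k) * w j * cnj (w k)) = 0"
    proof -
      have "(\<Sum>j\<in>?T. M j p * w j) = of_real r * c + (\<Sum>j\<in>S. M j p * v j)"
        using insert.hyps by (simp add: w_def r) (rule sum.cong, auto)
      also have "\<dots> = 0"
        using r0(2) by (cases "r = 0") (auto simp: c_def intro!: sum.neutral)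
      finally have "(\<Sum>j\<in>?T. b j * w j) = 0"
        unfolding b_def times_divide_eq_left sum_divide_distrib[symmetric] by simp
      moreover have "(\<Sum>j\<in>?T. \<Sum>k\<in>?T. b j * cnj (b k) * w j * cnj (w k)) =
          (\<Sum>j\<in>?T. b j * w j) * (\<Sum>k\<in>?T. cnj (b k) * cnj (w k))"
        by (simp only: sum_product) (simp only: ac_simps)
      ultimately show ?thesis by (simp only: mult_zero_left)
    qed
    ultimately have "(\<Sum>j\<in>S. \<Sum>k\<in>S. ?N j k * v j * cnj (v k)) =
        (\<Sum>j\<in>?T. \<Sum>k\<in>?T. M j k * w j * cnj (w k))"
      by (simp only: left_diff_distrib sum_subtractf) simp
    then show "Im (\<Sum>j\<in>S. \<Sum>k\<in>S. ?N j k * v j * cnj (v k)) = 0 \<and>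
        0 \<le> Re (\<Sum>j\<in>S. \<Sum>k\<in>S. ?N j k * v j * cnj (v k))"
      using insert.prems unfolding pos_semidef_on_def by simp
  qed
  from insert.IH[OF this] obtain B where
    B: "\<And>j k. j \<in> S \<Longrightarrow> k \<in> S \<Longrightarrow> ?N j k = (\<Sum>b\<leftarrow>B. b j * cnj (b k))" by blast
  \<comment> \<open>The vectors from the induction hypothesis are uncontrolled at p, hence are set
    to 0 there; row and column p are already produced by \<open>b\<close>.\<close>
  define B' where "B' = b # map (\<lambda>f. f(p := 0)) B"
  have "M j k = (\<Sum>b\<leftarrow>B'. b j * cnj (b k))" if "j \<in> ?T" "k \<in> ?T" for j k
  proof (cases "j = p \<or> k = p")
    case True
    then have "(\<Sum>f\<leftarrow>B. (f(p := 0)) j * cnj ((f(p := 0)) k)) = 0"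
      by (intro sum_list_0[of B, THEN trans[rotated]] arg_cong[where f = sum_list] map_cong) auto
    moreover have "?N j k = 0" using N0 True that by blast
    ultimately show ?thesis by (simp add: B'_def o_def)
  next
    case False
    then have "(\<Sum>f\<leftarrow>B. (f(p := 0)) j * cnj ((f(p := 0)) k)) = (\<Sum>f\<leftarrow>B. f j * cnj (f k))"
      by simp
    moreover have "?N j k = (\<Sum>b\<leftarrow>B. b j * cnj (b k))" using B that False by blast
    ultimately show ?thesis by (simp add: B'_def o_def algebra_simps)
  qed
  then show ?case by blast
qed

section \<open>Positive forms of bidegree \<open>(1,1)\<close>\<close>

lemma wedge_scale_left_ext: "(\<lambda>vs. a * \<alpha> vs) \<and>\<^sub>w \<beta> = (\<lambda>vs. a * (\<alpha> \<and>\<^sub>w \<beta>) vs)"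
  by (rule ext) (rule wedge_scale_left)

lemma wedge_scale_right_ext: "\<alpha> \<and>\<^sub>w (\<lambda>vs. a * \<beta> vs) = (\<lambda>vs. a * (\<alpha> \<and>\<^sub>w \<beta>) vs)"
  by (rule ext) (rule wedge_scale_right)

lemma wedge_sum_left_ext: "(\<lambda>vs. \<Sum>i\<in>I. \<alpha> i vs) \<and>\<^sub>w \<beta> = (\<lambda>vs. \<Sum>i\<in>I. (\<alpha> i \<and>\<^sub>w \<beta>) vs)"
  by (rule ext) (rule wedge_sum_left)

text \<open>Each covector moved to the front passes factors of degree 1 and contributes a sign. The
  sign stays unspecified because only absolute values of determinants enter later.\<close>

lemma wedge_list_mset:
  assumes "\<forall>\<alpha>\<in>set \<alpha>s. degree_form 1 \<alpha>" "mset \<alpha>s = mset \<beta>s"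
  shows "\<exists>s. (s = 1 \<or> s = -1) \<and> wedge_list \<alpha>s = (\<lambda>vs. s * wedge_list \<beta>s vs)"
  using assms
proof (induction \<alpha>s arbitrary: \<beta>s)
  case Nil
  then show ?case by (auto intro: exI[of _ 1])
next
  case (Cons \<alpha> \<alpha>s)
  have "\<alpha> \<in> set \<beta>s" using Cons.prems(2) by (metis list.set_intros(1) set_mset_mset)
  then obtain \<beta>1 \<beta>2 where b: "\<beta>s = \<beta>1 @ \<alpha> # \<beta>2" by (meson split_list)
  then have m: "mset \<alpha>s = mset (\<beta>1 @ \<beta>2)" using Cons.prems(2) by simp
  from Cons.IH[OF _ this] Cons.prems(1) obtain s where
    s: "s = 1 \<or> s = -1" "wedge_list \<alpha>s = (\<lambda>vs. s * wedge_list (\<beta>1 @ \<beta>2) vs)" by auto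
  have "set \<beta>1 \<subseteq> set \<alpha>s" using arg_cong[OF m, of set_mset] by auto
  then have d: "degree_form (length \<beta>1) (wedge_list \<beta>1)"
    using degree_form_wedge_list[of \<beta>1 1] Cons.prems(1) by auto
  have "wedge_list \<beta>s = wedge_list \<beta>1 \<and>\<^sub>w \<alpha> \<and>\<^sub>w wedge_list \<beta>2"
    by (simp add: b wedge_list_append wedge_list_Cons)
  also have "\<dots> = (\<lambda>vs. (-1) ^ (length \<beta>1 * 1) * (\<alpha> \<and>\<^sub>w wedge_list \<beta>1) vs) \<and>\<^sub>w wedge_list \<beta>2"
    using wedge_commute[OF d, of 1 \<alpha>] Cons.prems(1) by (simp add: wedge_assoc[symmetric])
  also have "\<dots> = (\<lambda>vs. (-1) ^ length \<beta>1 * (\<alpha> \<and>\<^sub>w wedge_list (\<beta>1 @ \<beta>2)) vs)"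
    by (rule ext) (simp add: wedge_scale_left wedge_assoc wedge_list_append)
  finally have b2: "wedge_list \<beta>s = \<dots>" .
  have "wedge_list (\<alpha> # \<alpha>s) = (\<lambda>vs. (s * (-1) ^ length \<beta>1) * wedge_list \<beta>s vs)"
    unfolding b2 wedge_list_Cons s(2)
    by (rule ext) (simp add: wedge_scale_right flip: power_add mult.assoc)
  moreover have "s * (-1) ^ length \<beta>1 = 1 \<or> s * (-1) ^ length \<beta>1 = -1"
    using s(1) by (cases "even (length \<beta>1)") auto
  ultimately show ?case by blast
qed

lemma wedge_same: "degree_form 1 \<alpha> \<Longrightarrow> \<alpha> \<and>\<^sub>w \<alpha> = (\<lambda>vs. 0)"
proof
  fix vs assume "degree_form 1 \<alpha>"
  from fun_cong[OF wedge_commute[OF this this], of vs]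
  have "(\<alpha> \<and>\<^sub>w \<alpha>) vs = - (\<alpha> \<and>\<^sub>w \<alpha>) vs" by simp
  then show "(\<alpha> \<and>\<^sub>w \<alpha>) vs = 0" by simp
qed

lemma wedge_list_not_distinct:
  assumes "\<forall>\<alpha>\<in>set \<alpha>s. degree_form 1 \<alpha>" "\<not> distinct \<alpha>s"
  shows "wedge_list \<alpha>s = (\<lambda>vs. 0)"
proof -
  obtain xs ys zs \<alpha> where d: "\<alpha>s = xs @ [\<alpha>] @ ys @ [\<alpha>] @ zs"
    using not_distinct_decomp[OF assms(2)] by blast
  have "mset \<alpha>s = mset (\<alpha> # \<alpha> # xs @ ys @ zs)" by (simp add: d)
  from wedge_list_mset[OF assms(1) this] obtain s where
    "wedge_list \<alpha>s = (\<lambda>vs. s * wedge_list (\<alpha> # \<alpha> # xs @ ys @ zs) vs)" by blast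
  moreover have "degree_form 1 \<alpha>" using assms(1) d by simp
  ultimately show ?thesis
    by (simp add: wedge_list_Cons wedge_same wedge_zero_left fun_eq_iff flip: wedge_assoc)
qed

section \<open>Covectors, squares and Hermitian (1,1)-forms\<close>

definition lin_form :: "complex^'n::finite \<Rightarrow> 'n form" where
  "lin_form g = (\<lambda>vs. \<Sum>j\<in>UNIV. g $ j * dz j vs)"

text \<open>The positive rank one forms, which are the factors in the definition of
  \<open>weakly_nonneg\<close>.\<close>

definition sq_form :: "complex^'n::finite \<Rightarrow> 'n form" where
  "sq_form g = scale_form \<i> (lin_form g) \<and>\<^sub>w cnj_form (lin_form g)"

text \<open>With the factor i inside the basis forms, Hermitian matrices correspond to real forms
  and positive definite ones to positive forms.\<close>

definition herm_form :: "('n::finite \<Rightarrow> 'n \<Rightarrow> complex) \<Rightarrow> 'n form" where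
  "herm_form M = (\<lambda>vs. \<Sum>j\<in>UNIV. \<Sum>k\<in>UNIV. M j k * (scale_form \<i> (dz j) \<and>\<^sub>w dzbar k) vs)"

lemma degree_form_lin: "degree_form 1 (lin_form g)"
  unfolding lin_form_def by (intro degree_form_sum degree_form_mult degree_form_dz)

lemma degree_form_sq: "degree_form 2 (sq_form g)"
  unfolding sq_form_def one_add_one[symmetric]
  by (intro degree_form_wedge degree_form_scale degree_form_cnj degree_form_lin)

lemma lin_form_axis: "lin_form (axis j a) = (\<lambda>vs. a * dz j vs)"
  by (simp add: lin_form_def axis_def if_distrib[of "\<lambda>x. x * _"] sum.delta' cong: if_cong)

lemma sq_form_eq_herm: "sq_form g = herm_form (\<lambda>j k. g $ j * cnj (g $ k))"
proof
  fix vs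
  have 1: "scale_form \<i> (lin_form g) = (\<lambda>vs. \<Sum>j\<in>UNIV. g $ j * scale_form \<i> (dz j) vs)"
    by (rule ext) (simp add: scale_form_def lin_form_def sum_distrib_left ac_simps)
  have 2: "cnj_form (lin_form g) = (\<lambda>vs. \<Sum>k\<in>UNIV. cnj (g $ k) * dzbar k vs)"
    by (rule ext) (simp add: cnj_form_def lin_form_def dzbar_def)
  show "sq_form g vs = herm_form (\<lambda>j k. g $ j * cnj (g $ k)) vs"
    unfolding sq_form_def 1 2 wedge_sum_left wedge_sum_right wedge_scale_left wedge_scale_right herm_form_def
    by (simp add: ac_simps)
qed

lemma lists_length_1: "{I. length I = 1} = range (\<lambda>i. [i])"
  by (auto simp: length_Suc_conv)

lemma lists_length_0: "{J. length J = 0} = {[]}"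
  by auto

lemma bidegree_1_0_lin: "bidegree 1 0 (lin_form g)"
proof -
  show ?thesis unfolding bidegree_def lists_length_1 lists_length_0
    by (rule exI[of _ "\<lambda>I J. g $ hd I"])
       (auto simp: sum.reindex inj_on_def lin_form_def wedge_list_Cons wedge_list_Nil wedge_const_right)
qed

lemma bidegree_1_0_imp_lin:
  assumes "bidegree 1 0 \<alpha>" shows "\<exists>g. \<alpha> = lin_form g"
proof -
  obtain c where c: "\<And>vs. \<alpha> vs = (\<Sum>I | length I = 1. \<Sum>J | length J = 0.
               c I J * wedge_list (map dz I @ map dzbar J) vs)"
    using assms unfolding bidegree_def by blast
  have "\<alpha> = lin_form (\<chi> i. c [i] [])"
    by (rule ext)
       (simp add: c[unfolded lists_length_1 lists_length_0] sum.reindex inj_on_def lin_form_def wedge_list_Cons wedge_list_Nil wedge_const_right)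
  then show ?thesis by blast
qed

lemma bidegree_1_1_imp_herm:
  assumes "bidegree 1 1 \<omega>" shows "\<exists>M. \<omega> = herm_form M"
proof -
  obtain c where c: "\<And>vs. \<omega> vs = (\<Sum>I | length I = 1. \<Sum>J | length J = 1.
               c I J * wedge_list (map dz I @ map dzbar J) vs)"
    using assms unfolding bidegree_def by blast
  have s: "scale_form \<i> (dz j) \<and>\<^sub>w dzbar k = (\<lambda>vs. \<i> * (dz j \<and>\<^sub>w dzbar k) vs)" for j k :: 'a
    by (rule ext) (simp add: scale_form_def wedge_scale_left)
  have w1: "dzbar k \<and>\<^sub>w const_form 1 = dzbar k" for k :: 'a
    by (rule ext) (simp add: wedge_const_right)
  have ii: "\<i> * a * (\<i> * b) = - (a * b)" for a b :: complex by (simp add: complex_eq_iff)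
  have "\<omega> = herm_form (\<lambda>j k. - \<i> * c [j] [k])"
    by (rule ext)
       (simp add: c[unfolded lists_length_1] sum.reindex inj_on_def herm_form_def wedge_list_Cons wedge_list_Nil w1 s ii)
  then show ?thesis by blast
qed

lemma insert_vec_1: "degree_form 1 \<theta> \<Longrightarrow> insert_vec v \<theta> = const_form (\<theta> [v])"
  by (auto simp: degree_form_def insert_vec_def const_form_def)

lemma wedge_1_Cons:
  assumes "degree_form 1 \<theta>"
  shows "(\<theta> \<and>\<^sub>w \<beta>) (v # vs) = \<theta> [v] * \<beta> vs - (\<theta> \<and>\<^sub>w insert_vec v \<beta>) vs"
  unfolding wedge_Cons insert_vec_1[OF assms] twist_degree[OF assms] wedge_const_left wedge_scale_left
  by simp

lemma wedge_1_vanish: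
  assumes "degree_form 1 \<theta>" "\<forall>v\<in>set vs. \<theta> [v] = 0"
  shows "(\<theta> \<and>\<^sub>w \<beta>) vs = 0"
  using assms(2)
proof (induction vs arbitrary: \<beta>)
  case Nil
  then show ?case using assms(1) by (simp add: wedge_Nil degree_form_def)
qed (simp add: wedge_1_Cons[OF assms(1)])

text \<open>Among the arguments only e_j and i e_j are seen by dz_j and its conjugate, and i dz_j
  wedge its conjugate has the value 2 on this pair. Induction then evaluates a product of coordinate
  squares.\<close>

lemma sq_axis_wedge:
  assumes "\<forall>v\<in>set vs. v $ j = 0"
  shows "(sq_form (axis j 1) \<and>\<^sub>w \<beta>) (axis j 1 # \<i> *s axis j 1 # vs) = 2 * \<beta> vs"
proof -
  have l: "lin_form (axis j 1) = dz j" by (simp add: lin_form_axis)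
  have d: "dz j [v] = v $ j" "dzbar j [v] = cnj (v $ j)" for v by (simp_all add: dz_def dzbar_def cnj_form_def)
  have z: "(dz j \<and>\<^sub>w \<gamma>) vs = 0" "(dzbar j \<and>\<^sub>w \<gamma>) vs = 0" for \<gamma>
    by (rule wedge_1_vanish[OF degree_form_dz] wedge_1_vanish[OF degree_form_dzbar]; use assms d in simp)+
  have "sq_form (axis j 1) \<and>\<^sub>w \<beta> = (\<lambda>vs. \<i> * (dz j \<and>\<^sub>w dzbar j \<and>\<^sub>w \<beta>) vs)"
    by (rule ext)
       (simp add: sq_form_def l scale_form_def wedge_assoc wedge_scale_left flip: dzbar_def)
  then show ?thesis
    by (simp add: wedge_1_Cons[OF degree_form_dz] wedge_1_Cons[OF degree_form_dzbar] d z insert_vec_def[of _ "dzbar j \<and>\<^sub>w \<beta>"])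
qed

lemma wedge_list_sq_axis:
  assumes "distinct L"
  shows "wedge_list (map (\<lambda>j. sq_form (axis j 1)) L) (real_basis_of (map (\<lambda>j. axis j 1) L)) = 2 ^ length L"
  using assms
proof (induction L)
  case Nil then show ?case by (simp add: wedge_list_Nil real_basis_of_def const_form_def)
next
  case (Cons j L)
  have "\<forall>v\<in>set (real_basis_of (map (\<lambda>j. axis j 1) L)). v $ j = 0"
    using Cons.prems by (auto simp: real_basis_of_def axis_def)
  from sq_axis_wedge[OF this] Cons show ?case
    by (simp add: wedge_list_Cons real_basis_of_def)
qed

section \<open>Products of n squares evaluated on the standard frame\<close>

definition index_list :: "'n::finite list" where
  "index_list = (SOME L. distinct L \<and> set L = UNIV)"

lemma index_list: "distinct (index_list :: 'n::finite list)" "set (index_list :: 'n list) = UNIV"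
  using someI_ex[of "\<lambda>L :: 'n list. distinct L \<and> set L = UNIV"] finite_distinct_list[of "UNIV :: 'n set"]
  unfolding index_list_def by auto

lemma length_index_list: "length (index_list :: 'n::finite list) = CARD('n)"
  using distinct_card[of "index_list :: 'n list"] index_list[where 'n = 'n] by simp

definition std_basis :: "(complex^'n::finite) list" where
  "std_basis = map (\<lambda>j. axis j 1) index_list"

lemma complex_basis_std: "complex_basis std_basis"
proof -
  have s: "set std_basis = (cart_basis :: (complex^'n::finite) set)"
    by (auto simp: std_basis_def index_list cart_basis_def)
  have "distinct (std_basis :: (complex^'n::finite) list)"
    by (simp add: std_basis_def distinct_map index_list inj_on_def axis_eq_axis)
  then show ?thesis unfolding complex_basis_def s using independent_cart_basis span_cart_basis by blast
qed

text \<open>The one positively oriented frame at which every sign condition on a top-degree form is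
  instantiated.\<close>

abbreviation std_frame :: "(complex^'n::finite) list" where
  "std_frame \<equiv> real_basis_of std_basis"

abbreviation vol_form :: "'n::finite form" where
  "vol_form \<equiv> wedge_list (map dz index_list)"

lemma wedge_list_dz:
  fixes I :: "'n::finite list"
  assumes "length I = CARD('n)"
  shows "\<exists>D. wedge_list (map dz I) = (\<lambda>vs. D * vol_form vs)"
proof (cases "distinct I")
  case True
  then have "set I = UNIV" using assms by (metis card_subset_eq distinct_card finite subset_UNIV)
  then have "mset I = mset index_list"
    using True index_list[where 'n = 'n] by (simp add: set_eq_iff_mset_eq_distinct[symmetric])
  then have "mset (map dz I) = mset (map dz index_list)" by simp
  from wedge_list_mset[OF _ this] show ?thesis using degree_form_dz by auto
next
  case False
  then have "\<not> distinct (map dz I)" by (simp add: distinct_map)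
  from wedge_list_not_distinct[OF _ this] have "wedge_list (map dz I) = (\<lambda>vs. 0 * vol_form vs)"
    using degree_form_dz by auto
  then show ?thesis by blast
qed

text \<open>The last covector is expanded in the coordinate covectors, which are collected in
  \<open>I\<close> until only they remain. The factor \<open>D\<close> is the determinant of the
  covectors up to normalisation; its existence suffices.\<close>

lemma wedge_list_lin_dz:
  fixes gs :: "(complex^'n::finite) list"
  assumes "length gs + length I = CARD('n)"
  shows "\<exists>D. wedge_list (map lin_form gs @ map dz I) = (\<lambda>vs. D * vol_form vs)"
  using assms
proof (induction gs arbitrary: I rule: rev_induct)
  case Nil then show ?case using wedge_list_dz by auto
next
  case (snoc g gs)
  have "\<exists>D. wedge_list (map lin_form gs @ map dz (j # I)) = (\<lambda>vs. D * vol_form vs)" for j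
    using snoc.IH[of "j # I"] snoc.prems by simp
  then obtain D where D: "\<And>j. wedge_list (map lin_form gs @ map dz (j # I)) = (\<lambda>vs. D j * vol_form vs)"
    by metis
  have "wedge_list (map lin_form (gs @ [g]) @ map dz I)
      = (\<lambda>vs. \<Sum>j\<in>UNIV. g $ j * wedge_list (map lin_form gs @ map dz (j # I)) vs)"
    by (rule ext)
       (simp add: wedge_list_append wedge_list_Cons lin_form_def[of g] wedge_sum_left_ext wedge_sum_right
         wedge_scale_left_ext wedge_scale_right wedge_assoc)
  also have "\<dots> = (\<lambda>vs. (\<Sum>j\<in>UNIV. g $ j * D j) * vol_form vs)"
    by (simp only: D sum_distrib_right mult.assoc)
  finally show ?case by blast
qed

text \<open>Separating the covectors from their conjugates costs powers of i and signs that depend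
  only on the number of factors. Since \<open>u\<close> is uniform in \<open>gs\<close>, it can be
  calibrated on a single example.\<close>

lemma wedge_list_sq_split:
  "\<exists>u. \<forall>gs :: (complex^'n::finite) list. length gs = n \<longrightarrow>
     wedge_list (map sq_form gs) =
     (\<lambda>vs. u * (wedge_list (map lin_form gs) \<and>\<^sub>w cnj_form (wedge_list (map lin_form gs))) vs)"
proof (induction n)
  case 0
  then show ?case
    by (intro exI[of _ 1]) (auto simp: wedge_list_Nil cnj_form_const wedge_const_left)
next
  case (Suc n)
  then obtain u where u: "\<And>gs :: (complex^'n) list. length gs = n \<Longrightarrow>
     wedge_list (map sq_form gs) =
     (\<lambda>vs. u * (wedge_list (map lin_form gs) \<and>\<^sub>w cnj_form (wedge_list (map lin_form gs))) vs)" by blast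
  show ?case
  proof (intro exI[of _ "\<i> * u * (-1) ^ n"] allI impI)
    fix gs :: "(complex^'n) list" assume "length gs = Suc n"
    then obtain g hs where gs: "gs = g # hs" "length hs = n" by (auto simp: length_Suc_conv)
    let ?A = "wedge_list (map lin_form hs)"
    have dA: "degree_form n ?A"
      using degree_form_wedge_list[of "map lin_form hs" 1] degree_form_lin gs by auto
    have c: "cnj_form (lin_form g) \<and>\<^sub>w ?A = (\<lambda>vs. (-1) ^ n * (?A \<and>\<^sub>w cnj_form (lin_form g)) vs)"
      using wedge_commute[OF degree_form_cnj[OF degree_form_lin] dA] by simp
    have "sq_form g \<and>\<^sub>w ?A \<and>\<^sub>w cnj_form ?A
        = scale_form \<i> (lin_form g) \<and>\<^sub>w (cnj_form (lin_form g) \<and>\<^sub>w ?A) \<and>\<^sub>w cnj_form ?A"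
      by (simp add: sq_form_def wedge_assoc)
    also have "\<dots> = (\<lambda>vs. \<i> * (-1) ^ n *
        ((lin_form g \<and>\<^sub>w ?A) \<and>\<^sub>w cnj_form (lin_form g) \<and>\<^sub>w cnj_form ?A) vs)"
      unfolding c scale_form_def
      by (simp add: wedge_scale_left_ext wedge_scale_right_ext wedge_assoc mult.assoc)
    finally show "wedge_list (map sq_form gs) = (\<lambda>vs. \<i> * u * (-1) ^ n *
        (wedge_list (map lin_form gs) \<and>\<^sub>w cnj_form (wedge_list (map lin_form gs))) vs)"
      by (simp add: gs wedge_list_Cons u cnj_form_wedge wedge_scale_right_ext ac_simps)
  qed
qed

text \<open>The universal factor is calibrated on the coordinate covectors, where the value is 2^n.
  A general product then carries \<open>D\<close> times its conjugate, so unspecified signs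
  disappear.\<close>

lemma wedge_list_sq_eval:
  fixes gs :: "(complex^'n::finite) list"
  assumes "length gs = CARD('n)" "wedge_list (map lin_form gs) = (\<lambda>vs. D * vol_form vs)"
  shows "wedge_list (map sq_form gs) (std_frame) = of_real ((cmod D)\<^sup>2 * 2 ^ CARD('n))"
proof -
  obtain u where u: "\<And>gs :: (complex^'n) list. length gs = CARD('n) \<Longrightarrow>
     wedge_list (map sq_form gs) =
     (\<lambda>vs. u * (wedge_list (map lin_form gs) \<and>\<^sub>w cnj_form (wedge_list (map lin_form gs))) vs)"
    using wedge_list_sq_split by blast
  have "map lin_form std_basis = map dz (index_list :: 'n list)"
    by (simp add: std_basis_def lin_form_axis)
  moreover have "wedge_list (map sq_form (std_basis :: (complex^'n) list)) (std_frame) = 2 ^ CARD('n)"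
    using wedge_list_sq_axis[of "index_list :: 'n list"] index_list(1)[where 'n = 'n]
    by (simp add: std_basis_def length_index_list o_def)
  ultimately have v: "u * (vol_form \<and>\<^sub>w cnj_form vol_form) ((std_frame :: (complex^'n) list)) = 2 ^ CARD('n)"
    using u[of std_basis] by (simp add: std_basis_def length_index_list del: map_map)
  have c: "cnj_form (\<lambda>vs. D * vol_form vs) = (\<lambda>vs. cnj D * cnj_form (vol_form :: 'n form) vs)"
    by (simp add: cnj_form_def)
  have "wedge_list (map sq_form gs) (std_frame)
     = D * cnj D * (u * (vol_form \<and>\<^sub>w cnj_form vol_form) ((std_frame :: (complex^'n) list)))"
    by (simp add: u[OF assms(1)] assms(2) c wedge_scale_left wedge_scale_right)
  then show ?thesis unfolding v by (simp flip: complex_norm_square)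
qed

lemma wedge_list_sq_nonneg:
  fixes gs :: "(complex^'n::finite) list"
  assumes "length gs = CARD('n)"
  shows "Im (wedge_list (map sq_form gs) (std_frame)) = 0"
    "Re (wedge_list (map sq_form gs) (std_frame)) \<ge> 0"
proof -
  obtain D where "wedge_list (map lin_form gs) = (\<lambda>vs. D * vol_form vs)"
    using wedge_list_lin_dz[of gs "[]"] assms by auto
  from wedge_list_sq_eval[OF assms this]
  show "Im (wedge_list (map sq_form gs) (std_frame)) = 0"
    "Re (wedge_list (map sq_form gs) (std_frame)) \<ge> 0" by simp_all
qed

text \<open>Against all coordinate covectors except the p-th, only the p-th component of g survives.
  The determinant is g_p c^(n-1) up to sign, which is nonzero.\<close>

lemma wedge_list_sq_pos:
  fixes g :: "complex^'n::finite"
  assumes "g $ p \<noteq> 0" "c \<noteq> 0" "distinct L" "set L = UNIV - {p}"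
  shows "Re (wedge_list (map sq_form (g # map (\<lambda>j. axis j c) L)) (std_frame)) > 0"
proof -
  have len: "length L = CARD('n) - 1" using distinct_card[OF assms(3)] assms(4) by simp
  have axs: "wedge_list (map lin_form (map (\<lambda>j. axis j c) L)) = (\<lambda>vs. c ^ length L * wedge_list (map dz L) vs)" for L :: "'n list"
    by (induction L)
       (simp_all add: wedge_list_Nil wedge_list_Cons lin_form_axis wedge_scale_left_ext
         wedge_scale_right_ext mult.assoc del: map_map)
  have z: "wedge_list (map dz (j # L)) vs = 0" if "j \<noteq> p" for j vs
  proof -
    have "\<not> distinct (map dz (j # L))" using that assms(4) by auto
    from wedge_list_not_distinct[OF _ this] degree_form_dz
    have "wedge_list (map dz (j # L)) = (\<lambda>vs. 0)" by auto
    then show ?thesis by (rule fun_cong)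
  qed
  have "mset (p # L) = mset index_list"
    using index_list[where 'n = 'n] assms(3,4)
    by (metis Diff_iff Diff_insert_absorb UNIV_I distinct.simps(2) insertI1 insert_Diff list.simps(15) set_eq_iff_mset_eq_distinct)
  then have "mset (map dz (p # L)) = mset (map dz index_list)" by (metis mset_map)
  from wedge_list_mset[OF _ this] degree_form_dz obtain s where
    s: "s = 1 \<or> s = -1" "wedge_list (map dz (p # L)) = (\<lambda>vs. s * vol_form vs)" by auto
  have "wedge_list (map lin_form (g # map (\<lambda>j. axis j c) L)) vs =
      (c ^ length L * g $ p * s) * vol_form vs" for vs
  proof -
    have "wedge_list (map lin_form (g # map (\<lambda>j. axis j c) L)) vs
       = (\<Sum>j\<in>UNIV. c ^ length L * g $ j * wedge_list (map dz (j # L)) vs)"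
      unfolding list.map wedge_list_Cons axs[unfolded list.map]
      by (simp add: wedge_scale_right lin_form_def wedge_sum_left wedge_scale_left sum_distrib_left mult.assoc mult.left_commute[of "c ^ length L"])
    also have "\<dots> = (\<Sum>j\<in>{p}. c ^ length L * g $ j * wedge_list (map dz (j # L)) vs)"
      by (rule sum.mono_neutral_right) (use z in auto)
    also have "\<dots> = c ^ length L * g $ p * wedge_list (map dz (p # L)) vs" by simp
    also have "\<dots> = (c ^ length L * g $ p * s) * vol_form vs" by (simp only: s(2) mult.assoc)
    finally show ?thesis .
  qed
  from wedge_list_sq_eval[OF _ ext, OF _ this] len s(1) assms(1,2) show ?thesis by auto
qed

section \<open>The pairing of Hermitian matrices with complementary forms\<close>

definition herm_coeff :: "'n::finite form \<Rightarrow> 'n \<Rightarrow> 'n \<Rightarrow> complex" where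
  "herm_coeff \<beta> j k = ((scale_form \<i> (dz j) \<and>\<^sub>w dzbar k) \<and>\<^sub>w \<beta>) std_frame"

abbreviation contract :: "('n::finite \<Rightarrow> 'n \<Rightarrow> complex) \<Rightarrow> ('n \<Rightarrow> 'n \<Rightarrow> complex) \<Rightarrow> complex" where
  "contract M A \<equiv> \<Sum>j\<in>UNIV. \<Sum>k\<in>UNIV. M j k * A j k"

lemma herm_form_wedge_eval:
  "(herm_form M \<and>\<^sub>w \<beta>) std_frame = (\<Sum>j\<in>UNIV. \<Sum>k\<in>UNIV. M j k * herm_coeff \<beta> j k)"
  by (simp add: herm_form_def wedge_sum_left wedge_scale_left herm_coeff_def)

text \<open>Ellipticity of the operator with coefficients \<open>A\<close>, required on rank one
  matrices only. The semidefinite case follows by decomposition, and the strict inequality gives the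
  case of equality.\<close>

definition pos_trace :: "('n::finite \<Rightarrow> 'n \<Rightarrow> complex) \<Rightarrow> bool" where
  "pos_trace A \<longleftrightarrow> (\<forall>g :: complex^'n. g \<noteq> 0 \<longrightarrow>
     Im (\<Sum>j\<in>UNIV. \<Sum>k\<in>UNIV. g $ j * cnj (g $ k) * A j k) = 0 \<and>
     Re (\<Sum>j\<in>UNIV. \<Sum>k\<in>UNIV. g $ j * cnj (g $ k) * A j k) > 0)"

lemma pos_semidef_rank_one:
  fixes M :: "'n::finite \<Rightarrow> 'n \<Rightarrow> complex"
  assumes "pos_semidef_on UNIV M"
  shows "\<exists>B :: (complex^'n) list. \<forall>j k. M j k = (\<Sum>b\<leftarrow>B. b $ j * cnj (b $ k))"
proof -
  obtain B where "\<And>j k. M j k = (\<Sum>b\<leftarrow>B. b j * cnj (b k))"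
    using pos_semidef_decompose[OF _ assms] by auto
  then show ?thesis by (intro exI[of _ "map vec_lambda B"]) (simp add: o_def)
qed

lemma sum_list_zero_nonneg:
  fixes f :: "'a \<Rightarrow> real"
  assumes "\<And>x. x \<in> set xs \<Longrightarrow> f x \<ge> 0" "sum_list (map f xs) \<le> 0" "x \<in> set xs"
  shows "f x = 0"
  using assms
proof (induction xs)
  case (Cons y ys)
  then have "sum_list (map f ys) \<ge> 0" by (intro sum_list_nonneg) auto
  with Cons show ?case by (auto simp: add_nonneg_eq_0_iff) (smt (verit))+
qed simp

lemma Re_sum_list: "Re (sum_list xs) = sum_list (map Re xs)"
  by (induction xs) auto

lemma Im_sum_list: "Im (sum_list xs) = sum_list (map Im xs)"
  by (induction xs) auto

lemma trace_rank_one: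
  fixes A :: "'n::finite \<Rightarrow> 'n \<Rightarrow> complex"
  assumes "\<And>j k. M j k = (\<Sum>b\<leftarrow>B. (b :: complex^'n) $ j * cnj (b $ k))"
  shows "contract M A =
    (\<Sum>b\<leftarrow>B. \<Sum>j\<in>UNIV. \<Sum>k\<in>UNIV. b $ j * cnj (b $ k) * A j k)"
  unfolding assms sum_list_mult_const[symmetric]
proof (induction B)
  case (Cons b B) then show ?case by (simp add: ring_distribs sum.distrib)
qed simp

lemma pos_trace_zero:
  "pos_trace A \<Longrightarrow> Im (\<Sum>j\<in>UNIV. \<Sum>k\<in>UNIV. g $ j * cnj (g $ k) * A j k) = 0"
  "pos_trace A \<Longrightarrow> Re (\<Sum>j\<in>UNIV. \<Sum>k\<in>UNIV. g $ j * cnj (g $ k) * A j k) \<ge> 0"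
  by (cases "g = 0"; force simp: pos_trace_def less_imp_le)+

lemma pos_trace_nonneg:
  assumes "pos_trace A" "pos_semidef_on UNIV M"
  shows "Im (contract M A) = 0"
    "Re (contract M A) \<ge> 0"
proof -
  obtain B where B: "\<And>j k. M j k = (\<Sum>b\<leftarrow>B. b $ j * cnj (b $ k))"
    using pos_semidef_rank_one[OF assms(2)] by auto
  show "Im (contract M A) = 0"
    unfolding trace_rank_one[OF B] Im_sum_list map_map o_def pos_trace_zero[OF assms(1)] by simp
  show "Re (contract M A) \<ge> 0"
    unfolding trace_rank_one[OF B] Re_sum_list map_map o_def
    by (rule sum_list_nonneg) (use pos_trace_zero[OF assms(1)] in auto)
qed

text \<open>The rank one summands all have nonnegative trace, so each trace is 0, and strict
  positivity forces every vector of the decomposition to vanish.\<close>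

lemma pos_trace_eq_0:
  assumes "pos_trace A" "pos_semidef_on UNIV M"
    and "Re (contract M A) \<le> 0"
  shows "M j k = 0"
proof -
  obtain B where B: "\<And>j k. M j k = (\<Sum>b\<leftarrow>B. b $ j * cnj (b $ k))"
    using pos_semidef_rank_one[OF assms(2)] by auto
  have "b = 0" if "b \<in> set B" for b
  proof -
    have "Re (\<Sum>j\<in>UNIV. \<Sum>k\<in>UNIV. b $ j * cnj (b $ k) * A j k) = 0"
      by (rule sum_list_zero_nonneg[OF _ _ that])
         (use pos_trace_zero[OF assms(1)] assms(3) in \<open>auto simp: trace_rank_one[OF B] Re_sum_list o_def\<close>)
    then show ?thesis using assms(1) unfolding pos_trace_def by force
  qed
  then have "(\<Sum>b\<leftarrow>B. b $ j * cnj (b $ k)) = (\<Sum>b\<leftarrow>B. 0)"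
    by (intro arg_cong[where f = sum_list] map_cong refl) (metis mult_zero_left zero_index)
  then show ?thesis unfolding B by simp
qed

definition qform :: "('n::finite \<Rightarrow> 'n \<Rightarrow> complex) \<Rightarrow> complex^'n \<Rightarrow> complex" where
  "qform M v = (\<Sum>j\<in>UNIV. \<Sum>k\<in>UNIV. M j k * v $ j * cnj (v $ k))"

lemma qform_scaleR: "qform M (a *\<^sub>R v) = of_real (a\<^sup>2) * qform M v"
proof -
  have "(a *\<^sub>R v) $ j = of_real a * v $ j" for j
    by (simp only: vector_scaleR_component scaleR_conv_of_real[where 'a = complex])
  then show ?thesis
    unfolding qform_def sum_distrib_left by (intro sum.cong refl) (simp add: power2_eq_square)
qed

lemma sum_cmod_eq_norm: "(\<Sum>j\<in>UNIV. v $ j * cnj (v $ j)) = of_real ((norm v)\<^sup>2)"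
  by (simp add: norm_vec_def L2_set_def sum_nonneg complex_norm_square flip: of_real_power)

text \<open>The minimum over the compact unit sphere is positive and is propagated by homogeneity of
  degree 2.\<close>

lemma pos_def_lower_bound:
  fixes M :: "'n::finite \<Rightarrow> 'n \<Rightarrow> complex"
  assumes "\<And>v. v \<noteq> 0 \<Longrightarrow> Re (qform M v) > 0"
  shows "\<exists>c>0. \<forall>v. Re (qform M v) \<ge> c * (norm v)\<^sup>2"
proof -
  let ?S = "sphere (0 :: complex^'n) 1"
  have ne: "?S \<noteq> {}" by simp
  have "continuous_on ?S (\<lambda>v. Re (qform M v))"
    unfolding qform_def by (intro continuous_intros)
  from continuous_attains_inf[OF compact_sphere ne this] obtain u where
    u: "u \<in> ?S" "\<And>v. v \<in> ?S \<Longrightarrow> Re (qform M u) \<le> Re (qform M v)" by blast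
  have "Re (qform M u) > 0" using assms u(1) by (metis dist_0_norm mem_sphere norm_zero zero_neq_one)
  moreover have "Re (qform M v) \<ge> Re (qform M u) * (norm v)\<^sup>2" for v
  proof (cases "v = 0")
    case True then show ?thesis by (simp add: qform_def)
  next
    case False
    let ?w = "(1 / norm v) *\<^sub>R v"
    have "?w \<in> ?S" using False by simp
    moreover have "v = norm v *\<^sub>R ?w" using False by simp
    then have "qform M v = of_real ((norm v)\<^sup>2) * qform M ?w" by (metis qform_scaleR)
    ultimately show ?thesis using mult_left_mono[OF u(2)[of ?w], of "(norm v)\<^sup>2"]
      by (simp add: mult.commute del: of_real_power)
  qed
  ultimately show ?thesis by blast
qed

lemma Im_qform_herm: "(\<And>j k. M k j = cnj (M j k)) \<Longrightarrow> Im (qform M v) = 0"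
proof -
  assume h: "\<And>j k. M k j = cnj (M j k)"
  have "cnj (qform M v) = (\<Sum>j\<in>UNIV. \<Sum>k\<in>UNIV. M k j * v $ k * cnj (v $ j))"
    unfolding qform_def cnj_sum by (intro sum.cong refl) (simp add: h[symmetric] ac_simps)
  also have "\<dots> = qform M v" unfolding qform_def by (rule sum.swap)
  finally show ?thesis by (simp add: complex_eq_iff)
qed

lemma herm_form_eval: "herm_form M [v, \<i> *s v] = 2 * qform M v"
proof -
  have e: "(scale_form \<i> (dz j) \<and>\<^sub>w dzbar k) [v, \<i> *s v] = 2 * (v $ j * cnj (v $ k))" for j k
  proof -
    have "(dz j \<and>\<^sub>w dzbar k) [v, \<i> *s v] = dz j [v] * dzbar k [\<i> *s v] - dz j [\<i> *s v] * dzbar k [v]"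
      by (simp add: wedge_1_Cons[OF degree_form_dz] wedge_Nil insert_vec_def)
        (simp add: dz_def)
    then show ?thesis
      by (simp add: scale_form_def wedge_scale_left_ext dz_def dzbar_def cnj_form_def)
  qed
  show ?thesis unfolding herm_form_def e qform_def sum_distrib_left by (simp add: ac_simps)
qed

text \<open>Positive definiteness leaves room to split off c times the identity before the
  semidefinite remainder is decomposed. This part contributes the squares of the coordinate
  covectors scaled by a = sqrt c, whose presence yields strict positivity later.\<close>

lemma kaehler_rank_one:
  fixes \<omega> :: "'n::finite form"
  assumes "bidegree 1 1 \<omega>" "real_form \<omega>" "\<And>v. v \<noteq> 0 \<Longrightarrow> Re (\<omega> [v, \<i> *s v]) > 0"
  shows "\<exists>(a::complex) B. a \<noteq> 0 \<and>
     \<omega> = (\<lambda>vs. \<Sum>g\<leftarrow>map (\<lambda>j. axis j a) index_list @ B. sq_form g vs)"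
proof -
  obtain M where M: "\<omega> = herm_form M" using bidegree_1_1_imp_herm[OF assms(1)] by blast
  have im: "Im (qform M v) = 0" for v
  proof -
    have "cnj (\<omega> [v, \<i> *s v]) = \<omega> [v, \<i> *s v]"
      using assms(2) by (metis cnj_form_def real_form_def)
    then show ?thesis unfolding M herm_form_eval by (simp add: complex_eq_iff)
  qed
  obtain c where c: "c > 0" "\<And>v. Re (qform M v) \<ge> c * (norm v)\<^sup>2"
    using pos_def_lower_bound[of M] assms(3) unfolding M herm_form_eval by auto
  let ?N = "\<lambda>j k. M j k - (if j = k then of_real c else 0)"
  have "pos_semidef_on UNIV ?N"
    unfolding pos_semidef_on_def
  proof
    fix v :: "'n \<Rightarrow> complex"
    have "(\<Sum>j\<in>UNIV. \<Sum>k\<in>UNIV. ?N j k * v j * cnj (v k)) = qform M (\<chi> j. v j) - of_real (c * (norm (\<chi> j. v j))\<^sup>2)"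
    proof -
      have "(\<Sum>j\<in>UNIV. \<Sum>k\<in>UNIV. (if j = k then of_real c else 0) * v j * cnj (v k)) = of_real c * (\<Sum>j\<in>UNIV. v j * cnj (v j))"
        by (simp add: if_distrib[of "\<lambda>x. x * _"] sum.delta sum_distrib_left mult.assoc cong: if_cong)
      also have "(\<Sum>j\<in>UNIV. v j * cnj (v j)) = of_real ((norm (\<chi> j. v j))\<^sup>2)"
        using sum_cmod_eq_norm[of "\<chi> j. v j"] by simp
      finally show ?thesis by (simp add: left_diff_distrib sum_subtractf qform_def)
    qed
    then show "Im (\<Sum>j\<in>UNIV. \<Sum>k\<in>UNIV. ?N j k * v j * cnj (v k)) = 0 \<and>
        0 \<le> Re (\<Sum>j\<in>UNIV. \<Sum>k\<in>UNIV. ?N j k * v j * cnj (v k))"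
      using im c(2)[of "\<chi> j. v j"] by (simp del: of_real_mult of_real_power)
  qed
  from pos_semidef_rank_one[OF this] obtain B where
    B: "\<And>j k. ?N j k = (\<Sum>b\<leftarrow>B. b $ j * cnj (b $ k))" by blast
  let ?a = "complex_of_real (sqrt c)"
  have a: "?a * ?a = of_real c" using c(1) by (simp flip: of_real_mult)
  let ?G = "map (\<lambda>j. axis j ?a) index_list @ B"
  have "M j k = (\<Sum>g\<leftarrow>?G. g $ j * cnj (g $ k))" for j k
  proof -
    have "(\<Sum>g\<leftarrow>map (\<lambda>j. axis j ?a) index_list. g $ j * cnj (g $ k)) = (\<Sum>l\<in>UNIV. axis l ?a $ j * cnj (axis l ?a $ k))"
      using sum_list_distinct_conv_sum_set[OF index_list(1), of "\<lambda>l. axis l ?a $ j * cnj (axis l ?a $ k)"]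
      by (simp add: index_list o_def)
    also have "\<dots> = (\<Sum>l\<in>{j}. axis l ?a $ j * cnj (axis l ?a $ k))"
      by (rule sum.mono_neutral_right) (auto simp: axis_def)
    also have "\<dots> = (if j = k then of_real c else 0)" using a by (simp add: axis_def)
    finally show ?thesis using B[of j k] by (simp add: algebra_simps)
  qed
  then have "herm_form M vs = (\<Sum>g\<leftarrow>?G. sq_form g vs)" for vs
    unfolding sq_form_eq_herm herm_form_def by (rule trace_rank_one)
  moreover have "?a \<noteq> 0" using c(1) by simp
  ultimately show ?thesis using M by blast
qed

text \<open>The power is expanded over words instead of multisets: no multinomial coefficients
  arise, and a single word can be singled out as the positive term.\<close>

lemma wedge_pow_sum:
  assumes "\<omega> = (\<lambda>vs. \<Sum>r\<in>R. \<tau> r vs)" "finite R"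
  shows "wedge_pow \<omega> k = (\<lambda>vs. \<Sum>I | set I \<subseteq> R \<and> length I = k. wedge_list (map \<tau> I) vs)"
proof (induction k)
  case 0
  have "{I. set I \<subseteq> R \<and> length I = 0} = {[]}" by auto
  then show ?case by (simp add: wedge_pow_def)
next
  case (Suc k)
  have "wedge_pow \<omega> (Suc k) = \<omega> \<and>\<^sub>w wedge_pow \<omega> k" by (simp add: wedge_pow_def wedge_list_Cons)
  also have "\<dots> = (\<lambda>vs. \<Sum>r\<in>R. \<Sum>I | set I \<subseteq> R \<and> length I = k. (\<tau> r \<and>\<^sub>w wedge_list (map \<tau> I)) vs)"
    unfolding Suc.IH unfolding assms(1) by (rule ext) (simp only: wedge_sum_left wedge_sum_right)
  also have "\<dots> = (\<lambda>vs. \<Sum>I | set I \<subseteq> R \<and> length I = Suc k. wedge_list (map \<tau> I) vs)"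
  proof
    fix vs
    have inj: "inj_on (\<lambda>(xs, n). n # xs) ({I. set I \<subseteq> R \<and> length I = k} \<times> R)" by (auto simp: inj_on_def)
    show "(\<Sum>r\<in>R. \<Sum>I | set I \<subseteq> R \<and> length I = k. (\<tau> r \<and>\<^sub>w wedge_list (map \<tau> I)) vs) =
       (\<Sum>I | set I \<subseteq> R \<and> length I = Suc k. wedge_list (map \<tau> I) vs)"
      unfolding lists_length_Suc_eq sum.reindex[OF inj]
      by (subst sum.swap) (simp add: sum.cartesian_product wedge_list_Cons case_prod_beta o_def)
  qed
  finally show ?case .
qed

lemma degree_form_wedge_pow: "degree_form 2 \<omega> \<Longrightarrow> degree_form (k * 2) (wedge_pow \<omega> k)"
  using degree_form_wedge_list[of "replicate k \<omega>" 2] by (auto simp: wedge_pow_def)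

text \<open>The trace against g times its conjugate is the value of Omega wedged with the square of
  g and omega^(m-1). Expanding the power tests Omega against products of m squares, where weak
  positivity bounds it below by eps omega^(n-m). Expanding that too leaves products of n squares,
  none negative and at least one positive.\<close>

lemma weakly_pos_pos_trace:
  fixes \<omega> \<Omega> :: "'n::finite form"
  assumes \<omega>: "bidegree 1 1 \<omega>" "real_form \<omega>" "\<And>v. v \<noteq> 0 \<Longrightarrow> Re (\<omega> [v, \<i> *s v]) > 0"
    and m: "m \<in> {1..CARD('n)}"
    and \<Omega>: "bidegree (CARD('n) - m) (CARD('n) - m) \<Omega>"
    and \<epsilon>: "(\<epsilon>::real) > 0"
    and weak: "weakly_nonneg (CARD('n) - m) (\<lambda>vs. \<Omega> vs - of_real \<epsilon> * wedge_pow \<omega> (CARD('n) - m) vs)"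
  shows "pos_trace (herm_coeff (wedge_pow \<omega> (m - 1) \<and>\<^sub>w \<Omega>))"
  unfolding pos_trace_def
proof (intro allI impI)
  fix g :: "complex^'n" assume "g \<noteq> 0"
  then obtain p where p: "g $ p \<noteq> 0" by (auto simp: vec_eq_iff)
  let ?q = "CARD('n) - m" and ?E = "(std_frame :: (complex^'n) list)"
  obtain a B where a: "a \<noteq> 0"
    and \<omega>B: "\<omega> = (\<lambda>vs. \<Sum>g\<leftarrow>map (\<lambda>j. axis j a) index_list @ B. sq_form g vs)"
    using kaehler_rank_one[OF \<omega>] by blast
  define G where "G = map (\<lambda>j. axis j a) index_list @ B"
  define R where "R = {..<length G}"
  define \<tau> where "\<tau> = (\<lambda>r. sq_form (G ! r))"
  have R: "\<omega> = (\<lambda>vs. \<Sum>r\<in>R. \<tau> r vs)" "finite R"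
    unfolding \<omega>B G_def[symmetric] by (auto simp: R_def \<tau>_def sum_list_sum_nth atLeast0LessThan)
  define T where "T = (\<lambda>k. {I. set I \<subseteq> R \<and> length I = k})"
  have pw: "wedge_pow \<omega> k = (\<lambda>vs. \<Sum>I\<in>T k. wedge_list (map \<tau> I) vs)" for k
    unfolding T_def by (rule wedge_pow_sum[OF R])
  have fT: "finite (T k)" for k unfolding T_def using finite_lists_length_eq[OF R(2)] by simp
  \<comment> \<open>\<open>W I\<close> is a product of m squares. \<open>X I\<close> is the part
    that is nonnegative by weak positivity, and \<open>V J I\<close> is a product of n squares
    coming from omega^(n-m).\<close>
  define W where "W = (\<lambda>I. wedge_list (map sq_form (g # map ((!) G) I)))"
  define X where "X = (\<lambda>I. ((\<lambda>vs. \<Omega> vs - of_real \<epsilon> * wedge_pow \<omega> ?q vs) \<and>\<^sub>w W I) ?E)"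
  define V where "V = (\<lambda>J I. wedge_list (map sq_form (map ((!) G) J @ g # map ((!) G) I)) ?E)"
  have d\<omega>: "degree_form 2 \<omega>" using degree_form_bidegree[OF \<omega>(1)] by (simp add: numeral_2_eq_2)
  have d\<Omega>: "degree_form (2 * ?q) \<Omega>" using degree_form_bidegree[OF \<Omega>] by (simp add: mult_2)
  \<comment> \<open>Omega has even degree and may be moved to the front, the position it has in
    \<open>weakly_nonneg\<close>.\<close>
  have comm: "sq_form g \<and>\<^sub>w wedge_pow \<omega> (m - 1) \<and>\<^sub>w \<Omega> = \<Omega> \<and>\<^sub>w sq_form g \<and>\<^sub>w wedge_pow \<omega> (m - 1)"
    using wedge_commute_even[OF d\<Omega> degree_form_wedge[OF degree_form_sq degree_form_wedge_pow[OF d\<omega>]]]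
    by (simp add: wedge_assoc)
  have "(\<Sum>j\<in>UNIV. \<Sum>k\<in>UNIV. g $ j * cnj (g $ k) * herm_coeff (wedge_pow \<omega> (m - 1) \<and>\<^sub>w \<Omega>) j k)
      = (\<Omega> \<and>\<^sub>w sq_form g \<and>\<^sub>w wedge_pow \<omega> (m - 1)) ?E"
    unfolding comm[symmetric] by (simp add: sq_form_eq_herm herm_form_wedge_eval)
  also have "\<dots> = (\<Sum>I\<in>T (m - 1). (\<Omega> \<and>\<^sub>w W I) ?E)"
    unfolding pw W_def by (simp add: wedge_sum_right wedge_sum_right[abs_def] wedge_list_Cons \<tau>_def o_def)
  also have "\<dots> = (\<Sum>I\<in>T (m - 1). X I + of_real \<epsilon> * (\<Sum>J\<in>T ?q. V J I))"
  proof (rule sum.cong[OF refl])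
    fix I
    have "(wedge_pow \<omega> ?q \<and>\<^sub>w W I) ?E = (\<Sum>J\<in>T ?q. V J I)"
      unfolding pw V_def W_def wedge_sum_left by (simp add: wedge_list_append \<tau>_def o_def)
    then show "(\<Omega> \<and>\<^sub>w W I) ?E = X I + of_real \<epsilon> * (\<Sum>J\<in>T ?q. V J I)"
      unfolding X_def wedge_diff_left wedge_scale_left by simp
  qed
  finally have eq: "(\<Sum>j\<in>UNIV. \<Sum>k\<in>UNIV. g $ j * cnj (g $ k) * herm_coeff (wedge_pow \<omega> (m - 1) \<and>\<^sub>w \<Omega>) j k)
     = (\<Sum>I\<in>T (m - 1). X I + of_real \<epsilon> * (\<Sum>J\<in>T ?q. V J I))" .
  have X: "Im (X I) = 0" "Re (X I) \<ge> 0" if "I \<in> T (m - 1)" for I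
  proof -
    let ?\<alpha>s = "map lin_form (g # map ((!) G) I)"
    \<comment> \<open>The covector g and the m-1 covectors of the word make m = n - (n-m); this
      count uses 1 \<le> m \<le> n.\<close>
    have "length ?\<alpha>s = CARD('n) - ?q" using that m by (auto simp: T_def)
    moreover have "\<forall>\<alpha>\<in>set ?\<alpha>s. bidegree 1 0 \<alpha>" using bidegree_1_0_lin by auto
    ultimately have "top_nonneg ((\<lambda>vs. \<Omega> vs - of_real \<epsilon> * wedge_pow \<omega> ?q vs) \<and>\<^sub>w
        wedge_list (map (\<lambda>\<alpha>. scale_form \<i> \<alpha> \<and>\<^sub>w cnj_form \<alpha>) ?\<alpha>s))"
      using weak unfolding weakly_nonneg_def by blast
    moreover have "map (\<lambda>\<alpha>. scale_form \<i> \<alpha> \<and>\<^sub>w cnj_form \<alpha>) ?\<alpha>s = map sq_form (g # map ((!) G) I)"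
      by (simp add: sq_form_def)
    ultimately have "top_nonneg ((\<lambda>vs. \<Omega> vs - of_real \<epsilon> * wedge_pow \<omega> ?q vs) \<and>\<^sub>w W I)"
      by (simp only: W_def)
    then show "Im (X I) = 0" "Re (X I) \<ge> 0"
      using complex_basis_std unfolding top_nonneg_def X_def by auto
  qed
  have V: "Im (V J I) = 0" "Re (V J I) \<ge> 0" if "I \<in> T (m - 1)" "J \<in> T ?q" for I J
    unfolding V_def using wedge_list_sq_nonneg[of "map ((!) G) J @ g # map ((!) G) I"] that m
    by (auto simp: T_def)
  \<comment> \<open>The word of all coordinate covectors except the p-th, as positions in
    \<open>G\<close>. Its n-1 letters are the complement to g that makes the determinant
    nonzero.\<close>
  define K where "K = filter (\<lambda>i. index_list ! i \<noteq> p) [0..<CARD('n)]"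
  have L: "map ((!) index_list) K = filter (\<lambda>j. j \<noteq> p) (index_list :: 'n list)"
    using filter_map[of "\<lambda>j. j \<noteq> p" "(!) (index_list :: 'n list)" "[0..<CARD('n)]"]
      map_nth[of "index_list :: 'n list"]
    by (simp add: K_def length_index_list o_def)
  have dL: "distinct (map ((!) (index_list :: 'n list)) K)" "set (map ((!) index_list) K) = UNIV - {p}"
    unfolding L using index_list[where 'n = 'n] by auto
  have KR: "set K \<subseteq> R" by (auto simp: K_def R_def G_def length_index_list)
  have GK: "map ((!) G) K = map (\<lambda>j. axis j a) (map ((!) index_list) K)"
    by (auto simp: K_def G_def nth_append length_index_list)
  have lK: "length K = CARD('n) - 1"
    using distinct_card[OF dL(1)] dL(2) by simp
  \<comment> \<open>As n-1 = (n-m) + (m-1), the word splits into a term of omega^(n-m) and a term of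
    omega^(m-1).\<close>
  define J0 I0 where "J0 = take ?q K" and "I0 = drop ?q K"
  have J0: "J0 \<in> T ?q" and I0: "I0 \<in> T (m - 1)"
    using m lK KR set_take_subset[of ?q K] set_drop_subset[of ?q K] by (auto simp: T_def J0_def I0_def)
  have V0: "Re (V J0 I0) > 0"
  proof -
    let ?A = "wedge_list (map sq_form (map ((!) G) J0))" and ?B = "wedge_list (map sq_form (map ((!) G) I0))"
    have "degree_form (length (map sq_form (map ((!) G) J0)) * 2) ?A"
      by (rule degree_form_wedge_list) (auto simp: degree_form_sq)
    from wedge_commute_even[OF this degree_form_sq] have "?A \<and>\<^sub>w sq_form g = sq_form g \<and>\<^sub>w ?A"
      by simp
    then have "?A \<and>\<^sub>w sq_form g \<and>\<^sub>w ?B = sq_form g \<and>\<^sub>w ?A \<and>\<^sub>w ?B"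
      by (metis wedge_assoc)
    then have "V J0 I0 = wedge_list (map sq_form (g # map ((!) G) J0 @ map ((!) G) I0)) ?E"
      by (simp only: V_def map_append list.map wedge_list_append wedge_list_Cons)
    also have "map ((!) G) J0 @ map ((!) G) I0 = map (\<lambda>j. axis j a) (map ((!) index_list) K)"
      unfolding GK[symmetric] J0_def I0_def by (metis append_take_drop_id map_append)
    finally show ?thesis using wedge_list_sq_pos[OF p a dL] by simp
  qed
  let ?Z = "\<lambda>I. X I + of_real \<epsilon> * (\<Sum>J\<in>T ?q. V J I)"
  have Z: "Im (?Z I) = 0" "Re (?Z I) \<ge> 0" if "I \<in> T (m - 1)" for I
    using X[OF that] V[OF that] \<epsilon> by (auto simp: intro!: add_nonneg_nonneg mult_nonneg_nonneg sum_nonneg)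
  have "Re (V J0 I0) \<le> (\<Sum>J\<in>T ?q. Re (V J I0))"
    by (rule member_le_sum[OF J0 _ fT]) (use V[OF I0] in auto)
  then have "Re (?Z I0) > 0" using X[OF I0] V0 \<epsilon> by (simp add: add_nonneg_pos)
  then have "(\<Sum>I\<in>T (m - 1). Re (?Z I)) > 0"
    by (rule sum_pos2[OF fT I0]) (use Z in auto)
  then show "Im (\<Sum>j\<in>UNIV. \<Sum>k\<in>UNIV. g $ j * cnj (g $ k) * herm_coeff (wedge_pow \<omega> (m - 1) \<and>\<^sub>w \<Omega>) j k) = 0 \<and>
      0 < Re (\<Sum>j\<in>UNIV. \<Sum>k\<in>UNIV. g $ j * cnj (g $ k) * herm_coeff (wedge_pow \<omega> (m - 1) \<and>\<^sub>w \<Omega>) j k)"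
    unfolding eq Re_sum Im_sum using Z(1) by (simp only: sum.neutral) simp
qed

section \<open>The strong maximum principle\<close>

definition der2 :: "(real \<Rightarrow> 'a::real_normed_vector) \<Rightarrow> 'a \<Rightarrow> 'a \<Rightarrow> bool" where
  "der2 \<phi> a b \<longleftrightarrow> (\<exists>\<phi>'. (\<forall>\<^sub>F t in nhds 0. (\<phi> has_vector_derivative \<phi>' t) (at t)) \<and>
     \<phi>' 0 = a \<and> (\<phi>' has_vector_derivative b) (at 0))"

lemma der2E:
  assumes "der2 \<phi> a b"
  obtains \<phi>' where "\<forall>\<^sub>F t in nhds 0. (\<phi> has_vector_derivative \<phi>' t) (at t)" "\<phi>' 0 = a" "(\<phi>' has_vector_derivative b) (at 0)"
  using assms unfolding der2_def by blast

lemma der2_const: "der2 (\<lambda>t. c) 0 0"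
  unfolding der2_def by (intro exI[of _ "\<lambda>t. 0"]) simp

lemma der2_add:
  assumes "der2 f a b" "der2 g c d"
  shows "der2 (\<lambda>t. f t + g t) (a + c) (b + d)"
proof -
  obtain f' where f: "\<forall>\<^sub>F t in nhds 0. (f has_vector_derivative f' t) (at t)" "f' 0 = a" "(f' has_vector_derivative b) (at 0)"
    using assms(1) by (rule der2E)
  obtain g' where g: "\<forall>\<^sub>F t in nhds 0. (g has_vector_derivative g' t) (at t)" "g' 0 = c" "(g' has_vector_derivative d) (at 0)"
    using assms(2) by (rule der2E)
  have "\<forall>\<^sub>F t in nhds 0. ((\<lambda>t. f t + g t) has_vector_derivative f' t + g' t) (at t)"
    using f(1) g(1) by eventually_elim (rule has_vector_derivative_add)
  then show ?thesis unfolding der2_def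
    using f g by (intro exI[of _ "\<lambda>t. f' t + g' t"]) (auto intro: has_vector_derivative_add)
qed

lemma der2_sum:
  assumes "\<And>i. i \<in> I \<Longrightarrow> der2 (f i) (a i) (b i)"
  shows "der2 (\<lambda>t. \<Sum>i\<in>I. f i t) (\<Sum>i\<in>I. a i) (\<Sum>i\<in>I. b i)"
  using assms by (induction I rule: infinite_finite_induct) (auto intro: der2_const der2_add)

lemma der2_mult:
  fixes f g :: "real \<Rightarrow> complex"
  assumes "der2 f a b" "der2 g c d"
  shows "der2 (\<lambda>t. f t * g t) (f 0 * c + a * g 0) (f 0 * d + 2 * a * c + b * g 0)"
proof -
  obtain f' where f: "\<forall>\<^sub>F t in nhds 0. (f has_vector_derivative f' t) (at t)" "f' 0 = a" "(f' has_vector_derivative b) (at 0)"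
    using assms(1) by (rule der2E)
  obtain g' where g: "\<forall>\<^sub>F t in nhds 0. (g has_vector_derivative g' t) (at t)" "g' 0 = c" "(g' has_vector_derivative d) (at 0)"
    using assms(2) by (rule der2E)
  have f0: "(f has_vector_derivative a) (at 0)" and g0: "(g has_vector_derivative c) (at 0)"
    using eventually_nhds_x_imp_x[OF f(1)] eventually_nhds_x_imp_x[OF g(1)] f(2) g(2) by auto
  have "\<forall>\<^sub>F t in nhds 0. ((\<lambda>t. f t * g t) has_vector_derivative f t * g' t + f' t * g t) (at t)"
    using f(1) g(1) by eventually_elim (rule has_vector_derivative_mult)
  moreover have "((\<lambda>t. f t * g' t + f' t * g t) has_vector_derivative
      (f 0 * d + a * g' 0) + (f' 0 * c + b * g 0)) (at 0)"
    by (intro has_vector_derivative_add has_vector_derivative_mult f0 g0 f(3) g(3))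
  ultimately show ?thesis unfolding der2_def f(2) g(2)
    by (intro exI[of _ "\<lambda>t. f t * g' t + f' t * g t"]) (simp add: f(2) g(2) algebra_simps)
qed

lemma der2_bounded_linear:
  assumes "bounded_linear L" "der2 f a b"
  shows "der2 (\<lambda>t. L (f t)) (L a) (L b)"
proof -
  from assms(2) obtain f' where
    f: "\<forall>\<^sub>F t in nhds 0. (f has_vector_derivative f' t) (at t)" "f' 0 = a" "(f' has_vector_derivative b) (at 0)"
    by (rule der2E)
  have "\<forall>\<^sub>F t in nhds 0. ((\<lambda>t. L (f t)) has_vector_derivative L (f' t)) (at t)"
    using f(1) by eventually_elim (rule bounded_linear.has_vector_derivative[OF assms(1)])
  then show ?thesis unfolding der2_def
    using f bounded_linear.has_vector_derivative[OF assms(1) f(3)]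
    by (intro exI[of _ "\<lambda>t. L (f' t)"]) auto
qed

lemma der2_cong:
  assumes "\<forall>\<^sub>F t in nhds 0. f t = g t" "der2 f a b"
  shows "der2 g a b"
proof -
  from assms(2) obtain f' where
    f: "\<forall>\<^sub>F t in nhds 0. (f has_vector_derivative f' t) (at t)" "f' 0 = a" "(f' has_vector_derivative b) (at 0)"
    by (rule der2E)
  have "\<forall>\<^sub>F t in nhds 0. \<forall>\<^sub>F s in nhds t. f s = g s" using assms(1) by (simp add: eventually_eventually)
  with f(1) have "\<forall>\<^sub>F t in nhds 0. (g has_vector_derivative f' t) (at t)"
  proof eventually_elim
    case (elim t)
    then show ?case
      using has_vector_derivative_cong_ev[where x = t and S = UNIV and f = f and g = g and f' = "f' t"]
        eventually_nhds_x_imp_x[OF elim(2)]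
      by simp
  qed
  then show ?thesis unfolding der2_def using f by blast
qed

text \<open>At a maximum the first derivative is 0; a positive second derivative would make the
  first one positive just to the right, and the function would increase there by the mean value
  theorem.\<close>

lemma der2_local_max:
  fixes \<phi> :: "real \<Rightarrow> real"
  assumes "der2 \<phi> a b" "\<forall>\<^sub>F t in nhds 0. \<phi> t \<le> \<phi> 0"
  shows "b \<le> 0"
proof (rule ccontr)
  assume "\<not> b \<le> 0"
  then have b: "b > 0" by simp
  from assms(1) obtain f' where
    f: "\<forall>\<^sub>F t in nhds 0. (\<phi> has_real_derivative f' t) (at t)" "f' 0 = a" "(f' has_real_derivative b) (at 0)"
    unfolding der2_def has_real_derivative_iff_has_vector_derivative by blast
  obtain d1 where d1: "d1 > 0" "\<And>t. \<bar>t\<bar> < d1 \<Longrightarrow> (\<phi> has_real_derivative f' t) (at t)"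
    using f(1) unfolding eventually_nhds_metric by (auto simp: dist_real_def)
  obtain d2 where d2: "d2 > 0" "\<And>t. \<bar>t\<bar> < d2 \<Longrightarrow> \<phi> t \<le> \<phi> 0"
    using assms(2) unfolding eventually_nhds_metric by (auto simp: dist_real_def)
  have "f' 0 = 0"
    by (rule DERIV_local_max[OF d1(2)[of 0] d2(1)]) (use d1(1) d2(2) in auto)
  with DERIV_pos_inc_right[OF f(3) b] obtain d3 where
    d3: "d3 > 0" "\<And>t. 0 < t \<Longrightarrow> t < d3 \<Longrightarrow> f' t > 0" by auto
  define t where "t = min d1 (min d2 d3) / 2"
  have t: "0 < t" "t < d1" "t < d2" "t < d3" using d1 d2 d3 by (auto simp: t_def)
  obtain z where z: "0 < z" "z < t" "\<phi> t - \<phi> 0 = (t - 0) * f' z"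
    using MVT2[of 0 t \<phi> f'] d1(2) t by auto
  then have "\<phi> t > \<phi> 0" using d3(2)[of z] t by (simp add: algebra_simps)
  then show False using d2(2)[of t] t by auto
qed

text \<open>The sum of the second derivatives along v and iv is the Laplacian of f on the complex
  line through z, hence the factor 4. The definition avoids any second Frechet derivative of
  f.\<close>

definition has_levi :: "(complex^'n::finite \<Rightarrow> real) \<Rightarrow> complex^'n \<Rightarrow> ('n \<Rightarrow> 'n \<Rightarrow> complex) \<Rightarrow> bool" where
  "has_levi f z F \<longleftrightarrow> (\<forall>v. \<exists>a b c d. der2 (\<lambda>t. f (z + t *\<^sub>R v)) a b \<and>
     der2 (\<lambda>t. f (z + t *\<^sub>R (\<i> *s v))) c d \<and> of_real (b + d) = 4 * qform F v)"

lemma has_levi_add: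
  assumes "has_levi f z F" "has_levi g z G"
  shows "has_levi (\<lambda>z. f z + e * g z) z (\<lambda>j k. F j k + of_real e * G j k)"
  unfolding has_levi_def
proof
  fix v
  from assms obtain a b c d a' b' c' d' where
    1: "der2 (\<lambda>t. f (z + t *\<^sub>R v)) a b" "der2 (\<lambda>t. f (z + t *\<^sub>R (\<i> *s v))) c d" "of_real (b + d) = 4 * qform F v"
    and 2: "der2 (\<lambda>t. g (z + t *\<^sub>R v)) a' b'" "der2 (\<lambda>t. g (z + t *\<^sub>R (\<i> *s v))) c' d'" "of_real (b' + d') = 4 * qform G v"
    unfolding has_levi_def by meson
  have "qform (\<lambda>j k. F j k + of_real e * G j k) v = qform F v + of_real e * qform G v"
    by (simp add: qform_def ring_distribs sum.distrib sum_distrib_left mult.assoc)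
  then have "of_real ((b + e * b') + (d + e * d')) = 4 * qform (\<lambda>j k. F j k + of_real e * G j k) v"
    using arg_cong2[OF 1(3) 2(3), of "\<lambda>x y. x + of_real e * y"] by (simp add: algebra_simps)
  then show "\<exists>a b c d. der2 (\<lambda>t. f (z + t *\<^sub>R v) + e * g (z + t *\<^sub>R v)) a b \<and>
     der2 (\<lambda>t. f (z + t *\<^sub>R (\<i> *s v)) + e * g (z + t *\<^sub>R (\<i> *s v))) c d \<and>
     of_real (b + d) = 4 * qform (\<lambda>j k. F j k + of_real e * G j k) v"
    using der2_add[OF 1(1) der2_bounded_linear[OF bounded_linear_mult_right 2(1), of e]]
      der2_add[OF 1(2) der2_bounded_linear[OF bounded_linear_mult_right 2(2), of e]] by blast
qed

lemma eventually_line: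
  fixes z v :: "'a::real_normed_vector"
  assumes "\<forall>\<^sub>F y in nhds z. P y"
  shows "\<forall>\<^sub>F t in nhds (0::real). P (z + t *\<^sub>R v)"
proof -
  have "filterlim (\<lambda>t::real. z + t *\<^sub>R v) (nhds (z + 0 *\<^sub>R v)) (nhds 0)"
    by (intro tendsto_intros filterlim_ident)
  then show ?thesis using assms by (simp add: filterlim_iff)
qed

lemma has_levi_local_max:
  assumes "has_levi f z F" "\<forall>\<^sub>F y in nhds z. f y \<le> f z"
  shows "pos_semidef_on UNIV (\<lambda>j k. - F j k)"
  unfolding pos_semidef_on_def
proof
  fix v :: "'a \<Rightarrow> complex"
  let ?v = "\<chi> j. v j"
  from assms(1) obtain a b c d where
    1: "der2 (\<lambda>t. f (z + t *\<^sub>R ?v)) a b" "der2 (\<lambda>t. f (z + t *\<^sub>R (\<i> *s ?v))) c d" "of_real (b + d) = 4 * qform F ?v"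
    unfolding has_levi_def by meson
  have "b \<le> 0" using der2_local_max[OF 1(1)] eventually_line[OF assms(2), of ?v] by simp
  moreover have "d \<le> 0" using der2_local_max[OF 1(2)] eventually_line[OF assms(2), of "\<i> *s ?v"] by simp
  moreover have "(\<Sum>j\<in>UNIV. \<Sum>k\<in>UNIV. - F j k * v j * cnj (v k)) = - qform F ?v"
    by (simp add: qform_def sum_negf)
  moreover have "qform F ?v = of_real ((b + d) / 4)" using 1(3) by (simp add: field_simps)
  ultimately show "Im (\<Sum>j\<in>UNIV. \<Sum>k\<in>UNIV. - F j k * v j * cnj (v k)) = 0 \<and>
      0 \<le> Re (\<Sum>j\<in>UNIV. \<Sum>k\<in>UNIV. - F j k * v j * cnj (v k))" by simp
qed

text \<open>The complex Hessian of exp(-\<alpha>|w|^2), the barrier function of Hopf's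
  argument.\<close>

definition gauss_levi :: "real \<Rightarrow> complex^'n::finite \<Rightarrow> 'n \<Rightarrow> 'n \<Rightarrow> complex" where
  "gauss_levi \<alpha> w j k = of_real (exp (- \<alpha> * (norm w)\<^sup>2)) *
     (of_real (\<alpha>\<^sup>2) * cnj (w $ j) * w $ k - (if j = k then of_real \<alpha> else 0))"

lemma der2_gauss:
  fixes w v :: "'a::real_inner"
  shows "der2 (\<lambda>t. exp (- \<alpha> * (norm (w + t *\<^sub>R v))\<^sup>2)) (exp (- \<alpha> * (norm w)\<^sup>2) * (- 2 * \<alpha> * (w \<bullet> v)))
     (exp (- \<alpha> * (norm w)\<^sup>2) * (4 * \<alpha>\<^sup>2 * (w \<bullet> v)\<^sup>2 - 2 * \<alpha> * (norm v)\<^sup>2))"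
proof -
  have n: "(norm (w + t *\<^sub>R v))\<^sup>2 = (norm w)\<^sup>2 + 2 * t * (w \<bullet> v) + t\<^sup>2 * (norm v)\<^sup>2" for t
    by (simp only: power2_norm_eq_inner)
       (simp add: inner_simps inner_commute[of v w] power2_eq_square algebra_simps)
  let ?f' = "\<lambda>t. exp (- \<alpha> * ((norm w)\<^sup>2 + 2 * t * (w \<bullet> v) + t\<^sup>2 * (norm v)\<^sup>2)) *
     (- \<alpha> * (2 * (w \<bullet> v) + 2 * t * (norm v)\<^sup>2))"
  show ?thesis unfolding der2_def n
    apply (intro exI[of _ ?f'] conjI always_eventually allI)
    subgoal
      unfolding has_real_derivative_iff_has_vector_derivative[symmetric]
      by (auto intro!: derivative_eq_intros simp: algebra_simps)
    subgoal by simp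
    subgoal
      unfolding has_real_derivative_iff_has_vector_derivative[symmetric]
      by (auto intro!: derivative_eq_intros simp: algebra_simps power2_eq_square)
    done
qed

lemma has_levi_gauss: "has_levi (\<lambda>z. exp (- \<alpha> * (norm (z - z0))\<^sup>2)) z (gauss_levi \<alpha> (z - z0))"
  unfolding has_levi_def
proof
  fix v
  let ?w = "z - z0"
  let ?E = "exp (- \<alpha> * (norm ?w)\<^sup>2)"
  \<comment> \<open>The real inner products of w with v and iv are the real part of S and minus its
    imaginary part, so their squares add up to |S|^2.\<close>
  define S where "S = (\<Sum>j\<in>UNIV. cnj (?w $ j) * v $ j)"
  have r: "?w \<bullet> v = Re S" by (simp add: S_def inner_vec_def inner_complex_def algebra_simps)
  have i: "?w \<bullet> (\<i> *s v) = - Im S" by (simp add: S_def inner_vec_def inner_complex_def sum_negf[symmetric] algebra_simps)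
  have nv: "norm (\<i> *s v) = norm v" by (simp add: norm_vec_def L2_set_def norm_mult)
  have e: "z + t *\<^sub>R u - z0 = ?w + t *\<^sub>R u" for t u by simp
  have "qform (gauss_levi \<alpha> ?w) v = of_real ?E * (of_real (\<alpha>\<^sup>2) * (S * cnj S) - of_real \<alpha> * (\<Sum>j\<in>UNIV. v $ j * cnj (v $ j)))"
  proof -
    have 1: "S * cnj S = (\<Sum>j\<in>UNIV. \<Sum>k\<in>UNIV. (cnj (?w $ j) * v $ j) * (?w $ k * cnj (v $ k)))"
      by (simp add: S_def sum_product)
    have 2: "(\<Sum>j\<in>UNIV. \<Sum>k\<in>UNIV. (if j = k then of_real \<alpha> else 0) * v $ j * cnj (v $ k))
        = of_real \<alpha> * (\<Sum>j\<in>UNIV. v $ j * cnj (v $ j))"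
      by (simp add: if_distrib[of "\<lambda>x. x * _"] sum_distrib_left mult.assoc cong: if_cong)
    have "qform (gauss_levi \<alpha> ?w) v = of_real ?E * ((\<Sum>j\<in>UNIV. \<Sum>k\<in>UNIV. of_real (\<alpha>\<^sup>2) * ((cnj (?w $ j) * v $ j) * (?w $ k * cnj (v $ k))))
      - (\<Sum>j\<in>UNIV. \<Sum>k\<in>UNIV. (if j = k then of_real \<alpha> else 0) * v $ j * cnj (v $ k)))"
      unfolding qform_def gauss_levi_def sum_subtractf[symmetric] sum_distrib_left
      by (intro sum.cong refl) (simp add: algebra_simps)
    then show ?thesis unfolding 1 2 sum_distrib_left[symmetric] .
  qed
  also have "S * cnj S = of_real ((Re S)\<^sup>2 + (Im S)\<^sup>2)"
    by (simp add: complex_eq_iff power2_eq_square)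
  also have "(\<Sum>j\<in>UNIV. v $ j * cnj (v $ j)) = of_real ((norm v)\<^sup>2)" by (rule sum_cmod_eq_norm)
  finally have q: "qform (gauss_levi \<alpha> ?w) v = of_real (?E * (\<alpha>\<^sup>2 * ((Re S)\<^sup>2 + (Im S)\<^sup>2) - \<alpha> * (norm v)\<^sup>2))"
    by simp
  have "of_real (?E * (4 * \<alpha>\<^sup>2 * (?w \<bullet> v)\<^sup>2 - 2 * \<alpha> * (norm v)\<^sup>2) +
      ?E * (4 * \<alpha>\<^sup>2 * (?w \<bullet> (\<i> *s v))\<^sup>2 - 2 * \<alpha> * (norm (\<i> *s v))\<^sup>2)) = 4 * qform (gauss_levi \<alpha> ?w) v"
    unfolding q r i nv by (simp add: algebra_simps)
  then show "\<exists>a b c d. der2 (\<lambda>t. exp (- \<alpha> * (norm (z + t *\<^sub>R v - z0))\<^sup>2)) a b \<and>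
     der2 (\<lambda>t. exp (- \<alpha> * (norm (z + t *\<^sub>R (\<i> *s v) - z0))\<^sup>2)) c d \<and>
     of_real (b + d) = 4 * qform (gauss_levi \<alpha> ?w) v"
    unfolding e using der2_gauss by blast
qed

text \<open>The term of second order in \<alpha> carries the elliptic form at the conjugate of w.
  Away from the centre of the barrier a large \<alpha> therefore makes the trace positive.\<close>

lemma gauss_levi_trace:
  "contract (gauss_levi \<alpha> w) A = of_real (exp (- \<alpha> * (norm w)\<^sup>2) * \<alpha>) *
     (of_real \<alpha> * (\<Sum>j\<in>UNIV. \<Sum>k\<in>UNIV. cnj (w $ j) * w $ k * A j k) - (\<Sum>j\<in>UNIV. A j j))"
proof -
  have "(\<Sum>j\<in>UNIV. A j j) = (\<Sum>j\<in>UNIV. \<Sum>k\<in>UNIV. (if j = k then 1 else 0) * A j k)"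
    by (simp add: if_distrib[of "\<lambda>x. x * _"] cong: if_cong)
  then show ?thesis
    unfolding gauss_levi_def
    by (simp only: sum_distrib_left sum_subtractf[symmetric] right_diff_distrib)
       (intro sum.cong refl, simp add: algebra_simps power2_eq_square)
qed

text \<open>By the parallelogram identity a ball of half the radius, internally tangent to a larger
  ball, meets its boundary sphere only in the point of tangency.\<close>

lemma inner_ball_touch:
  fixes w u :: "'a::real_inner"
  assumes "norm w \<le> norm u" "w \<noteq> u"
  shows "norm (w + u) < 2 * norm u"
proof -
  have "(norm (w + u))\<^sup>2 + (norm (w - u))\<^sup>2 = 2 * (norm w)\<^sup>2 + 2 * (norm u)\<^sup>2"
    by (simp add: power2_norm_eq_inner inner_simps inner_commute)
  moreover have "(norm w)\<^sup>2 \<le> (norm u)\<^sup>2" using assms(1) by (simp add: power_mono)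
  moreover have "(norm (w - u))\<^sup>2 > 0" using assms(2) by simp
  moreover have "(2 * norm u)\<^sup>2 = 4 * (norm u)\<^sup>2" by (simp add: power_mult_distrib)
  ultimately have "(norm (w + u))\<^sup>2 < (2 * norm u)\<^sup>2" by linarith
  then show ?thesis by (rule power2_less_imp_less) simp
qed

text \<open>The Levi matrix \<open>F\<close> is supplied as a parameter, since f is not assumed to
  be C^2. Continuity is imposed on the coefficients \<open>A\<close>, which lets a strict inequality
  at one point persist nearby.\<close>

locale subsolution =
  fixes W :: "(complex^'n::finite) set" and f :: "complex^'n \<Rightarrow> real"
    and A F :: "complex^'n \<Rightarrow> 'n \<Rightarrow> 'n \<Rightarrow> complex"
  assumes open_W: "open W" and cont: "continuous_on W f"
    and A: "\<And>j k. continuous_on W (\<lambda>z. A z j k)" "\<And>z. z \<in> W \<Longrightarrow> pos_trace (A z)"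
    and levi: "\<And>z. z \<in> W \<Longrightarrow> has_levi f z (F z)"
    and sub: "\<And>z. z \<in> W \<Longrightarrow> Re (contract (F z) (A z)) \<ge> 0"
begin

text \<open>Hopf's barrier argument: a closed ball on whose boundary the maximum is attained in a
  single point \<open>x\<close> only.\<close>

lemma hopf_barrier:
  assumes x: "x \<in> W" and max: "\<And>z. z \<in> W \<Longrightarrow> f z \<le> f x"
    and touch: "dist z0 x = \<sigma>" "\<sigma> > 0" "\<And>z. z \<in> W \<Longrightarrow> dist z0 z \<le> \<sigma> \<Longrightarrow> z \<noteq> x \<Longrightarrow> f z < f x"
  shows False
proof -
  let ?a = "\<lambda>z. \<Sum>j\<in>UNIV. \<Sum>k\<in>UNIV. cnj ((z - z0) $ j) * (z - z0) $ k * A z j k"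
  let ?tr = "\<lambda>z. \<Sum>j\<in>UNIV. A z j j"
  have "x \<noteq> z0" using touch by auto
  then have "(\<chi> j. cnj ((x - z0) $ j)) \<noteq> 0" by (auto simp: vec_eq_iff)
  then have a0: "Re (?a x) > 0"
    using A(2)[OF x] unfolding pos_trace_def
    by (drule_tac x = "\<chi> j. cnj ((x - z0) $ j)" in spec) simp
  \<comment> \<open>Chosen so that \<alpha> times the elliptic term exceeds the trace of
    \<open>A\<close> at x; the summand 1 makes the inequality strict.\<close>
  define \<alpha> where "\<alpha> = (\<bar>Re (?tr x)\<bar> + 1) / Re (?a x)"
  have \<alpha>: "\<alpha> > 0" "\<alpha> * Re (?a x) > Re (?tr x)" using a0 by (auto simp: \<alpha>_def intro!: divide_pos_pos)
  define Q where "Q = (\<lambda>z. \<alpha> * Re (?a z) - Re (?tr z))"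
  have "continuous_on W Q" unfolding Q_def by (intro continuous_intros A(1))
  then have "open (W \<inter> Q -` {0<..})"
    using open_W by (simp add: continuous_on_open_vimage Int_commute)
  moreover have "x \<in> W \<inter> Q -` {0<..}" using \<alpha> x by (simp add: Q_def)
  ultimately obtain \<delta> where \<delta>: "\<delta> > 0" "cball x \<delta> \<subseteq> W \<inter> Q -` {0<..}"
    using open_contains_cball by blast
  define v where "v = (\<lambda>z. exp (- \<alpha> * (norm (z - z0))\<^sup>2))"
  \<comment> \<open>The part of the small sphere inside the touching ball. It is compact and misses
    x, so f stays below its maximum by a definite amount there.\<close>
  define K where "K = sphere x \<delta> \<inter> cball z0 \<sigma>"
  have KW: "K \<subseteq> W" using \<delta> by (auto simp: K_def)
  have Kx: "f z < f x" if "z \<in> K" for z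
    using touch(3)[of z] that KW \<delta>(1) by (auto simp: K_def)
  have "\<exists>\<mu> < f x. \<forall>z\<in>K. f z \<le> \<mu>"
  proof (cases "K = {}")
    case True then show ?thesis by (intro exI[of _ "f x - 1"]) auto
  next
    case False
    have "compact K" unfolding K_def by (intro compact_Int_closed compact_sphere closed_cball)
    from continuous_attains_sup[OF this False continuous_on_subset[OF cont KW]] Kx show ?thesis by blast
  qed
  then obtain \<mu> where \<mu>: "\<mu> < f x" "\<And>z. z \<in> K \<Longrightarrow> f z \<le> \<mu>" by blast
  \<comment> \<open>Half of the gap: since the barrier is at most 1, adding \<eta> times it on
    \<open>K\<close> still leaves a value below f x.\<close>
  define \<eta> where "\<eta> = (f x - \<mu>) / 2"
  have \<eta>: "\<eta> > 0" using \<mu> by (simp add: \<eta>_def)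
  define g where "g = (\<lambda>z. f z + \<eta> * v z)"
  \<comment> \<open>Inside the touching ball the gap of f decides, outside it the barrier is smaller
    than at x. Hence the perturbed function attains its maximum over the small ball in the
    interior.\<close>
  have gs: "g z < g x" if "z \<in> sphere x \<delta>" for z
  proof (cases "dist z0 z \<le> \<sigma>")
    case True
    then have "f z \<le> \<mu>" using \<mu>(2) that by (auto simp: K_def)
    moreover have "v z \<le> 1" "v x > 0" using \<alpha>(1) by (auto simp: v_def)
    then have "\<eta> * v z \<le> \<eta> * 1" "\<eta> * v x > 0" using \<eta> by (auto intro!: mult_left_mono simp del: mult_1_right)
    moreover have "f x = \<mu> + 2 * \<eta>" by (simp add: \<eta>_def field_simps)
    ultimately show ?thesis using \<eta> unfolding g_def by linarith
  next
    case False
    then have "(norm (z - z0))\<^sup>2 > (norm (x - z0))\<^sup>2"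
      using touch by (intro power_strict_mono) (auto simp: dist_norm norm_minus_commute)
    then have "v z < v x" using \<alpha>(1) by (simp add: v_def)
    moreover have "f z \<le> f x" using max \<delta> that by auto
    ultimately show ?thesis using \<eta> by (simp add: g_def add_le_less_mono)
  qed
  have "continuous_on (cball x \<delta>) g"
    unfolding g_def v_def using continuous_on_subset[OF cont] \<delta>(2) by (intro continuous_intros) auto
  from continuous_attains_sup[OF compact_cball _ this] \<delta>(1) obtain q where
    q: "q \<in> cball x \<delta>" "\<And>z. z \<in> cball x \<delta> \<Longrightarrow> g z \<le> g q" by auto
  have "q \<notin> sphere x \<delta>" using gs[of q] q(2)[of x] \<delta>(1) by fastforce
  then have qb: "q \<in> ball x \<delta>" using q(1) by auto
  have qW: "q \<in> W" "Q q > 0" using \<delta>(2) q(1) by auto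
  have "\<forall>\<^sub>F z in nhds q. z \<in> ball x \<delta>" using qb by (intro eventually_nhds_in_open) auto
  then have "\<forall>\<^sub>F z in nhds q. g z \<le> g q" by eventually_elim (use q(2) in auto)
  moreover have "has_levi g q (\<lambda>j k. F q j k + of_real \<eta> * gauss_levi \<alpha> (q - z0) j k)"
    unfolding g_def v_def by (intro has_levi_add levi qW has_levi_gauss)
  ultimately have "pos_semidef_on UNIV (\<lambda>j k. - (F q j k + of_real \<eta> * gauss_levi \<alpha> (q - z0) j k))"
    using has_levi_local_max by blast
  from pos_trace_nonneg(2)[OF A(2)[OF qW(1)] this]
  have "Re (contract (F q) (A q)) +
      \<eta> * Re (contract (gauss_levi \<alpha> (q - z0)) (A q)) \<le> 0"
    by (simp add: ring_distribs sum_negf sum_subtractf sum.distrib sum_distrib_left mult.assoc)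
  \<comment> \<open>The sign of this trace is that of \<open>Q\<close>, positive throughout the
    small ball. The perturbation is thus a strict subsolution, which an interior maximum
    forbids.\<close>
  moreover have "Re (contract (gauss_levi \<alpha> (q - z0)) (A q))
     = exp (- \<alpha> * (norm (q - z0))\<^sup>2) * \<alpha> * Q q"
    unfolding gauss_levi_trace Q_def by (simp del: of_real_mult)
  then have "Re (contract (gauss_levi \<alpha> (q - z0)) (A q)) > 0"
    using \<alpha>(1) qW(2) by simp
  ultimately show False using sub[OF qW(1)] \<eta> by (smt (verit) mult_pos_pos)
qed

lemma strong_maximum_principle:
  assumes p: "p \<in> W" and max: "\<And>z. z \<in> W \<Longrightarrow> f z \<le> f p"
  shows "\<forall>\<^sub>F z in nhds p. f z = f p"
proof -
  obtain R where R: "R > 0" "ball p R \<subseteq> W" using open_W p open_contains_ball by blast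
  have "f y = f p" if y: "y \<in> ball p (R / 2)" for y
  proof (rule ccontr)
    assume ne: "f y \<noteq> f p"
    \<comment> \<open>With y within R/2 of p, the ball about y through p stays in W.\<close>
    let ?C = "cball y (dist y p)"
    have CW: "?C \<subseteq> W"
    proof
      fix z assume "z \<in> ?C"
      then have "dist p z < R" using y dist_triangle[of p z y] by (auto simp: dist_commute)
      then show "z \<in> W" using R by auto
    qed
    define S where "S = {z \<in> ?C. f z = f p}"
    have "closed S" unfolding S_def
      by (rule continuous_closed_preimage_constant[OF continuous_on_subset[OF cont CW] closed_cball])
    moreover have "S \<subseteq> ?C" by (auto simp: S_def)
    ultimately have "compact S" using compact_cball bounded_subset compact_eq_bounded_closed by blast
    moreover have "p \<in> S" by (simp add: S_def)
    ultimately obtain x where x: "x \<in> S" "\<And>z. z \<in> S \<Longrightarrow> dist y x \<le> dist y z"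
      using distance_attains_inf[of S y] compact_imp_closed by blast
    have xf: "f x = f p" and xC: "dist y x \<le> dist y p" using x(1) by (auto simp: S_def)
    \<comment> \<open>x is a maximum point nearest to y. The ball with centre halfway between y and
      x contains no maximum point other than x, as the barrier argument requires.\<close>
    define u where "u = (x - y) /\<^sub>R 2"
    have "x \<noteq> y" using xf ne by auto
    then have u0: "norm u > 0" by (simp add: u_def)
    have nu: "dist y x = 2 * norm u" by (simp add: u_def dist_norm norm_minus_commute)
    have xyu: "x = (y + u) + u" by (simp add: u_def algebra_simps flip: scaleR_left_distrib)
    show False
    proof (rule hopf_barrier[of x "y + u" "norm u"])
      show "x \<in> W" using CW xC by auto
      show "f z \<le> f x" if "z \<in> W" for z using max that xf by simp
      show "dist (y + u) x = norm u" by (subst xyu) (simp add: dist_norm)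
      show "0 < norm u" by (rule u0)
      fix z assume z: "z \<in> W" "dist (y + u) z \<le> norm u" "z \<noteq> x"
      let ?w = "z - (y + u)"
      have "norm ?w \<le> norm u" "?w \<noteq> u" using z xyu by (auto simp: dist_norm norm_minus_commute algebra_simps)
      from inner_ball_touch[OF this] have d: "dist y z < dist y x"
        unfolding nu by (simp add: dist_norm norm_minus_commute)
      then have "z \<in> ?C" "z \<notin> S" using xC x(2)[of z] by auto
      then show "f z < f x" using max[OF z(1)] xf by (auto simp: S_def)
    qed
  qed
  moreover have "\<forall>\<^sub>F y in nhds p. y \<in> ball p (R / 2)"
    using R(1) by (intro eventually_nhds_in_open) auto
  ultimately show ?thesis by (auto elim: eventually_mono)
qed

end

section \<open>Wirtinger calculus\<close>

abbreviation dder :: "complex^'n::finite \<Rightarrow> (complex^'n \<Rightarrow> complex) \<Rightarrow> complex^'n \<Rightarrow> complex" where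
  "dder v f z \<equiv> frechet_derivative f (at z) v"

lemma has_derivative_dder: "f differentiable at z \<Longrightarrow> (f has_derivative (\<lambda>v. dder v f z)) (at z)"
  using frechet_derivative_works by blast

lemma dder_eq: "(f has_derivative f') (at z) \<Longrightarrow> dder v f z = f' v"
  using frechet_derivative_at by metis

lemma dder_cong:
  assumes "open U" "z \<in> U" "\<And>y. y \<in> U \<Longrightarrow> f y = g y"
  shows "dder v f z = dder v g z"
proof -
  have "(f has_derivative f') (at z) \<longleftrightarrow> (g has_derivative f') (at z)" for f'
    using has_derivative_transform_within_open[OF _ assms(1,2), of f f' UNIV g]
      has_derivative_transform_within_open[OF _ assms(1,2), of g f' UNIV f] assms(3) by auto
  then show ?thesis unfolding frechet_derivative_def by simp
qed

lemma dder_add: "f differentiable at z \<Longrightarrow> g differentiable at z \<Longrightarrow>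
    dder v (\<lambda>z. f z + g z) z = dder v f z + dder v g z"
  by (rule dder_eq) (intro has_derivative_add has_derivative_dder)

lemma dder_sum: "(\<And>i. i \<in> I \<Longrightarrow> f i differentiable at z) \<Longrightarrow>
    dder v (\<lambda>z. \<Sum>i\<in>I. f i z) z = (\<Sum>i\<in>I. dder v (f i) z)"
  by (rule dder_eq) (intro has_derivative_sum has_derivative_dder)

lemma dder_mult: "f differentiable at z \<Longrightarrow> g differentiable at z \<Longrightarrow>
    dder v (\<lambda>z. f z * g z) z = f z * dder v g z + dder v f z * g z"
  by (rule dder_eq) (intro has_derivative_mult has_derivative_dder)

lemma dder_cmult: "f differentiable at z \<Longrightarrow> dder v (\<lambda>z. c * f z) z = c * dder v f z"
  by (rule dder_eq) (intro has_derivative_mult_right has_derivative_dder)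

lemma dder_cnj: "f differentiable at z \<Longrightarrow> dder v (\<lambda>z. cnj (f z)) z = cnj (dder v f z)"
  by (rule dder_eq) (intro has_derivative_cnj has_derivative_dder)

section \<open>Symmetry of second derivatives\<close>

lemma dder_line:
  assumes "f differentiable at (z + t *\<^sub>R v)"
  shows "((\<lambda>t. f (z + t *\<^sub>R v)) has_vector_derivative dder v f (z + t *\<^sub>R v)) (at t)"
proof -
  have "((\<lambda>t. z + t *\<^sub>R v) has_derivative (\<lambda>h. h *\<^sub>R v)) (at t)"
    by (auto intro!: derivative_eq_intros)
  from has_derivative_compose[OF this has_derivative_dder[OF assms]]
  show ?thesis unfolding has_vector_derivative_def
    using linear_scale[OF linear_frechet_derivative[OF assms]] by simp
qed

text \<open>The mean value theorem needs real values, hence the functional \<open>L\<close>, later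
  the real or the imaginary part. Two functions at two base points allow the increment of a
  difference to be taken in one application.\<close>

lemma mvt_line:
  assumes L: "bounded_linear (L :: complex \<Rightarrow> real)" and h: "h > 0"
    and d: "\<And>t. 0 \<le> t \<Longrightarrow> t \<le> h \<Longrightarrow> f differentiable at (z + t *\<^sub>R v) \<and> g differentiable at (y + t *\<^sub>R v)"
  shows "\<exists>\<xi>. 0 < \<xi> \<and> \<xi> < h \<and> L (f (z + h *\<^sub>R v)) - L (g (y + h *\<^sub>R v)) - (L (f z) - L (g y)) =
     h * (L (dder v f (z + \<xi> *\<^sub>R v)) - L (dder v g (y + \<xi> *\<^sub>R v)))"
proof -
  have "((\<lambda>t. L (f (z + t *\<^sub>R v)) - L (g (y + t *\<^sub>R v))) has_real_derivative
      L (dder v f (z + t *\<^sub>R v)) - L (dder v g (y + t *\<^sub>R v))) (at t)" if "0 \<le> t" "t \<le> h" for t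
    unfolding has_real_derivative_iff_has_vector_derivative
    by (intro has_vector_derivative_diff bounded_linear.has_vector_derivative[OF L] dder_line) (use d that in auto)
  from MVT2[OF h this] show ?thesis by auto
qed

lemma second_difference:
  assumes L: "bounded_linear (L :: complex \<Rightarrow> real)" and h: "h > 0"
    and d: "\<And>s t. 0 \<le> s \<Longrightarrow> s \<le> h \<Longrightarrow> 0 \<le> t \<Longrightarrow> t \<le> h \<Longrightarrow>
      f differentiable at (z + s *\<^sub>R v + t *\<^sub>R w) \<and> dder v f differentiable at (z + s *\<^sub>R v + t *\<^sub>R w)"
  shows "\<exists>\<xi> \<eta>. 0 < \<xi> \<and> \<xi> < h \<and> 0 < \<eta> \<and> \<eta> < h \<and>
     L (f (z + h *\<^sub>R v + h *\<^sub>R w)) - L (f (z + h *\<^sub>R v)) - (L (f (z + h *\<^sub>R w)) - L (f z)) =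
     h * (h * L (dder w (dder v f) (z + \<xi> *\<^sub>R v + \<eta> *\<^sub>R w)))"
proof -
  have c: "z + h *\<^sub>R w + t *\<^sub>R v = z + t *\<^sub>R v + h *\<^sub>R w" for t by simp
  have "f differentiable at (z + h *\<^sub>R w + t *\<^sub>R v) \<and> f differentiable at (z + t *\<^sub>R v)"
    if "0 \<le> t" "t \<le> h" for t
    using d[of t h] d[of t 0] that h unfolding c by simp
  from mvt_line[OF L h this] obtain \<xi> where \<xi>: "0 < \<xi>" "\<xi> < h"
    "L (f (z + h *\<^sub>R w + h *\<^sub>R v)) - L (f (z + h *\<^sub>R v)) - (L (f (z + h *\<^sub>R w)) - L (f z)) =
     h * (L (dder v f (z + h *\<^sub>R w + \<xi> *\<^sub>R v)) - L (dder v f (z + \<xi> *\<^sub>R v)))" by blast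
  \<comment> \<open>The zero function in the second slot reduces the two-function rule to the
    ordinary mean value theorem in the direction w.\<close>
  have "dder v f differentiable at (z + \<xi> *\<^sub>R v + t *\<^sub>R w) \<and> (\<lambda>x. 0 :: complex) differentiable at (z + t *\<^sub>R w)"
    if "0 \<le> t" "t \<le> h" for t
    using d[of \<xi> t] that \<xi> by simp
  from mvt_line[OF L h this] obtain \<eta> where "0 < \<eta>" "\<eta> < h"
    "L (dder v f (z + \<xi> *\<^sub>R v + h *\<^sub>R w)) - L (dder v f (z + \<xi> *\<^sub>R v)) = h * L (dder w (dder v f) (z + \<xi> *\<^sub>R v + \<eta> *\<^sub>R w))"
    using linear_0[OF bounded_linear.linear[OF L]] by auto
  with \<xi> show ?thesis unfolding c by metis
qed

text \<open>Both iterated derivatives are limits of the same second difference quotient.\<close>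

lemma dder_commute:
  assumes U: "open U" "z \<in> U" and C: "Ck_on 2 U f"
  shows "dder w (dder v f) z = dder v (dder w f) z"
proof -
  have d1: "f differentiable at y" if "y \<in> U" for y using C that by (simp add: numeral_2_eq_2)
  have d2: "dder v f differentiable at y" if "y \<in> U" for y v using C that by (simp add: numeral_2_eq_2)
  have c: "continuous_on U (dder w (dder v f))" for v w using C by (simp add: numeral_2_eq_2)
  have *: "L (dder w (dder v f) z) = L (dder v (dder w f) z)" if L: "bounded_linear (L :: complex \<Rightarrow> real)" for L
  proof (rule ccontr)
    assume ne: "L (dder w (dder v f) z) \<noteq> L (dder v (dder w f) z)"
    define e where "e = \<bar>L (dder w (dder v f) z) - L (dder v (dder w f) z)\<bar> / 2"
    have e: "e > 0" using ne by (simp add: e_def)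
    have near: "\<exists>\<delta>>0. \<forall>y. dist z y < \<delta> \<longrightarrow> y \<in> U \<and> \<bar>L (dder b (dder a f) y) - L (dder b (dder a f) z)\<bar> < e" for a b
    proof -
      have "continuous_on U (\<lambda>y. L (dder b (dder a f) y))"
        using continuous_on_compose2[OF linear_continuous_on[OF L, of UNIV] c] by simp
      then obtain d where "d > 0" "\<And>y. y \<in> U \<Longrightarrow> dist y z < d \<Longrightarrow> \<bar>L (dder b (dder a f) y) - L (dder b (dder a f) z)\<bar> < e"
        using e U(2) unfolding continuous_on_iff dist_real_def by meson
      moreover obtain d' where "d' > 0" "ball z d' \<subseteq> U" using U open_contains_ball by blast
      ultimately show ?thesis by (intro exI[of _ "min d d'"]) (auto simp: dist_commute subset_eq)
    qed
    obtain d d' where d: "d > 0" "\<And>y. dist z y < d \<Longrightarrow> y \<in> U \<and> \<bar>L (dder w (dder v f) y) - L (dder w (dder v f) z)\<bar> < e"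
      and d': "d' > 0" "\<And>y. dist z y < d' \<Longrightarrow> y \<in> U \<and> \<bar>L (dder v (dder w f) y) - L (dder v (dder w f) z)\<bar> < e"
      using near by meson
    \<comment> \<open>The sides h v and h w of the parallelogram together stay shorter than both
      radii; the added 1 excludes division by zero and makes the estimate strict.\<close>
    define h where "h = min d d' / (norm v + norm w + 1)"
    have n1: "norm v + norm w + 1 > 0" by (simp add: add_nonneg_pos)
    have h: "h > 0" using d(1) d'(1) n1 by (simp add: h_def)
    have close: "dist z (z + s *\<^sub>R v + t *\<^sub>R w) < min d d'" if "0 \<le> s" "s \<le> h" "0 \<le> t" "t \<le> h" for s t
    proof -
      have "dist z (z + s *\<^sub>R v + t *\<^sub>R w) = norm (s *\<^sub>R v + t *\<^sub>R w)"
        by (metis add.assoc add_diff_cancel_left' dist_commute dist_norm)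
      also have "\<dots> \<le> s * norm v + t * norm w"
        by (rule norm_triangle_le) (use that in simp)
      also have "\<dots> \<le> h * norm v + h * norm w" using that by (intro add_mono mult_right_mono) auto
      also have "\<dots> < h * (norm v + norm w + 1)" using h by (simp add: algebra_simps)
      also have "\<dots> = min d d'" using n1 by (simp add: h_def)
      finally show ?thesis .
    qed
    have inU: "z + s *\<^sub>R v + t *\<^sub>R w \<in> U" if "0 \<le> s" "s \<le> h" "0 \<le> t" "t \<le> h" for s t
      using close[OF that] d(2) by simp
    obtain \<xi> \<eta> where \<xi>: "0 < \<xi>" "\<xi> < h" "0 < \<eta>" "\<eta> < h"
      "L (f (z + h *\<^sub>R v + h *\<^sub>R w)) - L (f (z + h *\<^sub>R v)) - (L (f (z + h *\<^sub>R w)) - L (f z)) =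
       h * (h * L (dder w (dder v f) (z + \<xi> *\<^sub>R v + \<eta> *\<^sub>R w)))"
      using second_difference[OF L h, where z = z and v = v and w = w and f = f] d1 d2 inU by blast
    have "z + t *\<^sub>R w + s *\<^sub>R v \<in> U" if "0 \<le> s" "s \<le> h" "0 \<le> t" "t \<le> h" for s t
      using inU[OF that] by (simp add: ac_simps)
    then obtain \<xi>' \<eta>' where \<xi>': "0 < \<xi>'" "\<xi>' < h" "0 < \<eta>'" "\<eta>' < h"
      "L (f (z + h *\<^sub>R w + h *\<^sub>R v)) - L (f (z + h *\<^sub>R w)) - (L (f (z + h *\<^sub>R v)) - L (f z)) =
       h * (h * L (dder v (dder w f) (z + \<xi>' *\<^sub>R w + \<eta>' *\<^sub>R v)))"
      using second_difference[OF L h, where z = z and v = w and w = v and f = f] d1 d2 by blast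
    let ?P = "z + \<xi> *\<^sub>R v + \<eta> *\<^sub>R w" and ?P' = "z + \<eta>' *\<^sub>R v + \<xi>' *\<^sub>R w"
    have "h * (h * L (dder w (dder v f) ?P)) = h * (h * L (dder v (dder w f) ?P'))"
    proof -
      have c: "z + h *\<^sub>R w + h *\<^sub>R v = z + h *\<^sub>R v + h *\<^sub>R w" "z + \<xi>' *\<^sub>R w + \<eta>' *\<^sub>R v = ?P'" by simp_all
      show ?thesis using \<xi>(5) \<xi>'(5)[unfolded c] by linarith
    qed
    then have "L (dder w (dder v f) ?P) = L (dder v (dder w f) ?P')" using h by simp
    moreover have "\<bar>L (dder w (dder v f) ?P) - L (dder w (dder v f) z)\<bar> < e"
      using d(2)[of ?P] close[of \<xi> \<eta>] \<xi> by simp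
    moreover have "\<bar>L (dder v (dder w f) ?P') - L (dder v (dder w f) z)\<bar> < e"
      using d'(2)[of ?P'] close[of \<eta>' \<xi>'] \<xi>' by simp
    moreover have "\<bar>a - b\<bar> < 2 * e" if "p = p'" "\<bar>p - a\<bar> < e" "\<bar>p' - b\<bar> < e" for a b p p' :: real
      using that by linarith
    ultimately show False unfolding e_def by fastforce
  qed
  show ?thesis using *[OF bounded_linear_Re] *[OF bounded_linear_Im] by (simp add: complex_eq_iff)
qed

section \<open>Wirtinger derivatives: product rule, conjugation and commutation\<close>

lemma axis_decomp:
  fixes v :: "complex^'n::finite"
  shows "v = (\<Sum>j\<in>UNIV. Re (v $ j) *\<^sub>R axis j 1 + Im (v $ j) *\<^sub>R axis j \<i>)"
proof (rule vec_eq_iff[THEN iffD2], rule allI)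
  fix k
  have "(\<Sum>j\<in>UNIV. Re (v $ j) *\<^sub>R axis j 1 + Im (v $ j) *\<^sub>R axis j \<i>) $ k =
     (\<Sum>j\<in>UNIV. if j = k then of_real (Re (v $ k)) + of_real (Im (v $ k)) * \<i> else 0)"
    unfolding sum_component by (intro sum.cong refl) (auto simp: axis_def scaleR_conv_of_real[where 'a = complex])
  also have "\<dots> = v $ k" by (simp add: complex_eq_iff)
  finally show "v $ k = (\<Sum>j\<in>UNIV. Re (v $ j) *\<^sub>R axis j 1 + Im (v $ j) *\<^sub>R axis j \<i>) $ k" ..
qed

lemma dder_wirtinger:
  assumes "f differentiable at z"
  shows "dder v f z = (\<Sum>j\<in>UNIV. partial_z j f z * v $ j + partial_zbar j f z * cnj (v $ j))"
proof -
  note lin = linear_frechet_derivative[OF assms]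
  have "dder v f z = dder (\<Sum>j\<in>UNIV. Re (v $ j) *\<^sub>R axis j 1 + Im (v $ j) *\<^sub>R axis j \<i>) f z"
    by (rule arg_cong[OF axis_decomp[of v], of "\<lambda>v. dder v f z"])
  also have "\<dots> = (\<Sum>j\<in>UNIV. of_real (Re (v $ j)) * dder (axis j 1) f z + of_real (Im (v $ j)) * dder (axis j \<i>) f z)"
    by (simp only: linear_sum[OF lin] linear_add[OF lin] linear_scale[OF lin] scaleR_conv_of_real[where 'a = complex])
  also have "\<dots> = (\<Sum>j\<in>UNIV. partial_z j f z * v $ j + partial_zbar j f z * cnj (v $ j))"
  proof (rule sum.cong[OF refl])
    fix j
    have "of_real (Re c) * P + of_real (Im c) * Q = (P - \<i> * Q) / 2 * c + (P + \<i> * Q) / 2 * cnj c" for c P Q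
      by (simp add: complex_eq_iff field_simps)
    then show "of_real (Re (v $ j)) * dder (axis j 1) f z + of_real (Im (v $ j)) * dder (axis j \<i>) f z =
      partial_z j f z * v $ j + partial_zbar j f z * cnj (v $ j)"
      unfolding partial_z_def partial_zbar_def .
  qed
  finally show ?thesis .
qed

lemma partial_cong:
  assumes "open U" "z \<in> U" "\<And>y. y \<in> U \<Longrightarrow> f y = g y"
  shows "partial_z j f z = partial_z j g z" "partial_zbar j f z = partial_zbar j g z"
  unfolding partial_z_def partial_zbar_def using dder_cong[OF assms] by simp_all

lemma partial_const: "partial_z j (\<lambda>z. c) z = 0" "partial_zbar j (\<lambda>z. c) z = 0"
  by (simp_all add: partial_z_def partial_zbar_def)

lemma partial_sum:
  assumes "\<And>i. i \<in> I \<Longrightarrow> f i differentiable at z"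
  shows "partial_z j (\<lambda>z. \<Sum>i\<in>I. f i z) z = (\<Sum>i\<in>I. partial_z j (f i) z)"
    "partial_zbar j (\<lambda>z. \<Sum>i\<in>I. f i z) z = (\<Sum>i\<in>I. partial_zbar j (f i) z)"
proof -
  have "dder v (\<lambda>z. \<Sum>i\<in>I. f i z) z = (\<Sum>i\<in>I. dder v (f i) z)" for v
    using assms by (rule dder_sum)
  then show "partial_z j (\<lambda>z. \<Sum>i\<in>I. f i z) z = (\<Sum>i\<in>I. partial_z j (f i) z)"
    "partial_zbar j (\<lambda>z. \<Sum>i\<in>I. f i z) z = (\<Sum>i\<in>I. partial_zbar j (f i) z)"
    unfolding partial_z_def partial_zbar_def sum_divide_distrib[symmetric]
      sum_subtractf sum.distrib sum_distrib_left[symmetric]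
    by simp_all
qed

lemma partial_mult:
  assumes "f differentiable at z" "g differentiable at z"
  shows "partial_z j (\<lambda>z. f z * g z) z = f z * partial_z j g z + partial_z j f z * g z"
    "partial_zbar j (\<lambda>z. f z * g z) z = f z * partial_zbar j g z + partial_zbar j f z * g z"
  by (simp_all add: partial_z_def partial_zbar_def dder_mult[OF assms] field_simps)

lemma partial_cmult:
  assumes "f differentiable at z"
  shows "partial_z j (\<lambda>z. f z * c) z = partial_z j f z * c"
    "partial_zbar j (\<lambda>z. f z * c) z = partial_zbar j f z * c"
  using dder_cmult[OF assms, where c = c]
  by (simp_all add: partial_z_def partial_zbar_def mult.commute[of _ c] field_simps)

lemma partial_cnj:
  assumes "f differentiable at z"
  shows "partial_zbar j (\<lambda>z. cnj (f z)) z = cnj (partial_z j f z)"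
  by (simp add: partial_z_def partial_zbar_def dder_cnj[OF assms])

lemma partial_differentiable:
  assumes "\<And>v. dder v f differentiable at z"
  shows "partial_z j f differentiable at z" "partial_zbar j f differentiable at z"
  unfolding partial_z_def[abs_def] partial_zbar_def[abs_def] divide_inverse
  by (intro differentiable_mult differentiable_diff differentiable_add differentiable_const assms)+

lemma dder_partial:
  assumes "\<And>v. dder v f differentiable at z"
  shows "dder v (partial_z j f) z = (dder v (dder (axis j 1) f) z - \<i> * dder v (dder (axis j \<i>) f) z) / 2"
    "dder v (partial_zbar j f) z = (dder v (dder (axis j 1) f) z + \<i> * dder v (dder (axis j \<i>) f) z) / 2"
proof -
  have "((\<lambda>z. (dder (axis j 1) f z - \<i> * dder (axis j \<i>) f z) / 2) has_derivative
      (\<lambda>v. (dder v (dder (axis j 1) f) z - \<i> * dder v (dder (axis j \<i>) f) z) / 2)) (at z)"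
    by (auto intro!: derivative_eq_intros has_derivative_dder[OF assms])
  then show "dder v (partial_z j f) z = (dder v (dder (axis j 1) f) z - \<i> * dder v (dder (axis j \<i>) f) z) / 2"
    unfolding partial_z_def[abs_def] by (rule dder_eq)
  have "((\<lambda>z. (dder (axis j 1) f z + \<i> * dder (axis j \<i>) f z) / 2) has_derivative
      (\<lambda>v. (dder v (dder (axis j 1) f) z + \<i> * dder v (dder (axis j \<i>) f) z) / 2)) (at z)"
    by (auto intro!: derivative_eq_intros has_derivative_dder[OF assms])
  then show "dder v (partial_zbar j f) z = (dder v (dder (axis j 1) f) z + \<i> * dder v (dder (axis j \<i>) f) z) / 2"
    unfolding partial_zbar_def[abs_def] by (rule dder_eq)
qed

lemma partial_commute:
  assumes "open U" "z \<in> U" "Ck_on 2 U f"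
  shows "partial_z j (partial_z k f) z = partial_z k (partial_z j f) z"
    "partial_z j (partial_zbar k f) z = partial_zbar k (partial_z j f) z"
proof -
  have d: "dder v f differentiable at z" for v using assms(2,3) by (simp add: numeral_2_eq_2)
  note s = dder_commute[OF assms]
  show "partial_z j (partial_z k f) z = partial_z k (partial_z j f) z"
    unfolding partial_z_def[of j "partial_z k f"] partial_z_def[of k "partial_z j f"] dder_partial[OF d]
    by (simp add: s[of "axis j 1"] s[of "axis j \<i>"] field_simps)
  show "partial_z j (partial_zbar k f) z = partial_zbar k (partial_z j f) z"
    unfolding partial_z_def[of j "partial_zbar k f"] partial_zbar_def[of k "partial_z j f"] dder_partial[OF d]
    by (simp add: s[of "axis j 1"] s[of "axis j \<i>"] field_simps)
qed

section \<open>The Levi form of a squared norm\<close>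

lemma sum_cycle3: "(\<Sum>i\<in>A. \<Sum>j\<in>B. \<Sum>k\<in>C. f i j k) = (\<Sum>j\<in>B. \<Sum>k\<in>C. \<Sum>i\<in>A. f i j k)"
  by (subst sum.swap) (intro sum.cong refl sum.swap)

lemma sum_reverse3: "(\<Sum>i\<in>A. \<Sum>j\<in>B. \<Sum>k\<in>C. f i j k) = (\<Sum>k\<in>C. \<Sum>j\<in>B. \<Sum>i\<in>A. f i j k)"
  unfolding sum_cycle3[of _ A] by (rule sum.swap)

lemma sum_swap_pairs: "(\<Sum>i\<in>A. \<Sum>j\<in>B. \<Sum>k\<in>C. \<Sum>l\<in>D. f i j k l) = (\<Sum>k\<in>C. \<Sum>l\<in>D. \<Sum>i\<in>A. \<Sum>j\<in>B. f i j k l)"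
proof -
  have "(\<Sum>i\<in>A. \<Sum>j\<in>B. \<Sum>k\<in>C. \<Sum>l\<in>D. f i j k l) = (\<Sum>i\<in>A. \<Sum>k\<in>C. \<Sum>l\<in>D. \<Sum>j\<in>B. f i j k l)"
    by (intro sum.cong refl sum_cycle3)
  also have "\<dots> = (\<Sum>k\<in>C. \<Sum>l\<in>D. \<Sum>i\<in>A. \<Sum>j\<in>B. f i j k l)" by (rule sum_cycle3)
  finally show ?thesis .
qed

lemma has_field_derivative_imp_vector_line:
  assumes "(f has_field_derivative f') (at (of_real t * c))"
  shows "((\<lambda>t. f (of_real t * c)) has_vector_derivative c * f') (at t)"
proof -
  have "((\<lambda>t. of_real t * c) has_vector_derivative c) (at t)"
    by (auto intro!: derivative_eq_intros)
  from field_vector_diff_chain_at[OF this assms] show ?thesis by (simp add: o_def)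
qed

text \<open>The factor c^2 is what matters: for c = 1 and c = i the second derivatives are
  opposite.\<close>

lemma der2_holomorphic:
  assumes "\<sigma> holomorphic_on ball 0 r" "r > 0"
  shows "der2 (\<lambda>t. \<sigma> (of_real t * c)) (c * deriv \<sigma> 0) (c\<^sup>2 * deriv (deriv \<sigma>) 0)"
proof -
  have ev: "\<forall>\<^sub>F t::real in nhds 0. of_real t * c \<in> ball 0 r"
  proof -
    have "filterlim (\<lambda>t::real. of_real t * c) (nhds (of_real 0 * c)) (nhds 0)"
      by (intro tendsto_intros filterlim_ident)
    moreover have "\<forall>\<^sub>F y in nhds (of_real 0 * c). y \<in> ball 0 r"
      using assms(2) by (intro eventually_nhds_in_open) auto
    ultimately show ?thesis unfolding filterlim_iff by blast
  qed
  have 1: "\<forall>\<^sub>F t in nhds 0. ((\<lambda>t. \<sigma> (of_real t * c)) has_vector_derivative c * deriv \<sigma> (of_real t * c)) (at t)"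
    using ev
  proof eventually_elim
    case (elim t)
    show ?case
      by (rule has_field_derivative_imp_vector_line) (rule holomorphic_derivI[OF assms(1) open_ball elim])
  qed
  have "(deriv \<sigma> has_field_derivative deriv (deriv \<sigma>) 0) (at (of_real 0 * c))"
    using holomorphic_derivI[OF holomorphic_deriv[OF assms(1) open_ball] open_ball, of 0] assms(2) by simp
  from has_vector_derivative_mult_right[OF has_field_derivative_imp_vector_line[OF this], of c]
  have 2: "((\<lambda>t. c * deriv \<sigma> (of_real t * c)) has_vector_derivative c\<^sup>2 * deriv (deriv \<sigma>) 0) (at 0)"
    by (simp add: power2_eq_square mult.assoc)
  show ?thesis unfolding der2_def using 1 2 by (intro exI[of _ "\<lambda>t. c * deriv \<sigma> (of_real t * c)"]) simp
qed

lemma holo_on_dder: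
  assumes "holo_on W s" "z \<in> W"
  shows "s differentiable at z" "dder (a *s v) s z = a * dder v s z"
    "partial_zbar j s z = 0" "dder v s z = (\<Sum>j\<in>UNIV. partial_z j s z * v $ j)"
proof -
  obtain f' where f': "(s has_derivative f') (at z)" "\<And>a v. f' (a *s v) = a * f' v"
    using assms unfolding holo_on_def by blast
  show d: "s differentiable at z" using f'(1) unfolding differentiable_def by blast
  show "dder (a *s v) s z = a * dder v s z" for a v using dder_eq[OF f'(1)] f'(2) by simp
  moreover have "axis j \<i> = \<i> *s axis j 1" for j :: 'a by (simp add: vec_eq_iff axis_def)
  ultimately have "dder (axis j \<i>) s z = \<i> * dder (axis j 1) s z" for j by simp
  then show z: "partial_zbar j s z = 0" for j by (simp add: partial_zbar_def flip: mult.assoc)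
  show "dder v s z = (\<Sum>j\<in>UNIV. partial_z j s z * v $ j)"
    using dder_wirtinger[OF d, of v] by (simp add: z)
qed

lemma scaleR_eq_smult: "t *\<^sub>R v = complex_of_real t *s (v :: complex^'n)"
  by (simp only: vec_eq_iff vector_scaleR_component vector_smult_component scaleR_conv_of_real[where 'a = complex]) simp

text \<open>The definition of \<open>holo_on\<close> provides only a first derivative. Restriction
  to the complex line in direction v gives a holomorphic function of one variable, which is
  differentiable again; along v and iv the second derivatives cancel.\<close>

lemma der2_holo_on:
  fixes s :: "complex^'n::finite \<Rightarrow> complex"
  assumes "open W" "holo_on W s" "z \<in> W"
  shows "\<exists>S. der2 (\<lambda>t. s (z + t *\<^sub>R v)) (dder v s z) S \<and>
     der2 (\<lambda>t. s (z + t *\<^sub>R (\<i> *s v))) (\<i> * dder v s z) (- S)"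
proof -
  define \<sigma> where "\<sigma> = (\<lambda>\<zeta>. s (z + \<zeta> *s v))"
  obtain e where e: "e > 0" "ball z e \<subseteq> W" using assms(1,3) open_contains_ball by blast
  define r where "r = e / (norm v + 1)"
  have n: "norm v + 1 > 0" by (simp add: add_nonneg_pos)
  have r: "r > 0" using e n by (simp add: r_def)
  have nsm: "norm (\<zeta> *s v) = cmod \<zeta> * norm v" for \<zeta>
    by (simp add: norm_vec_def L2_set_def norm_mult power_mult_distrib sum_distrib_left[symmetric] real_sqrt_mult)
  have inW: "z + \<zeta> *s v \<in> W" if "\<zeta> \<in> ball 0 r" for \<zeta>
  proof -
    have "cmod \<zeta> * norm v \<le> cmod \<zeta> * (norm v + 1)" by (simp add: mult_left_mono)
    also have "\<dots> < e" using that n by (simp add: r_def pos_less_divide_eq)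
    finally have "z + \<zeta> *s v \<in> ball z e" using nsm[of \<zeta>] by (simp add: dist_norm)
    then show ?thesis using e by blast
  qed
  have d: "(\<sigma> has_field_derivative dder v s (z + \<zeta> *s v)) (at \<zeta>)" if "\<zeta> \<in> ball 0 r" for \<zeta>
  proof -
    have bl: "bounded_linear (\<lambda>\<zeta>. \<zeta> *s v)"
      by (rule bounded_linear_intro[where K = "norm v"])
        (auto simp: nsm vec_eq_iff algebra_simps scaleR_conv_of_real[where 'a = complex] vector_scaleR_component
          simp del: scaleR_complex.simps)
    have "((\<lambda>\<zeta>. z + \<zeta> *s v) has_derivative (\<lambda>h. h *s v)) (at \<zeta>)"
      using has_derivative_add[OF has_derivative_const bounded_linear_imp_has_derivative[OF bl]] by simp
    from has_derivative_compose[OF this has_derivative_dder[OF holo_on_dder(1)[OF assms(2) inW[OF that]]]]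
    have "((\<lambda>\<zeta>. s (z + \<zeta> *s v)) has_derivative (\<lambda>h. dder (h *s v) s (z + \<zeta> *s v))) (at \<zeta>)" .
    moreover have "(\<lambda>h. dder (h *s v) s (z + \<zeta> *s v)) = (*) (dder v s (z + \<zeta> *s v))"
      using holo_on_dder(2)[OF assms(2) inW[OF that]] by (intro ext) (simp only: mult.commute)
    ultimately show ?thesis unfolding has_field_derivative_def \<sigma>_def by simp
  qed
  have hol: "\<sigma> holomorphic_on ball 0 r"
    using d field_differentiable_at_within unfolding holomorphic_on_def field_differentiable_def by blast
  have D: "deriv \<sigma> 0 = dder v s z" using DERIV_imp_deriv[OF d[of 0]] r by simp
  have "(\<lambda>t. \<sigma> (of_real t * 1)) = (\<lambda>t. s (z + t *\<^sub>R v))" "(\<lambda>t. \<sigma> (of_real t * \<i>)) = (\<lambda>t. s (z + t *\<^sub>R (\<i> *s v)))"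
    by (simp_all add: \<sigma>_def scaleR_eq_smult vector_smult_assoc)
  then show ?thesis
    using der2_holomorphic[OF hol r, of 1] der2_holomorphic[OF hol r, of \<i>] D by auto
qed

lemma der2_Ck:
  assumes "open W" "Ck_on 2 W f" "z \<in> W"
  shows "der2 (\<lambda>t. f (z + t *\<^sub>R v)) (dder v f z) (dder v (dder v f) z)"
proof -
  have d1: "f differentiable at y" and d2: "dder v f differentiable at y" if "y \<in> W" for y
    using assms(2) that by (simp_all add: numeral_2_eq_2)
  have "\<forall>\<^sub>F y in nhds z. y \<in> W" using assms by (intro eventually_nhds_in_open)
  from eventually_line[OF this] have "\<forall>\<^sub>F t in nhds 0.
      ((\<lambda>t. f (z + t *\<^sub>R v)) has_vector_derivative dder v f (z + t *\<^sub>R v)) (at t)"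
    by eventually_elim (intro dder_line d1)
  moreover have "((\<lambda>t. dder v f (z + t *\<^sub>R v)) has_vector_derivative dder v (dder v f) z) (at 0)"
    using dder_line[of "dder v f" z 0 v] d2[OF assms(3)] by simp
  ultimately show ?thesis unfolding der2_def by (intro exI[of _ "\<lambda>t. dder v f (z + t *\<^sub>R v)"]) simp
qed

lemma qform_add: "qform (\<lambda>l p. S l p + T l p) v = qform S v + qform T v"
  by (simp add: qform_def ring_distribs sum.distrib)

lemma qform_sum: "qform (\<lambda>l p. \<Sum>i\<in>I. T i l p) v = (\<Sum>i\<in>I. qform (T i) v)"
  by (induction I rule: infinite_finite_induct) (simp_all add: qform_add, simp_all add: qform_def)

lemma qform_rank_one: "qform (\<lambda>l p. c * (x l * cnj (y p))) v =
    c * ((\<Sum>l\<in>UNIV. x l * v $ l) * cnj (\<Sum>p\<in>UNIV. y p * v $ p))"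
  unfolding qform_def cnj_sum sum_product unfolding sum_distrib_left by (intro sum.cong refl) simp

text \<open>Replacing v by iv changes the sign of the terms of type (2,0) and (0,2) and preserves
  those of mixed type. The latter occur twice in each of the two directions by commutation of the
  derivatives.\<close>

lemma Ck_laplacian_line:
  assumes "open W" "Ck_on 2 W f" "z \<in> W"
  shows "dder v (dder v f) z + dder (\<i> *s v) (dder (\<i> *s v) f) z =
    4 * qform (\<lambda>l p. partial_zbar p (partial_z l f) z) v"
proof -
  have d1: "f differentiable at y" and d2: "dder u f differentiable at y" if "y \<in> W" for y u
    using assms(2) that by (simp_all add: numeral_2_eq_2)
  have pd: "partial_z j f differentiable at z" "partial_zbar j f differentiable at z" for j
    using partial_differentiable[OF d2[OF assms(3)]] by blast+
  have dd: "dder w (dder u f) z = (\<Sum>j\<in>UNIV. dder w (partial_z j f) z * u $ j + dder w (partial_zbar j f) z * cnj (u $ j))" for u w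
  proof -
    have "dder w (dder u f) z = dder w (\<lambda>y. \<Sum>j\<in>UNIV. u $ j * partial_z j f y + cnj (u $ j) * partial_zbar j f y) z"
      by (rule dder_cong[OF assms(1,3)]) (simp add: dder_wirtinger[OF d1] mult.commute)
    also have "\<dots> = (\<Sum>j\<in>UNIV. dder w (partial_z j f) z * u $ j + dder w (partial_zbar j f) z * cnj (u $ j))"
      by (subst dder_sum) (auto simp: dder_add dder_cmult pd mult.commute)
    finally show ?thesis .
  qed
  define a where "a = (\<lambda>j k. partial_z k (partial_z j f) z)"
  define b where "b = (\<lambda>j k. partial_zbar k (partial_z j f) z)"
  define c where "c = (\<lambda>j k. partial_zbar k (partial_zbar j f) z)"
  have ba: "partial_z k (partial_zbar j f) z = b k j" for j k
    unfolding b_def by (rule partial_commute(2)[OF assms(1,3,2)])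
  have abc: "partial_z k (partial_z j f) z = a j k" "partial_zbar k (partial_z j f) z = b j k"
    "partial_zbar k (partial_zbar j f) z = c j k" for j k by (simp_all add: a_def b_def c_def)
  have q2: "qform b u = (\<Sum>j\<in>UNIV. \<Sum>k\<in>UNIV. b j k * cnj (u $ k) * u $ j)" for u
    by (simp add: qform_def ac_simps)
  have E: "dder u (dder u f) z = (\<Sum>j\<in>UNIV. \<Sum>k\<in>UNIV. a j k * u $ k * u $ j) + qform b u + (\<Sum>j\<in>UNIV. \<Sum>k\<in>UNIV. b k j * u $ k * cnj (u $ j))
     + (\<Sum>j\<in>UNIV. \<Sum>k\<in>UNIV. c j k * cnj (u $ k) * cnj (u $ j))" for u
    unfolding dd dder_wirtinger[OF pd(1)] dder_wirtinger[OF pd(2)] ba abc q2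
    by (simp add: sum.distrib sum_distrib_right distrib_right)
  have E': "dder u (dder u f) z = (\<Sum>j\<in>UNIV. \<Sum>k\<in>UNIV. a j k * u $ k * u $ j) + 2 * qform b u
     + (\<Sum>j\<in>UNIV. \<Sum>k\<in>UNIV. c j k * cnj (u $ k) * cnj (u $ j))" for u
  proof -
    have "(\<Sum>j\<in>UNIV. \<Sum>k\<in>UNIV. b k j * u $ k * cnj (u $ j)) = qform b u"
      unfolding qform_def by (rule sum.swap)
    then show ?thesis unfolding E by simp
  qed
  have ii: "x * (\<i> * y) * (\<i> * w) = - (x * y * w)" "x * (- \<i> * y) * (- \<i> * w) = - (x * y * w)" "x * (\<i> * y) * (- \<i> * w) = x * y * w"
    for x y w :: complex by (simp_all add: complex_eq_iff algebra_simps)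
  have q: "qform b (\<i> *s v) = qform b v"
    unfolding qform_def vector_smult_component complex_cnj_mult complex_cnj_i ii ..
  show ?thesis
    unfolding E' q vector_smult_component complex_cnj_mult complex_cnj_i ii sum_negf b_def[symmetric] by simp
qed

text \<open>The coefficients of \<open>\<partial>\<close>-\<open>\<partial>\<close>-bar of \<open>h s t\<close> (\<open>t\<close> conjugated) for holomorphic \<open>s\<close> and \<open>t\<close>.\<close>

definition levi_density where
  "levi_density h s t z l p = partial_zbar p (partial_z l h) z * (s z * cnj (t z)) +
     partial_z l h z * (s z * cnj (partial_z p t z)) +
     partial_zbar p h z * (partial_z l s z * cnj (t z)) +
     h z * (partial_z l s z * cnj (partial_z p t z))"

definition levi_form :: "('r::finite \<Rightarrow> 'r \<Rightarrow> complex^'n::finite \<Rightarrow> complex) \<Rightarrow> ('r \<Rightarrow> complex^'n \<Rightarrow> complex) \<Rightarrow>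
    complex^'n \<Rightarrow> 'n \<Rightarrow> 'n \<Rightarrow> complex" where
  "levi_form H \<sigma> z l p = (\<Sum>i\<in>UNIV. \<Sum>j\<in>UNIV. levi_density (H i j) (\<sigma> i) (\<sigma> j) z l p)"

lemma der2_cnj: "der2 f a b \<Longrightarrow> der2 (\<lambda>t. cnj (f t)) (cnj a) (cnj b)"
  by (rule der2_bounded_linear[OF bounded_linear_cnj])

text \<open>The product rule along v plus the product rule along iv. P and Q are the holomorphic and
  antiholomorphic first derivatives of h, X and Y those of s and of the conjugate of the second
  section. S and T cancel, and D is replaced by 4q - D in the second direction.\<close>

lemma levi_algebra:
  fixes h s t X Y P Q S T D q :: complex
  shows "h * (s * T + 2 * X * Y + S * t) + 2 * (P + Q) * (s * Y + X * t) + D * (s * t) +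
    (h * (s * (- T) + 2 * (\<i> * X) * (- \<i> * Y) + (- S) * t) +
      2 * (\<i> * P - \<i> * Q) * (s * (- \<i> * Y) + \<i> * X * t) + (4 * q - D) * (s * t)) =
    4 * (q * (s * t) + P * (s * Y) + Q * (X * t) + h * (X * Y))"
proof -
  have "\<i> * \<i> = -1" by simp
  then show ?thesis by algebra
qed
lemma levi_term:
  fixes h s t :: "complex^'n::finite \<Rightarrow> complex"
  assumes W: "open W" "z \<in> W" and h: "Ck_on 2 W h" and s: "holo_on W s" and t: "holo_on W t"
  shows "\<exists>a b c d. der2 (\<lambda>r. h (z + r *\<^sub>R v) * (s (z + r *\<^sub>R v) * cnj (t (z + r *\<^sub>R v)))) a b \<and>
     der2 (\<lambda>r. h (z + r *\<^sub>R (\<i> *s v)) * (s (z + r *\<^sub>R (\<i> *s v)) * cnj (t (z + r *\<^sub>R (\<i> *s v))))) c d \<and>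
     b + d = 4 * qform (levi_density h s t z) v"
proof -
  obtain S where S: "der2 (\<lambda>r. s (z + r *\<^sub>R v)) (dder v s z) S" "der2 (\<lambda>r. s (z + r *\<^sub>R (\<i> *s v))) (\<i> * dder v s z) (- S)"
    using der2_holo_on[OF W(1) s W(2)] by blast
  obtain T where T: "der2 (\<lambda>r. t (z + r *\<^sub>R v)) (dder v t z) T" "der2 (\<lambda>r. t (z + r *\<^sub>R (\<i> *s v))) (\<i> * dder v t z) (- T)"
    using der2_holo_on[OF W(1) t W(2)] by blast
  note H = der2_Ck[OF W(1) h W(2)]
  have hd: "h differentiable at z" using h W(2) by (simp add: numeral_2_eq_2)
  define P where "P = (\<Sum>l\<in>UNIV. partial_z l h z * v $ l)"
  define Q where "Q = (\<Sum>l\<in>UNIV. partial_zbar l h z * cnj (v $ l))"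
  define X where "X = dder v s z"
  define Y where "Y = cnj (dder v t z)"
  have hv: "dder v h z = P + Q" by (simp add: dder_wirtinger[OF hd] P_def Q_def sum.distrib)
  have hiv: "dder (\<i> *s v) h z = \<i> * P - \<i> * Q"
    by (simp add: dder_wirtinger[OF hd] P_def Q_def sum_subtractf sum_distrib_left ac_simps)
  have X: "X = (\<Sum>l\<in>UNIV. partial_z l s z * v $ l)" unfolding X_def by (rule holo_on_dder(4)[OF s W(2)])
  have Y: "Y = cnj (\<Sum>l\<in>UNIV. partial_z l t z * v $ l)" unfolding Y_def holo_on_dder(4)[OF t W(2)] ..
  have q: "qform (levi_density h s t z) v =
     qform (\<lambda>l p. partial_zbar p (partial_z l h) z) v * (s z * cnj (t z)) + P * (s z * Y) + Q * (X * cnj (t z)) + h z * (X * Y)"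
  proof -
    have 1: "qform (\<lambda>l p. partial_zbar p (partial_z l h) z * (s z * cnj (t z))) v = qform (\<lambda>l p. partial_zbar p (partial_z l h) z) v * (s z * cnj (t z))"
      by (simp add: qform_def sum_distrib_left sum_distrib_right ac_simps)
    have 2: "qform (\<lambda>l p. partial_z l h z * (s z * cnj (partial_z p t z))) v = P * (s z * Y)"
      using qform_rank_one[of "s z" "\<lambda>l. partial_z l h z" "\<lambda>p. partial_z p t z" v] by (simp add: P_def Y ac_simps)
    have 3: "qform (\<lambda>l p. partial_zbar p h z * (partial_z l s z * cnj (t z))) v = Q * (X * cnj (t z))"
      using qform_rank_one[of "cnj (t z)" "\<lambda>l. partial_z l s z" "\<lambda>p. cnj (partial_zbar p h z)" v] by (simp add: Q_def X ac_simps)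
    have 4: "qform (\<lambda>l p. h z * (partial_z l s z * cnj (partial_z p t z))) v = h z * (X * Y)"
      unfolding qform_rank_one X Y ..
    show ?thesis unfolding levi_density_def[abs_def] qform_add 1 2 3 4 ..
  qed
  note L = Ck_laplacian_line[OF W(1) h W(2), of v]
  let ?v = "\<i> *s v"
  have z0: "z + 0 *\<^sub>R w = z" for w by simp
  have L': "dder ?v (dder ?v h) z = 4 * qform (\<lambda>l p. partial_zbar p (partial_z l h) z) v - dder v (dder v h) z"
    using L by (simp add: algebra_simps)
  show ?thesis
  proof (intro exI conjI, rule der2_mult[OF H der2_mult[OF S(1) der2_cnj[OF T(1)]]],
      rule der2_mult[OF H der2_mult[OF S(2) der2_cnj[OF T(2)]]], goal_cases)
    case 1
    show ?case
      unfolding q L' hv hiv Y_def[symmetric] X_def[symmetric] complex_cnj_mult complex_cnj_minus complex_cnj_i z0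
      by (rule levi_algebra)
  qed
qed

text \<open>The zero function has both a maximum and a minimum at 0, so the second-derivative test
  applies to it and to its negative.\<close>

lemma der2_zero:
  fixes a b :: real
  assumes "der2 (\<lambda>t. 0 :: real) a b" shows "b = 0"
  using der2_local_max[OF assms] der2_local_max[OF der2_bounded_linear[OF bounded_linear_minus[OF bounded_linear_ident] assms]]
  by simp

text \<open>The Hermitian sum is real near z, so the imaginary parts of its second derivatives
  vanish and the complex identity of \<open>levi_term\<close> passes to the real part.\<close>

lemma has_levi_section:
  assumes W: "open W" "z \<in> W" and H: "\<And>i j. Ck_on 2 W (H i j)" and \<sigma>: "\<And>i. holo_on W (\<sigma> i)"
    and herm: "\<And>z i j. z \<in> W \<Longrightarrow> H j i z = cnj (H i j z)"
  shows "has_levi (\<lambda>z. Re (\<Sum>i\<in>UNIV. \<Sum>j\<in>UNIV. H i j z * (\<sigma> i z * cnj (\<sigma> j z)))) z (levi_form H \<sigma> z)"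
  unfolding has_levi_def
proof
  fix v
  let ?T = "\<lambda>i j z. H i j z * (\<sigma> i z * cnj (\<sigma> j z))"
  have im: "Im (\<Sum>i\<in>UNIV. \<Sum>j\<in>UNIV. ?T i j z) = 0" if "z \<in> W" for z
  proof -
    have "cnj (\<Sum>i\<in>UNIV. \<Sum>j\<in>UNIV. ?T i j z) = (\<Sum>i\<in>UNIV. \<Sum>j\<in>UNIV. ?T j i z)"
      unfolding cnj_sum by (intro sum.cong refl) (simp add: herm[OF that, symmetric] ac_simps)
    also have "\<dots> = (\<Sum>i\<in>UNIV. \<Sum>j\<in>UNIV. ?T i j z)" by (rule sum.swap)
    finally have "cnj (\<Sum>i\<in>UNIV. \<Sum>j\<in>UNIV. ?T i j z) = (\<Sum>i\<in>UNIV. \<Sum>j\<in>UNIV. ?T i j z)" .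
    moreover have "Im x = 0" if "cnj x = x" for x using that by (simp add: complex_eq_iff)
    ultimately show ?thesis by blast
  qed
  define P where "P = (\<lambda>i j a b c d. der2 (\<lambda>r. ?T i j (z + r *\<^sub>R v)) a b \<and>
     der2 (\<lambda>r. ?T i j (z + r *\<^sub>R (\<i> *s v))) c d \<and> b + d = 4 * qform (levi_density (H i j) (\<sigma> i) (\<sigma> j) z) v)"
  have "\<exists>a b c d. P i j a b c d" for i j
    unfolding P_def by (rule levi_term[OF W H \<sigma> \<sigma>])
  then obtain a b c d where "\<And>i j. P i j (a i j) (b i j) (c i j) (d i j)" by metis
  then have 1: "\<And>i j. der2 (\<lambda>r. ?T i j (z + r *\<^sub>R v)) (a i j) (b i j)"
    and 2: "\<And>i j. der2 (\<lambda>r. ?T i j (z + r *\<^sub>R (\<i> *s v))) (c i j) (d i j)"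
    and 3: "\<And>i j. b i j + d i j = 4 * qform (levi_density (H i j) (\<sigma> i) (\<sigma> j) z) v"
    unfolding P_def by blast+
  let ?b = "\<Sum>i\<in>UNIV. \<Sum>j\<in>UNIV. b i j" and ?d = "\<Sum>i\<in>UNIV. \<Sum>j\<in>UNIV. d i j"
  have B: "der2 (\<lambda>r. \<Sum>i\<in>UNIV. \<Sum>j\<in>UNIV. ?T i j (z + r *\<^sub>R v)) (\<Sum>i\<in>UNIV. \<Sum>j\<in>UNIV. a i j) ?b"
    by (intro der2_sum 1)
  have D: "der2 (\<lambda>r. \<Sum>i\<in>UNIV. \<Sum>j\<in>UNIV. ?T i j (z + r *\<^sub>R (\<i> *s v))) (\<Sum>i\<in>UNIV. \<Sum>j\<in>UNIV. c i j) ?d"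
    by (intro der2_sum 2)
  have nearW: "\<forall>\<^sub>F y in nhds z. Im (\<Sum>i\<in>UNIV. \<Sum>j\<in>UNIV. ?T i j y) = 0"
    by (rule eventually_mono[OF eventually_nhds_in_open[OF W]]) (rule im)
  have i0: "Im ?b = 0" "Im ?d = 0"
    using der2_zero[OF der2_cong[OF eventually_line[OF nearW] der2_bounded_linear[OF bounded_linear_Im B]]]
      der2_zero[OF der2_cong[OF eventually_line[OF nearW] der2_bounded_linear[OF bounded_linear_Im D]]] by blast+
  have "?b + ?d = 4 * qform (levi_form H \<sigma> z) v"
    unfolding levi_form_def[abs_def] qform_sum sum.distrib[symmetric] 3 sum_distrib_left ..
  then have "of_real (Re ?b + Re ?d) = 4 * qform (levi_form H \<sigma> z) v"
    using i0 by (simp add: complex_eq_iff)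
  then show "\<exists>a b c d. der2 (\<lambda>t. Re (\<Sum>i\<in>UNIV. \<Sum>j\<in>UNIV. ?T i j (z + t *\<^sub>R v))) a b \<and>
     der2 (\<lambda>t. Re (\<Sum>i\<in>UNIV. \<Sum>j\<in>UNIV. ?T i j (z + t *\<^sub>R (\<i> *s v)))) c d \<and>
     of_real (b + d) = 4 * qform (levi_form H \<sigma> z) v"
    using der2_bounded_linear[OF bounded_linear_Re B] der2_bounded_linear[OF bounded_linear_Re D] by blast
qed

section \<open>The Chern connection in a local frame\<close>

lemma differentiable_prod:
  fixes f :: "'i \<Rightarrow> 'a::real_normed_vector \<Rightarrow> complex"
  assumes "\<And>i. i \<in> I \<Longrightarrow> f i differentiable at z"
  shows "(\<lambda>z. \<Prod>i\<in>I. f i z) differentiable at z"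
  using assms by (induction I rule: infinite_finite_induct) (auto intro: differentiable_mult)

lemma differentiable_det:
  fixes M :: "'a::real_normed_vector \<Rightarrow> 'r::finite \<Rightarrow> 'r \<Rightarrow> complex"
  assumes "\<And>i j. (\<lambda>z. M z i j) differentiable at z"
  shows "(\<lambda>z. det (\<chi> i j. M z i j)) differentiable at z"
proof -
  have "(\<lambda>z. of_int (sign p) * (\<Prod>i\<in>UNIV. M z i (p i))) differentiable at z" for p
    by (rule differentiable_mult[OF differentiable_const differentiable_prod]) (rule assms)
  then show ?thesis unfolding det_def by simp
qed

text \<open>The Gram matrix of a holomorphic frame in a chart. Two derivatives are asked for: the
  connection uses one and its curvature a second.\<close>

locale smooth_gram =
  fixes W :: "(complex^'n::finite) set" and H :: "'r::finite \<Rightarrow> 'r \<Rightarrow> complex^'n \<Rightarrow> complex"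
  assumes open_W: "open W"
    and smooth: "\<And>i j. Ck_on 2 W (H i j)"
    and herm: "\<And>z i j. z \<in> W \<Longrightarrow> H j i z = cnj (H i j z)"
    and posdef: "\<And>z u. z \<in> W \<Longrightarrow> u \<noteq> 0 \<Longrightarrow>
      Re (\<Sum>i\<in>UNIV. \<Sum>j\<in>UNIV. H i j z * u $ i * cnj (u $ j)) > 0"
begin

lemma H_diff: "z \<in> W \<Longrightarrow> H i j differentiable at z"
  using smooth by (simp add: numeral_2_eq_2)

lemma dH_diff: "z \<in> W \<Longrightarrow> dder v (H i j) differentiable at z"
  using smooth by (simp add: numeral_2_eq_2)

lemma partial_H_diff: "z \<in> W \<Longrightarrow> partial_z l (H i j) differentiable at z"
  using partial_differentiable(1) dH_diff by blast

lemma nonsingular: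
  assumes "z \<in> W" "\<And>j. (\<Sum>k\<in>UNIV. x k * H k j z) = 0"
  shows "x k = 0"
proof (rule ccontr)
  assume "x k \<noteq> 0"
  then have "(\<chi> k. x k) \<noteq> 0" by (auto simp: vec_eq_iff)
  from posdef[OF assms(1) this] have "Re (\<Sum>i\<in>UNIV. \<Sum>j\<in>UNIV. H i j z * x i * cnj (x j)) > 0" by simp
  also have "(\<Sum>i\<in>UNIV. \<Sum>j\<in>UNIV. H i j z * x i * cnj (x j)) = (\<Sum>j\<in>UNIV. (\<Sum>i\<in>UNIV. x i * H i j z) * cnj (x j))"
    by (subst sum.swap) (simp add: sum_distrib_left sum_distrib_right ac_simps)
  finally show False by (simp add: assms(2))
qed

text \<open>Identities between connection coefficients are proved after multiplication by the Gram
  matrix, where they become identities between derivatives of \<open>H\<close>.\<close>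

lemma cancel:
  assumes "z \<in> W" "\<And>j. (\<Sum>k\<in>UNIV. x k * H k j z) = (\<Sum>k\<in>UNIV. y k * H k j z)"
  shows "x k = y k"
  using nonsingular[OF assms(1), of "\<lambda>k. x k - y k" k] assms(2)
  by (simp add: left_diff_distrib sum_subtractf)

definition mat_H :: "complex^'n \<Rightarrow> complex^'r^'r" where
  "mat_H z = (\<chi> j k. H k j z)"

text \<open>The coefficients of the Chern connection, the solution of the linear system in
  \<open>conn_eq\<close> by Cramer's rule. As quotients of determinants they are visibly
  differentiable; \<open>mat_H\<close> is transposed so that the system has matrix-vector
  form.\<close>

definition conn :: "'r \<Rightarrow> 'r \<Rightarrow> 'n \<Rightarrow> complex^'n \<Rightarrow> complex" where
  "conn k i l z = det (\<chi> a b. if b = k then partial_z l (H i a) z else H b a z) / det (mat_H z)"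

lemma det_mat_H: "z \<in> W \<Longrightarrow> det (mat_H z) \<noteq> 0"
proof -
  assume z: "z \<in> W"
  have "x = 0" if "mat_H z *v x = 0" for x
  proof -
    have "(\<Sum>k\<in>UNIV. x $ k * H k j z) = 0" for j
      using arg_cong[OF that, of "\<lambda>v. v $ j"] by (simp add: matrix_vector_mult_def mat_H_def mult.commute)
    from nonsingular[OF z this] show ?thesis by (simp add: vec_eq_iff)
  qed
  then have "invertible (mat_H z)"
    using matrix_left_invertible_ker[of "mat_H z"] invertible_left_inverse by blast
  then show ?thesis by (simp add: invertible_det_nz)
qed

lemma conn_eq:
  assumes "z \<in> W"
  shows "(\<Sum>k\<in>UNIV. conn k i l z * H k j z) = partial_z l (H i j) z"
proof -
  let ?b = "\<chi> a. partial_z l (H i a) z"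
  have "mat_H z *v (\<chi> k. conn k i l z) = ?b"
    unfolding cramer[OF det_mat_H[OF assms]] conn_def
    by (simp add: mat_H_def vec_eq_iff cong: if_cong)
  from arg_cong[OF this, of "\<lambda>v. v $ j"] show ?thesis
    by (simp add: matrix_vector_mult_def mat_H_def mult.commute)
qed

lemma conn_diff: "z \<in> W \<Longrightarrow> conn k i l differentiable at z"
proof -
  assume z: "z \<in> W"
  have 1: "(\<lambda>z. det (mat_H z)) differentiable at z"
    unfolding mat_H_def by (rule differentiable_det) (rule H_diff[OF z])
  have 2: "(\<lambda>z. det (\<chi> a b. if b = k then partial_z l (H i a) z else H b a z)) differentiable at z"
  proof (rule differentiable_det)
    fix a b show "(\<lambda>z. if b = k then partial_z l (H i a) z else H b a z) differentiable at z"
      by (cases "b = k") (simp_all only: simp_thms if_True if_False H_diff[OF z] partial_H_diff[OF z])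
  qed
  show ?thesis unfolding conn_def[abs_def]
    by (rule differentiable_divide[OF 2 1 det_mat_H[OF z]])
qed

lemma partial_zbar_H: "z \<in> W \<Longrightarrow> partial_zbar p (H k j) z = cnj (partial_z p (H j k) z)"
proof -
  assume z: "z \<in> W"
  have "partial_zbar p (H k j) z = partial_zbar p (\<lambda>z. cnj (H j k z)) z"
    by (rule partial_cong(2)[OF open_W z]) (rule herm)
  then show ?thesis by (simp only: partial_cnj[OF H_diff[OF z]])
qed

text \<open>The symmetry in l and p expresses the vanishing of the (2,0)-part of dA + A wedge A.
  Multiplied by the Gram matrix, each side is a second holomorphic derivative of \<open>H\<close>,
  and these commute.\<close>

lemma conn_torsion:
  assumes z: "z \<in> W"
  shows "partial_z p (conn q i l) z + (\<Sum>k\<in>UNIV. conn q k p z * conn k i l z) =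
    partial_z l (conn q i p) z + (\<Sum>k\<in>UNIV. conn q k l z * conn k i p z)"
proof -
  have E: "(\<Sum>q\<in>UNIV. (partial_z p (conn q i l) z + (\<Sum>k\<in>UNIV. conn q k p z * conn k i l z)) * H q j z)
     = partial_z p (partial_z l (H i j)) z" for p l j
  proof -
    have "partial_z p (partial_z l (H i j)) z = partial_z p (\<lambda>z. \<Sum>k\<in>UNIV. conn k i l z * H k j z) z"
      by (rule partial_cong(1)[OF open_W z]) (simp add: conn_eq)
    also have "\<dots> = (\<Sum>k\<in>UNIV. conn k i l z * partial_z p (H k j) z + partial_z p (conn k i l) z * H k j z)"
      by (simp only: partial_sum(1)[OF differentiable_mult[OF conn_diff[OF z] H_diff[OF z]]]
          partial_mult(1)[OF conn_diff[OF z] H_diff[OF z]])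
    also have "\<dots> = (\<Sum>k\<in>UNIV. \<Sum>q\<in>UNIV. conn k i l z * (conn q k p z * H q j z)) + (\<Sum>q\<in>UNIV. partial_z p (conn q i l) z * H q j z)"
      by (simp add: sum.distrib conn_eq[OF z, symmetric] sum_distrib_left)
    also have "(\<Sum>k\<in>UNIV. \<Sum>q\<in>UNIV. conn k i l z * (conn q k p z * H q j z)) = (\<Sum>q\<in>UNIV. (\<Sum>k\<in>UNIV. conn q k p z * conn k i l z) * H q j z)"
      by (subst sum.swap) (simp add: sum_distrib_left sum_distrib_right ac_simps)
    finally show ?thesis by (simp add: distrib_right sum.distrib add.commute)
  qed
  let ?x = "\<lambda>p l q. partial_z p (conn q i l) z + (\<Sum>k\<in>UNIV. conn q k p z * conn k i l z)"
  show ?thesis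
  proof (rule cancel[OF z, of "?x p l" "?x l p"])
    fix j
    show "(\<Sum>q\<in>UNIV. (partial_z p (conn q i l) z + (\<Sum>k\<in>UNIV. conn q k p z * conn k i l z)) * H q j z) =
      (\<Sum>q\<in>UNIV. (partial_z l (conn q i p) z + (\<Sum>k\<in>UNIV. conn q k l z * conn k i p z)) * H q j z)"
      unfolding E by (rule partial_commute(1)[OF open_W z smooth])
  qed
qed

lemma conn_bar:
  assumes z: "z \<in> W"
  shows "(\<Sum>k\<in>UNIV. partial_zbar p (conn k i l) z * H k j z) =
    partial_zbar p (partial_z l (H i j)) z - (\<Sum>k\<in>UNIV. conn k i l z * partial_zbar p (H k j) z)"
proof -
  have "partial_zbar p (partial_z l (H i j)) z = partial_zbar p (\<lambda>z. \<Sum>k\<in>UNIV. conn k i l z * H k j z) z"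
    by (rule partial_cong(2)[OF open_W z]) (simp add: conn_eq)
  also have "\<dots> = (\<Sum>k\<in>UNIV. conn k i l z * partial_zbar p (H k j) z + partial_zbar p (conn k i l) z * H k j z)"
    by (simp only: partial_sum(2)[OF differentiable_mult[OF conn_diff[OF z] H_diff[OF z]]]
        partial_mult(2)[OF conn_diff[OF z] H_diff[OF z]])
  finally show ?thesis by (simp add: sum.distrib)
qed

text \<open>The matrix in the form indices l, p of -i times the curvature paired with u, where only
  the antiholomorphic derivative of the connection remains.\<close>

definition curv_form :: "complex^'n \<Rightarrow> ('r \<Rightarrow> complex) \<Rightarrow> 'n \<Rightarrow> 'n \<Rightarrow> complex" where
  "curv_form z u l p = (\<Sum>k\<in>UNIV. \<Sum>j\<in>UNIV.
     (\<Sum>i\<in>UNIV. partial_zbar p (conn i k l) z * H i j z) * u k * cnj (u j))"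

definition cov_deriv :: "('r \<Rightarrow> complex^'n \<Rightarrow> complex) \<Rightarrow> complex^'n \<Rightarrow> 'r \<Rightarrow> 'n \<Rightarrow> complex" where
  "cov_deriv \<sigma> z a l = partial_z l (\<sigma> a) z + (\<Sum>k\<in>UNIV. conn a k l z * \<sigma> k z)"

definition grad_form :: "('r \<Rightarrow> complex^'n \<Rightarrow> complex) \<Rightarrow> complex^'n \<Rightarrow> 'n \<Rightarrow> 'n \<Rightarrow> complex" where
  "grad_form \<sigma> z l p = (\<Sum>a\<in>UNIV. \<Sum>q\<in>UNIV. H a q z * (cov_deriv \<sigma> z a l * cnj (cov_deriv \<sigma> z q p)))"

end

text \<open>Completion of the square at a single pair of form indices: hh, hl and hb stand for the
  mixed, holomorphic and antiholomorphic derivatives of h, and a, b for the connection and its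
  conjugate. What is left over is the curvature term.\<close>

lemma complete_square_sum:
  fixes h hh hl hb a b :: "'r::finite \<Rightarrow> 'r \<Rightarrow> complex"
  assumes hl: "\<And>k j. hl k j = (\<Sum>i\<in>UNIV. a i k * h i j)"
    and hb: "\<And>i j. hb i j = (\<Sum>q\<in>UNIV. b q j * h i q)"
  shows "(\<Sum>k\<in>UNIV. \<Sum>j\<in>UNIV. hh k j * (s k * t j) + hl k j * (s k * y j) + hb k j * (x k * t j) + h k j * (x k * y j)) =
    (\<Sum>i\<in>UNIV. \<Sum>q\<in>UNIV. h i q * ((x i + (\<Sum>k\<in>UNIV. a i k * s k)) * (y q + (\<Sum>j\<in>UNIV. b q j * t j)))) +
    (\<Sum>k\<in>UNIV. \<Sum>j\<in>UNIV. (hh k j - (\<Sum>i\<in>UNIV. a i k * hb i j)) * s k * t j)"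
proof -
  have 2: "(\<Sum>i\<in>UNIV. \<Sum>q\<in>UNIV. h i q * ((\<Sum>k\<in>UNIV. a i k * s k) * w q)) = (\<Sum>k\<in>UNIV. \<Sum>q\<in>UNIV. hl k q * (s k * w q))" for w
  proof -
    have "(\<Sum>i\<in>UNIV. \<Sum>q\<in>UNIV. h i q * ((\<Sum>k\<in>UNIV. a i k * s k) * w q)) = (\<Sum>i\<in>UNIV. \<Sum>q\<in>UNIV. \<Sum>k\<in>UNIV. a i k * h i q * (s k * w q))"
      by (simp add: sum_distrib_left sum_distrib_right ac_simps)
    also have "\<dots> = (\<Sum>k\<in>UNIV. \<Sum>q\<in>UNIV. \<Sum>i\<in>UNIV. a i k * h i q * (s k * w q))" by (rule sum_reverse3)
    finally show ?thesis by (simp add: hl sum_distrib_right)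
  qed
  have 3: "(\<Sum>i\<in>UNIV. \<Sum>q\<in>UNIV. h i q * (w i * (\<Sum>j\<in>UNIV. b q j * t j))) = (\<Sum>i\<in>UNIV. \<Sum>j\<in>UNIV. hb i j * (w i * t j))" for w
  proof -
    have "(\<Sum>q\<in>UNIV. h i q * (w i * (\<Sum>j\<in>UNIV. b q j * t j))) = (\<Sum>j\<in>UNIV. hb i j * (w i * t j))" for i
    proof -
      have "(\<Sum>q\<in>UNIV. h i q * (w i * (\<Sum>j\<in>UNIV. b q j * t j))) = (\<Sum>q\<in>UNIV. \<Sum>j\<in>UNIV. b q j * h i q * (w i * t j))"
        by (simp add: sum_distrib_left ac_simps)
      also have "\<dots> = (\<Sum>j\<in>UNIV. \<Sum>q\<in>UNIV. b q j * h i q * (w i * t j))" by (rule sum.swap)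
      finally show ?thesis by (simp add: hb sum_distrib_right)
    qed
    then show ?thesis by simp
  qed
  have 4: "(\<Sum>i\<in>UNIV. \<Sum>j\<in>UNIV. hb i j * ((\<Sum>k\<in>UNIV. a i k * s k) * t j)) = (\<Sum>k\<in>UNIV. \<Sum>j\<in>UNIV. (\<Sum>i\<in>UNIV. a i k * hb i j) * s k * t j)"
  proof -
    have "(\<Sum>i\<in>UNIV. \<Sum>j\<in>UNIV. hb i j * ((\<Sum>k\<in>UNIV. a i k * s k) * t j)) = (\<Sum>i\<in>UNIV. \<Sum>j\<in>UNIV. \<Sum>k\<in>UNIV. a i k * hb i j * s k * t j)"
      by (simp add: sum_distrib_left sum_distrib_right ac_simps)
    also have "\<dots> = (\<Sum>k\<in>UNIV. \<Sum>j\<in>UNIV. \<Sum>i\<in>UNIV. a i k * hb i j * s k * t j)" by (rule sum_reverse3)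
    finally show ?thesis by (simp add: sum_distrib_right)
  qed
  \<comment> \<open>The product of the two connection terms is exactly what the curvature term
    subtracts, so both drop out.\<close>
  have 5: "(\<Sum>i\<in>UNIV. \<Sum>q\<in>UNIV. h i q * ((\<Sum>k\<in>UNIV. a i k * s k) * (\<Sum>j\<in>UNIV. b q j * t j))) =
      (\<Sum>k\<in>UNIV. \<Sum>j\<in>UNIV. (\<Sum>i\<in>UNIV. a i k * hb i j) * s k * t j)"
    unfolding 3 4 ..
  have "(\<Sum>i\<in>UNIV. \<Sum>q\<in>UNIV. h i q * ((x i + (\<Sum>k\<in>UNIV. a i k * s k)) * (y q + (\<Sum>j\<in>UNIV. b q j * t j)))) =
    (\<Sum>i\<in>UNIV. \<Sum>q\<in>UNIV. h i q * (x i * y q)) + (\<Sum>i\<in>UNIV. \<Sum>q\<in>UNIV. h i q * (x i * (\<Sum>j\<in>UNIV. b q j * t j)))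
    + (\<Sum>i\<in>UNIV. \<Sum>q\<in>UNIV. h i q * ((\<Sum>k\<in>UNIV. a i k * s k) * y q)) + (\<Sum>i\<in>UNIV. \<Sum>q\<in>UNIV. h i q * ((\<Sum>k\<in>UNIV. a i k * s k) * (\<Sum>j\<in>UNIV. b q j * t j)))"
    by (simp only: distrib_left distrib_right sum.distrib add.assoc) (simp only: ac_simps)
  then show ?thesis unfolding 5 unfolding 2 3
    by (simp add: sum.distrib left_diff_distrib sum_subtractf mult.assoc)
qed

context smooth_gram
begin

lemma bochner:
  assumes z: "z \<in> W"
  shows "levi_form H \<sigma> z l p = grad_form \<sigma> z l p + curv_form z (\<lambda>i. \<sigma> i z) l p"
proof -
  have "partial_zbar p (H i j) z = (\<Sum>q\<in>UNIV. cnj (conn q j p z) * H i q z)" for i j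
    by (simp add: partial_zbar_H[OF z] conn_eq[OF z, symmetric] flip: herm[OF z])
  then show ?thesis
    unfolding levi_form_def levi_density_def grad_form_def curv_form_def cov_deriv_def conn_bar[OF z]
      complex_cnj_add cnj_sum complex_cnj_mult
    by (intro complete_square_sum) (simp_all add: conn_eq[OF z])
qed

end

section \<open>Charts and trivializations\<close>

lemma Cinf_on_imp_Ck: "Cinf_on U f \<Longrightarrow> Ck_on k U f"
  by (simp add: Cinf_on_def)

lemma const_form_partial:
  "(\<lambda>ws. partial_z j (\<lambda>z. const_form (g z) ws) z) = const_form (partial_z j g z)"
  "(\<lambda>ws. partial_zbar j (\<lambda>z. const_form (g z) ws) z) = const_form (partial_zbar j g z)"
  by (rule ext, simp add: const_form_def partial_const)+

lemma del_local_const: "del_local (\<lambda>z. const_form (g z)) z vs = (\<Sum>j\<in>UNIV. partial_z j g z * dz j vs)"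
  by (simp add: del_local_def const_form_partial wedge_const_right)

lemma delbar_local_const: "delbar_local (\<lambda>z. const_form (g z)) z vs = (\<Sum>j\<in>UNIV. partial_zbar j g z * dzbar j vs)"
  by (simp add: delbar_local_def const_form_partial wedge_const_right)

lemma d_local_lin:
  assumes "open W" "z \<in> W" "\<And>y. y \<in> W \<Longrightarrow> \<alpha> y = lin_form (\<chi> l. a l y)" "\<And>l. a l differentiable at z"
  shows "del_local \<alpha> z vs = (\<Sum>p\<in>UNIV. \<Sum>l\<in>UNIV. partial_z p (a l) z * (dz p \<and>\<^sub>w dz l) vs)"
    "delbar_local \<alpha> z vs = (\<Sum>p\<in>UNIV. \<Sum>l\<in>UNIV. partial_zbar p (a l) z * (dzbar p \<and>\<^sub>w dz l) vs)"
proof -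
  have 1: "partial_z p (\<lambda>y. \<alpha> y ws) z = (\<Sum>l\<in>UNIV. partial_z p (a l) z * dz l ws)"
    "partial_zbar p (\<lambda>y. \<alpha> y ws) z = (\<Sum>l\<in>UNIV. partial_zbar p (a l) z * dz l ws)" for p ws
  proof -
    have e: "\<alpha> y ws = (\<Sum>l\<in>UNIV. a l y * dz l ws)" if "y \<in> W" for y
      using assms(3)[OF that] by (simp add: lin_form_def)
    have d: "(\<lambda>y. a l y * dz l ws) differentiable at z" for l
      using assms(4) by (intro differentiable_mult differentiable_const)
    show "partial_z p (\<lambda>y. \<alpha> y ws) z = (\<Sum>l\<in>UNIV. partial_z p (a l) z * dz l ws)"
      "partial_zbar p (\<lambda>y. \<alpha> y ws) z = (\<Sum>l\<in>UNIV. partial_zbar p (a l) z * dz l ws)"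
      using partial_cong[OF assms(1,2) e] by (simp_all add: partial_sum[OF d] partial_cmult[OF assms(4)])
  qed
  show "del_local \<alpha> z vs = (\<Sum>p\<in>UNIV. \<Sum>l\<in>UNIV. partial_z p (a l) z * (dz p \<and>\<^sub>w dz l) vs)"
    "delbar_local \<alpha> z vs = (\<Sum>p\<in>UNIV. \<Sum>l\<in>UNIV. partial_zbar p (a l) z * (dzbar p \<and>\<^sub>w dz l) vs)"
    unfolding del_local_def delbar_local_def 1 by (simp_all add: wedge_sum_right wedge_scale_right)
qed

lemma fibre_coord_bij:
  fixes E :: "('x, 'e, 'r::finite) vbundle"
  assumes "holo_vector_bundle X E" "t \<in> trivs E" "x \<in> fst t"
  shows "bij_betw (snd t) (fibre E x) UNIV"
proof -
  obtain V \<psi> where t: "t = (V, \<psi>)" by fastforce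
  have b: "bij_betw (\<lambda>e. (proj E e, \<psi> e)) {e \<in> total E. proj E e \<in> V} (V \<times> UNIV)"
    using assms(1,2) unfolding holo_vector_bundle_def t by fastforce
  have x: "x \<in> V" using assms(3) t by simp
  show ?thesis unfolding bij_betw_def t snd_conv
  proof
    show "inj_on \<psi> (fibre E x)"
      using bij_betw_imp_inj_on[OF b] x unfolding inj_on_def fibre_def by auto
    show "\<psi> ` fibre E x = UNIV"
    proof (intro set_eqI iffI)
      fix u :: "complex^'r"
      have "(x, u) \<in> (\<lambda>e. (proj E e, \<psi> e)) ` {e \<in> total E. proj E e \<in> V}"
        using bij_betw_imp_surj_on[OF b] x by simp
      then show "u \<in> \<psi> ` fibre E x" unfolding fibre_def by auto
    qed simp
  qed
qed

text \<open>A real-linear map of one complex variable determines its complex-linear part, by its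
  values at 1 and i. This isolates the (1,0)-part in the compatibility equation.\<close>

lemma linear_part_eq:
  assumes "\<And>a. P * a + Q * cnj a = S * a + T * cnj a"
  shows "P = S"
  using assms[of 1] assms[of \<i>] by (simp add: complex_eq_iff)

section \<open>Local data over the overlap of one chart and one trivialization\<close>

locale bundle_chart =
  fixes X :: "('x, 'n::finite) cmfd" and E :: "('x, 'e, 'r::finite) vbundle" and h :: "'e \<Rightarrow> 'e \<Rightarrow> complex"
    and c :: "('x, 'n) chart" and t :: "('x, 'e, 'r) triv"
  assumes X: "complex_manifold X" and E: "holo_vector_bundle X E" and h: "hermitian_metric X E h"
    and c: "c \<in> atlas X" and t: "t \<in> trivs E"
begin

definition dom where "dom = snd c ` (fst c \<inter> fst t)"

definition gram_c where "gram_c i j = in_chart c (\<lambda>x. gram E h t x i j)"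

lemma chart_props:
  "openin (mtop X) (fst c)" "open (snd c ` fst c)"
  "homeomorphic_map (subtopology (mtop X) (fst c)) (top_of_set (snd c ` fst c)) (snd c)"
proof -
  have "\<forall>(U, \<phi>)\<in>atlas X. openin (mtop X) U \<and> open (\<phi> ` U) \<and>
        homeomorphic_map (subtopology (mtop X) U) (top_of_set (\<phi> ` U)) \<phi>"
    using X unfolding complex_manifold_def by (elim conjE)
  from bspec[OF this c] show "openin (mtop X) (fst c)" "open (snd c ` fst c)"
    "homeomorphic_map (subtopology (mtop X) (fst c)) (top_of_set (snd c ` fst c)) (snd c)"
    by (simp_all only: case_prod_beta)
qed

lemma chart_subset: "fst c \<subseteq> topspace (mtop X)"
  using chart_props(1) by (rule openin_subset)

lemma chart_inj: "inj_on (snd c) (fst c)"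
  using homeomorphic_imp_injective_map[OF chart_props(3)] chart_subset by (simp add: Int_absorb1)

lemma chart_inv_chart [simp]: "x \<in> fst c \<Longrightarrow> chart_inv c (snd c x) = x"
  unfolding chart_inv_def using chart_inj by (rule inv_into_f_f)

lemma open_chart_image:
  assumes "openin (mtop X) S" shows "open (snd c ` (fst c \<inter> S))"
proof -
  have "openin (subtopology (mtop X) (fst c)) (fst c \<inter> S)"
    using assms by (auto simp: openin_subtopology)
  then have "openin (top_of_set (snd c ` fst c)) (snd c ` (fst c \<inter> S))"
    using homeomorphic_imp_open_map[OF chart_props(3)] unfolding open_map_def by blast
  then show ?thesis using chart_props(2) by (simp add: openin_open_eq)
qed

lemma openin_chart_preimage:
  assumes "open S" shows "openin (mtop X) {x \<in> fst c. snd c x \<in> S}"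
proof -
  let ?U = "subtopology (mtop X) (fst c)"
  have "openin ?U {x \<in> topspace ?U. snd c x \<in> snd c ` fst c \<inter> S}"
    by (rule openin_continuous_map_preimage[OF homeomorphic_imp_continuous_map[OF chart_props(3)] openin_open_Int[OF assms]])
  moreover have "{x \<in> topspace ?U. snd c x \<in> snd c ` fst c \<inter> S} = {x \<in> fst c. snd c x \<in> S}"
    using chart_subset unfolding topspace_subtopology by blast
  ultimately have "openin ?U {x \<in> fst c. snd c x \<in> S}" by (simp only:)
  then show ?thesis using chart_props(1) by (rule openin_trans_full)
qed

lemma triv_open: "openin (mtop X) (fst t)"
proof -
  have "\<forall>(V, \<psi>)\<in>trivs E. openin (mtop X) V \<and>
        bij_betw (\<lambda>e. (proj E e, \<psi> e)) {e \<in> total E. proj E e \<in> V} (V \<times> UNIV)"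
    using E unfolding holo_vector_bundle_def by (elim conjE)
  from bspec[OF this t] show ?thesis by (simp add: case_prod_beta)
qed

lemma open_dom: "open dom"
  unfolding dom_def using triv_open by (rule open_chart_image)

lemma domE:
  assumes "z \<in> dom"
  obtains x where "x \<in> fst c" "x \<in> fst t" "z = snd c x" "chart_inv c z = x"
  using assms unfolding dom_def by auto

lemma coord_bij: "x \<in> fst t \<Longrightarrow> bij_betw (snd t) (fibre E x) UNIV"
  using fibre_coord_bij[OF E t] .

lemma frame_fibre:
  assumes "x \<in> fst t" shows "frame E t i x \<in> fibre E x" "snd t (frame E t i x) = axis i 1"
proof -
  have "\<exists>!e. e \<in> fibre E x \<and> snd t e = axis i 1"
    using coord_bij[OF assms] by (simp add: bij_betw_iff_bijections) metis
  from theI'[OF this] show "frame E t i x \<in> fibre E x" "snd t (frame E t i x) = axis i 1"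
    unfolding frame_def by auto
qed

lemma h_gram:
  assumes "x \<in> fst t" "u \<in> fibre E x" "v \<in> fibre E x"
  shows "h u v = (\<Sum>i\<in>UNIV. \<Sum>j\<in>UNIV. gram E h t x i j * snd t u $ i * cnj (snd t v $ j))"
    "h v u = cnj (h u v)" "snd t u \<noteq> 0 \<Longrightarrow> Re (h u u) > 0"
proof -
  note * = conjunct1[OF bspec[OF h[unfolded hermitian_metric_def] t]]
  note ** = bspec[OF bspec[OF bspec[OF * assms(1)] assms(2)] assms(3)]
  show "h u v = (\<Sum>i\<in>UNIV. \<Sum>j\<in>UNIV. gram E h t x i j * snd t u $ i * cnj (snd t v $ j))"
    by (rule conjunct1[OF **])
  show "h v u = cnj (h u v)" by (rule conjunct1[OF conjunct2[OF **]])
  show "snd t u \<noteq> 0 \<Longrightarrow> Re (h u u) > 0" by (rule mp[OF conjunct2[OF conjunct2[OF **]]])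
qed

lemma gram_smooth: "Cinf_on dom (gram_c i j)"
proof -
  have "Cinf_fun X (fst t) (\<lambda>x. gram E h t x i j)"
    using conjunct2[OF bspec[OF h[unfolded hermitian_metric_def] t]] by blast
  then show ?thesis using c unfolding Cinf_fun_def gram_c_def dom_def by blast
qed

sublocale smooth_gram dom gram_c
proof
  show "open dom" by (rule open_dom)
  show "Ck_on 2 dom (gram_c i j)" for i j using gram_smooth by (rule Cinf_on_imp_Ck)
  fix z assume "z \<in> dom"
  then obtain x where x: "x \<in> fst c" "x \<in> fst t" "chart_inv c z = x" by (rule domE)
  show "gram_c j i z = cnj (gram_c i j z)" for i j
    unfolding gram_c_def in_chart_def x gram_def by (rule h_gram(2)) (use x frame_fibre in auto)
  fix u :: "complex^'r" assume "u \<noteq> 0"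
  obtain e where e: "e \<in> fibre E x" "snd t e = u"
    using coord_bij[OF x(2)] unfolding bij_betw_def by (metis UNIV_I imageE)
  show "Re (\<Sum>i\<in>UNIV. \<Sum>j\<in>UNIV. gram_c i j z * u $ i * cnj (u $ j)) > 0"
    using h_gram(1)[OF x(2) e(1) e(1)] h_gram(3)[OF x(2) e(1) e(1)] \<open>u \<noteq> 0\<close>
    unfolding e(2) gram_c_def in_chart_def x by simp
qed

lemma d_at_const:
  "d_at c (\<lambda>y. const_form (f y)) x vs = (\<Sum>l\<in>UNIV. partial_z l (in_chart c f) (snd c x) * dz l vs)
     + (\<Sum>l\<in>UNIV. partial_zbar l (in_chart c f) (snd c x) * dzbar l vs)"
proof -
  have "in_chart c (\<lambda>y. const_form (f y) :: 'n form) = (\<lambda>z. const_form (in_chart c f z))"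
    by (simp add: in_chart_def)
  then show ?thesis
    by (simp add: d_at_def del_at_def delbar_at_def del_local_const delbar_local_const)
qed

text \<open>Both halves of the description are needed. The (1,0)-part of compatibility is
  \<open>conn_eq\<close> and the (0,1)-part its conjugate; conversely, the (1,0)-part of any
  solution agrees after multiplication by the invertible Gram matrix.\<close>

lemma chern_matrix_eq:
  assumes x: "x \<in> fst c" "x \<in> fst t"
  shows "chern_matrix E h c t x k j = lin_form (\<chi> l. conn k j l (snd c x))"
proof -
  let ?z = "snd c x"
  let ?A = "\<lambda>k j. lin_form (\<chi> l. conn k j l ?z)"
  have z: "?z \<in> dom" using x by (auto simp: dom_def)
  have g: "gram E h t x i j = gram_c i j ?z" for i j using x by (simp add: gram_c_def in_chart_def)
  have dg: "d_at c (\<lambda>y. const_form (gram E h t y i j)) x vs =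
      (\<Sum>l\<in>UNIV. partial_z l (gram_c i j) ?z * dz l vs) + (\<Sum>l\<in>UNIV. partial_zbar l (gram_c i j) ?z * dzbar l vs)" for i j vs
    unfolding d_at_const gram_c_def ..
  have "chern_matrix E h c t x = ?A"
    unfolding chern_matrix_def
  proof (rule the_equality, intro conjI allI)
    show "bidegree 1 0 (?A k j)" for k j by (rule bidegree_1_0_lin)
    fix i j vs
    have 1: "(\<Sum>k\<in>UNIV. ?A k i vs * gram_c k j ?z) = (\<Sum>l\<in>UNIV. partial_z l (gram_c i j) ?z * dz l vs)" for i j
    proof -
      have "(\<Sum>k\<in>UNIV. ?A k i vs * gram_c k j ?z) = (\<Sum>k\<in>UNIV. \<Sum>l\<in>UNIV. conn k i l ?z * gram_c k j ?z * dz l vs)"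
        by (simp add: lin_form_def sum_distrib_left sum_distrib_right ac_simps)
      also have "\<dots> = (\<Sum>l\<in>UNIV. \<Sum>k\<in>UNIV. conn k i l ?z * gram_c k j ?z * dz l vs)" by (rule sum.swap)
      finally show ?thesis by (simp add: conn_eq[OF z, symmetric] sum_distrib_right)
    qed
    have "(\<Sum>k\<in>UNIV. gram_c i k ?z * cnj (?A k j vs)) = cnj (\<Sum>k\<in>UNIV. ?A k j vs * gram_c k i ?z)"
      by (simp add: herm[OF z, symmetric] mult.commute)
    also have "\<dots> = (\<Sum>l\<in>UNIV. partial_zbar l (gram_c i j) ?z * dzbar l vs)"
      unfolding 1 by (simp add: partial_zbar_H[OF z] dzbar_def cnj_form_def)
    finally show "d_at c (\<lambda>y. const_form (gram E h t y i j)) x vs =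
        (\<Sum>k\<in>UNIV. ?A k i vs * gram E h t x k j + gram E h t x i k * cnj (?A k j vs))"
      unfolding dg g by (simp add: sum.distrib 1)
  next
    fix B assume B: "(\<forall>k j. bidegree 1 0 (B k j)) \<and> (\<forall>i j vs. d_at c (\<lambda>y. const_form (gram E h t y i j)) x vs =
        (\<Sum>k\<in>UNIV. B k i vs * gram E h t x k j + gram E h t x i k * cnj (B k j vs)))"
    have "\<exists>g. B k j = lin_form g" for k j using B by (intro bidegree_1_0_imp_lin) blast
    then obtain b where b: "\<And>k j. B k j = lin_form (b k j)" by metis
    \<comment> \<open>A multiple of a coordinate vector as argument picks out one component; letting
      a vary over all complex numbers separates dz from its conjugate.\<close>
    have ev: "(\<Sum>l\<in>UNIV. f l * dz l [axis p a]) = f p * a" "(\<Sum>l\<in>UNIV. f l * dzbar l [axis p a]) = f p * cnj a"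
      for f p a
      by (simp_all add: dz_def dzbar_def cnj_form_def axis_def if_distrib[of "(*) _"] if_distrib[of cnj] cong: if_cong)
    have e: "partial_z p (gram_c i j) ?z * a + partial_zbar p (gram_c i j) ?z * cnj a =
      (\<Sum>k\<in>UNIV. b k i $ p * gram_c k j ?z) * a + (\<Sum>k\<in>UNIV. gram_c i k ?z * cnj (b k j $ p)) * cnj a" for i j p a
    proof -
      have "(\<Sum>l\<in>UNIV. partial_z l (gram_c i j) ?z * dz l [axis p a]) + (\<Sum>l\<in>UNIV. partial_zbar l (gram_c i j) ?z * dzbar l [axis p a]) =
        (\<Sum>k\<in>UNIV. B k i [axis p a] * gram_c k j ?z + gram_c i k ?z * cnj (B k j [axis p a]))"
        using B unfolding dg g by blast
      then show ?thesis unfolding b lin_form_def ev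
        by (simp add: sum.distrib sum_distrib_right sum_distrib_left ac_simps)
    qed
    have "(\<Sum>k\<in>UNIV. b k i $ p * gram_c k j ?z) = (\<Sum>k\<in>UNIV. conn k i p ?z * gram_c k j ?z)" for i j p
      unfolding conn_eq[OF z] by (rule linear_part_eq[symmetric]) (rule e)
    then have "b k i $ p = conn k i p ?z" for k i p by (rule cancel[OF z])
    then have "b k j = (\<chi> l. conn k j l ?z)" for k j by (simp add: vec_eq_iff)
    then show "B = ?A" by (intro ext) (simp add: b)
  qed
  then show ?thesis by simp
qed

lemma curvature_eq:
  assumes x: "x \<in> fst c" "x \<in> fst t"
  shows "scale_form (- \<i>) (curvature E h c t x i j) = herm_form (\<lambda>l p. partial_zbar p (conn i j l) (snd c x))"
proof
  fix vs :: "(complex^'n) list"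
  let ?z = "snd c x"
  have z: "?z \<in> dom" using x by (auto simp: dom_def)
  have A: "in_chart c (\<lambda>y. chern_matrix E h c t y i j) y = lin_form (\<chi> l. conn i j l y)" if "y \<in> dom" for y
    using that by (rule domE) (simp add: in_chart_def chern_matrix_eq)
  let ?T = "\<lambda>p l. partial_z p (conn i j l) ?z + (\<Sum>k\<in>UNIV. conn i k p ?z * conn k j l ?z)"
  let ?w = "\<lambda>p l. (dz p \<and>\<^sub>w dz l) vs"
  have w: "?w l p = - ?w p l" for p l
    using fun_cong[OF wedge_commute[OF degree_form_dz degree_form_dz, of l p], of vs] by simp
  have d: "d_at c (\<lambda>y. chern_matrix E h c t y i j) x vs = (\<Sum>p\<in>UNIV. \<Sum>l\<in>UNIV. partial_z p (conn i j l) ?z * ?w p l)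
      + (\<Sum>p\<in>UNIV. \<Sum>l\<in>UNIV. partial_zbar p (conn i j l) ?z * (dzbar p \<and>\<^sub>w dz l) vs)"
    unfolding d_at_def del_at_def delbar_at_def
    by (rule arg_cong2[where f = "(+)"]; rule d_local_lin[OF open_dom z A conn_diff[OF z]])
  have AA: "(\<Sum>k\<in>UNIV. (chern_matrix E h c t x i k \<and>\<^sub>w chern_matrix E h c t x k j) vs)
      = (\<Sum>p\<in>UNIV. \<Sum>l\<in>UNIV. (\<Sum>k\<in>UNIV. conn i k p ?z * conn k j l ?z) * ?w p l)"
  proof -
    have "(\<Sum>k\<in>UNIV. (chern_matrix E h c t x i k \<and>\<^sub>w chern_matrix E h c t x k j) vs)
      = (\<Sum>k\<in>UNIV. \<Sum>p\<in>UNIV. \<Sum>l\<in>UNIV. conn i k p ?z * conn k j l ?z * ?w p l)"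
      unfolding chern_matrix_eq[OF x] lin_form_def wedge_sum_left wedge_sum_right wedge_scale_left wedge_scale_right
      by (simp add: sum_distrib_left mult.assoc)
    also have "\<dots> = (\<Sum>p\<in>UNIV. \<Sum>l\<in>UNIV. \<Sum>k\<in>UNIV. conn i k p ?z * conn k j l ?z * ?w p l)" by (rule sum_cycle3)
    finally show ?thesis by (simp add: sum_distrib_right)
  qed
  \<comment> \<open>Symmetric coefficients meet antisymmetric forms, so the (2,0)-part equals its
    own negative.\<close>
  have "contract ?T ?w = (\<Sum>p\<in>UNIV. \<Sum>l\<in>UNIV. - (?T l p * ?w l p))"
    by (intro sum.cong refl) (subst conn_torsion[OF z], subst w, simp)
  also have "\<dots> = - (contract ?T ?w)"
    unfolding sum_negf by (subst sum.swap) (rule refl)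
  finally have T0: "contract ?T ?w = 0" by simp
  have "curvature E h c t x i j vs = (contract ?T ?w)
      + (\<Sum>p\<in>UNIV. \<Sum>l\<in>UNIV. partial_zbar p (conn i j l) ?z * (dzbar p \<and>\<^sub>w dz l) vs)"
    unfolding curvature_def d AA by (simp add: distrib_right sum.distrib)
  also have "\<dots> = (\<Sum>l\<in>UNIV. \<Sum>p\<in>UNIV. partial_zbar p (conn i j l) ?z * (dzbar p \<and>\<^sub>w dz l) vs)"
    unfolding T0 by (simp, rule sum.swap)
  finally have C: "curvature E h c t x i j vs = (\<Sum>l\<in>UNIV. \<Sum>p\<in>UNIV. partial_zbar p (conn i j l) ?z * (dzbar p \<and>\<^sub>w dz l) vs)" .
  have s: "(scale_form \<i> (dz l) \<and>\<^sub>w dzbar p) vs = - \<i> * (dzbar p \<and>\<^sub>w dz l) vs" for l p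
    using fun_cong[OF wedge_commute[OF degree_form_dz degree_form_dzbar, of l p], of vs]
    by (simp add: scale_form_def wedge_scale_left)
  show "scale_form (- \<i>) (curvature E h c t x i j) vs = herm_form (\<lambda>l p. partial_zbar p (conn i j l) ?z) vs"
    unfolding scale_form_def[of "- \<i>"] C herm_form_def s sum_distrib_left by (simp add: ac_simps)
qed

text \<open>Evaluation on the frame turns the wedge product into a trace. What remains is to
  exchange the summations over fibre indices and form indices.\<close>

lemma m_curvature_eval:
  assumes x: "x \<in> fst c" "x \<in> fst t"
  shows "m_curvature_form \<omega> \<Omega> m E h c t x u std_frame =
    (\<Sum>l\<in>UNIV. \<Sum>p\<in>UNIV. curv_form (snd c x) (\<lambda>i. snd t u $ i) l p *
       herm_coeff (wedge_pow (\<omega> c x) (m - 1) \<and>\<^sub>w \<Omega> c x) l p)"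
proof -
  let ?z = "snd c x"
  define A where "A = herm_coeff (wedge_pow (\<omega> c x) (m - 1) \<and>\<^sub>w \<Omega> c x)"
  define R where "R = (\<lambda>i k l p. partial_zbar p (conn i k l) ?z)"
  define v where "v = snd t u"
  have g: "gram E h t x i j = gram_c i j ?z" for i j using x by (simp add: gram_c_def in_chart_def)
  have "m_curvature_form \<omega> \<Omega> m E h c t x u std_frame =
    (\<Sum>i\<in>UNIV. \<Sum>j\<in>UNIV. gram_c i j ?z * (cnj (v $ j) * (\<Sum>k\<in>UNIV. (contract (R i k) A) * v $ k)))"
    unfolding m_curvature_form_def hpair_def cnj_form_const wedge_const_right curvature_eq[OF x] herm_form_wedge_eval g
    by (simp add: A_def R_def v_def)
  also have "\<dots> = (\<Sum>i\<in>UNIV. \<Sum>j\<in>UNIV. \<Sum>k\<in>UNIV. \<Sum>l\<in>UNIV. \<Sum>p\<in>UNIV. R i k l p * gram_c i j ?z * v $ k * cnj (v $ j) * A l p)"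
    (is "_ = (\<Sum>i\<in>UNIV. \<Sum>j\<in>UNIV. \<Sum>k\<in>UNIV. \<Sum>l\<in>UNIV. \<Sum>p\<in>UNIV. ?f i j k l p)")
    by (simp add: sum_distrib_left sum_distrib_right ac_simps)
  also have "\<dots> = (\<Sum>k\<in>UNIV. \<Sum>j\<in>UNIV. \<Sum>i\<in>UNIV. \<Sum>l\<in>UNIV. \<Sum>p\<in>UNIV. ?f i j k l p)" by (rule sum_reverse3)
  also have "\<dots> = (\<Sum>k\<in>UNIV. \<Sum>j\<in>UNIV. \<Sum>l\<in>UNIV. \<Sum>p\<in>UNIV. \<Sum>i\<in>UNIV. ?f i j k l p)"
    by (intro sum.cong refl sum_cycle3)
  also have "\<dots> = (\<Sum>l\<in>UNIV. \<Sum>p\<in>UNIV. \<Sum>k\<in>UNIV. \<Sum>j\<in>UNIV. \<Sum>i\<in>UNIV. ?f i j k l p)" by (rule sum_swap_pairs)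
  finally show ?thesis
    unfolding curv_form_def A_def[symmetric] v_def[symmetric] R_def by (simp add: sum_distrib_right)
qed

definition coord :: "('x \<Rightarrow> 'e) \<Rightarrow> 'r \<Rightarrow> complex^'n \<Rightarrow> complex" where
  "coord s i = in_chart c (\<lambda>x. snd t (s x) $ i)"

lemma coord_holo: "s \<in> H0 X E \<Longrightarrow> holo_on dom (coord s i)"
  using t c unfolding H0_def holo_fun_def coord_def dom_def by (fastforce simp: case_prod_beta)

lemma section_fibre: "s \<in> H0 X E \<Longrightarrow> x \<in> topspace (mtop X) \<Longrightarrow> s x \<in> fibre E x"
  unfolding H0_def by auto

lemma chern_deriv_eq:
  assumes x: "x \<in> fst c" "x \<in> fst t" and s: "s \<in> H0 X E"
  shows "chern_deriv E h c t s x i vs = (\<Sum>l\<in>UNIV. cov_deriv (coord s) (snd c x) i l * dz l vs)"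
proof -
  let ?z = "snd c x"
  have z: "?z \<in> dom" using x by (auto simp: dom_def)
  have v: "snd t (s x) $ j = coord s j ?z" for j using x by (simp add: coord_def in_chart_def)
  have d: "d_at c (\<lambda>y. const_form (snd t (s y) $ i)) x vs = (\<Sum>l\<in>UNIV. partial_z l (coord s i) ?z * dz l vs)"
    unfolding d_at_const coord_def[symmetric] holo_on_dder(3)[OF coord_holo[OF s] z] by simp
  have "(\<Sum>j\<in>UNIV. chern_matrix E h c t x i j vs * (snd t (s x) $ j))
     = (\<Sum>j\<in>UNIV. \<Sum>l\<in>UNIV. conn i j l ?z * coord s j ?z * dz l vs)"
    unfolding chern_matrix_eq[OF x] v lin_form_def by (simp add: sum_distrib_left sum_distrib_right ac_simps)
  also have "\<dots> = (\<Sum>l\<in>UNIV. \<Sum>j\<in>UNIV. conn i j l ?z * coord s j ?z * dz l vs)" by (rule sum.swap)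
  finally show ?thesis unfolding chern_deriv_def d cov_deriv_def
    by (simp add: distrib_right sum.distrib sum_distrib_right)
qed

definition norm2 :: "('x \<Rightarrow> 'e) \<Rightarrow> complex^'n \<Rightarrow> real" where
  "norm2 s z = Re (\<Sum>i\<in>UNIV. \<Sum>j\<in>UNIV. gram_c i j z * (coord s i z * cnj (coord s j z)))"

lemma norm2_chart:
  assumes "x \<in> fst c" "x \<in> fst t" "s \<in> H0 X E"
  shows "Re (h (s x) (s x)) = norm2 s (snd c x)"
proof -
  have "s x \<in> fibre E x" using section_fibre[OF assms(3)] chart_subset assms(1) by auto
  from h_gram(1)[OF assms(2) this this] show ?thesis
    using assms(1) by (simp add: norm2_def gram_c_def coord_def in_chart_def mult.assoc)
qed

end

section \<open>The Bochner argument\<close>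

lemma continuous_on_wedge:
  assumes "\<And>ws. continuous_on W (\<lambda>z. \<alpha> z ws)" "\<And>ws. continuous_on W (\<lambda>z. \<beta> z ws)"
  shows "continuous_on W (\<lambda>z. (\<alpha> z \<and>\<^sub>w \<beta> z) vs)"
  unfolding wedge_def by (intro continuous_intros assms)

lemma continuous_on_wedge_pow:
  assumes "\<And>ws. continuous_on W (\<lambda>z. \<alpha> z ws)"
  shows "continuous_on W (\<lambda>z. wedge_pow (\<alpha> z) k vs)"
proof (induction k arbitrary: vs)
  case 0 show ?case by (simp add: wedge_pow_def)
next
  case (Suc k)
  have "wedge_pow (\<alpha> z) (Suc k) = \<alpha> z \<and>\<^sub>w wedge_pow (\<alpha> z) k" for z
    by (simp add: wedge_pow_def wedge_list_Cons)
  then show ?case using continuous_on_wedge[OF assms Suc] by simp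
qed

lemma continuous_on_Cinf: "Cinf_on U f \<Longrightarrow> continuous_on U f"
  using Cinf_on_imp_Ck[of U f 0] by simp

context smooth_gram
begin

lemma H_quadratic:
  assumes z: "z \<in> W"
  shows "Im (\<Sum>i\<in>UNIV. \<Sum>j\<in>UNIV. H i j z * (x i * cnj (x j))) = 0"
    "Re (\<Sum>i\<in>UNIV. \<Sum>j\<in>UNIV. H i j z * (x i * cnj (x j))) \<ge> 0"
    "Re (\<Sum>i\<in>UNIV. \<Sum>j\<in>UNIV. H i j z * (x i * cnj (x j))) = 0 \<Longrightarrow> x i = 0"
proof -
  let ?u = "\<chi> i. x i"
  have e: "(\<Sum>i\<in>UNIV. \<Sum>j\<in>UNIV. H i j z * (x i * cnj (x j))) = qform (\<lambda>i j. H i j z) ?u"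
    by (simp add: qform_def mult.assoc)
  show "Im (\<Sum>i\<in>UNIV. \<Sum>j\<in>UNIV. H i j z * (x i * cnj (x j))) = 0"
    unfolding e by (rule Im_qform_herm) (rule herm[OF z])
  have p: "Re (qform (\<lambda>i j. H i j z) ?u) > 0" if "?u \<noteq> 0"
    using posdef[OF z that] by (simp add: qform_def)
  show "Re (\<Sum>i\<in>UNIV. \<Sum>j\<in>UNIV. H i j z * (x i * cnj (x j))) \<ge> 0"
    unfolding e using p by (cases "?u = 0") (auto simp: qform_def vec_eq_iff)
  assume "Re (\<Sum>i\<in>UNIV. \<Sum>j\<in>UNIV. H i j z * (x i * cnj (x j))) = 0"
  then have "?u = 0" using p unfolding e by force
  then show "x i = 0" by (simp add: vec_eq_iff)
qed

text \<open>The value at v is the squared length of the covariant derivative of the section in the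
  direction v.\<close>

lemma grad_form_pos_semidef:
  assumes z: "z \<in> W"
  shows "pos_semidef_on UNIV (grad_form \<sigma> z)"
  unfolding pos_semidef_on_def
proof
  fix v :: "'n \<Rightarrow> complex"
  let ?D = "cov_deriv \<sigma> z"
  let ?x = "\<lambda>a. \<Sum>l\<in>UNIV. ?D a l * v l"
  have "(\<Sum>l\<in>UNIV. \<Sum>p\<in>UNIV. grad_form \<sigma> z l p * v l * cnj (v p)) = qform (\<lambda>l p. \<Sum>a\<in>UNIV. \<Sum>q\<in>UNIV. H a q z * (?D a l * cnj (?D q p))) (\<chi> l. v l)"
    by (simp add: qform_def grad_form_def)
  also have "\<dots> = (\<Sum>a\<in>UNIV. \<Sum>q\<in>UNIV. H a q z * (?x a * cnj (?x q)))"
    unfolding qform_sum qform_rank_one by simp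
  finally show "Im (\<Sum>l\<in>UNIV. \<Sum>p\<in>UNIV. grad_form \<sigma> z l p * v l * cnj (v p)) = 0 \<and>
     0 \<le> Re (\<Sum>l\<in>UNIV. \<Sum>p\<in>UNIV. grad_form \<sigma> z l p * v l * cnj (v p))"
    using H_quadratic(1,2)[OF z, of ?x] by simp
qed

lemma grad_form_zero:
  assumes z: "z \<in> W" "\<And>l p. grad_form \<sigma> z l p = 0"
  shows "cov_deriv \<sigma> z a l = 0"
  by (rule H_quadratic(3)[OF z(1)]) (use z(2)[of l l] in \<open>simp add: grad_form_def\<close>)

end

locale bochner_chart = bundle_chart X E h c t
  for X :: "('x, 'n::finite) cmfd" and E :: "('x, 'e, 'r::finite) vbundle" and h c t +
  fixes \<omega> \<Omega> :: "('x, 'n) mform" and m :: nat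
  assumes kaehler: "kaehler_form X \<omega>"
    and m: "m \<in> {1..CARD('n)}"
    and \<Omega>: "Cinf_form X (CARD('n) - m) (CARD('n) - m) \<Omega>"
    and pos: "metrically_weakly_pos X \<omega> (CARD('n) - m) \<Omega>"
    and semi: "\<forall>x\<in>topspace (mtop X). m_semi_negative_at X \<omega> \<Omega> m E h x"
begin

text \<open>The coefficient matrix of the second order operator in the chart, to be paired with Levi
  forms.\<close>

definition coeff :: "complex^'n \<Rightarrow> 'n \<Rightarrow> 'n \<Rightarrow> complex" where
  "coeff z = herm_coeff (wedge_pow (\<omega> c (chart_inv c z)) (m - 1) \<and>\<^sub>w \<Omega> c (chart_inv c z))"

lemma coeff_pos:
  assumes "z \<in> dom" shows "pos_trace (coeff z)"
proof -
  from assms obtain x where x: "x \<in> fst c" "chart_inv c z = x" by (rule domE)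
  obtain \<epsilon> :: real where \<epsilon>: "\<epsilon> > 0" "\<And>c x. c \<in> atlas X \<Longrightarrow> x \<in> fst c \<Longrightarrow>
      weakly_nonneg (CARD('n) - m) (\<lambda>vs. \<Omega> c x vs - of_real \<epsilon> * wedge_pow (\<omega> c x) (CARD('n) - m) vs)"
    using pos unfolding metrically_weakly_pos_def by blast
  show ?thesis unfolding coeff_def x
  proof (rule weakly_pos_pos_trace[OF _ _ _ m _ \<epsilon>(1) \<epsilon>(2)[OF c x(1)]])
    show "bidegree 1 1 (\<omega> c x)" using kaehler c x unfolding kaehler_form_def Cinf_form_def by blast
    show "real_form (\<omega> c x)" using kaehler c x unfolding kaehler_form_def real_mform_def by blast
    show "0 < Re (\<omega> c x [v, \<i> *s v])" if "v \<noteq> 0" for v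
      using kaehler c x that unfolding kaehler_form_def by blast
    show "bidegree (CARD('n) - m) (CARD('n) - m) (\<Omega> c x)" using \<Omega> c x unfolding Cinf_form_def by blast
  qed
qed

lemma Cinf_form_continuous:
  assumes "Cinf_form X p q \<alpha>"
  shows "continuous_on dom (\<lambda>z. \<alpha> c (chart_inv c z) ws)"
proof -
  have "Cinf_on (snd c ` fst c) (\<lambda>z. in_chart c (\<alpha> c) z ws)"
    using assms c unfolding Cinf_form_def by blast
  moreover have "dom \<subseteq> snd c ` fst c" by (auto simp: dom_def)
  ultimately show ?thesis
    using continuous_on_subset[OF continuous_on_Cinf] by (fastforce simp: in_chart_def)
qed

lemma coeff_continuous: "continuous_on dom (\<lambda>z. coeff z j k)"
proof -
  have "Cinf_form X 1 1 \<omega>" using kaehler unfolding kaehler_form_def by blast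
  with \<Omega> show ?thesis unfolding coeff_def herm_coeff_def
    by (intro continuous_on_wedge continuous_on_wedge_pow continuous_on_const Cinf_form_continuous)
qed

lemma norm2_levi:
  assumes "s \<in> H0 X E" "z \<in> dom"
  shows "has_levi (norm2 s) z (levi_form gram_c (coord s) z)"
  unfolding norm2_def[abs_def]
  by (rule has_levi_section[OF open_dom assms(2) smooth coord_holo[OF assms(1)] herm])

lemma norm2_continuous:
  assumes "s \<in> H0 X E" shows "continuous_on dom (norm2 s)"
proof -
  have "continuous_on dom (gram_c i j)" for i j
    by (intro continuous_at_imp_continuous_on ballI differentiable_imp_continuous_within H_diff)
  moreover have "continuous_on dom (coord s i)" for i
    by (intro continuous_at_imp_continuous_on ballI differentiable_imp_continuous_within holo_on_dder(1)[OF coord_holo[OF assms]])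
  ultimately show ?thesis unfolding norm2_def[abs_def] by (intro continuous_intros)
qed

lemma curvature_trace:
  assumes s: "s \<in> H0 X E" and x: "x \<in> fst c" "x \<in> fst t"
  shows "m_curvature_form \<omega> \<Omega> m E h c t x (s x) std_frame =
     (\<Sum>l\<in>UNIV. \<Sum>p\<in>UNIV. curv_form (snd c x) (\<lambda>i. coord s i (snd c x)) l p * coeff (snd c x) l p)"
  using m_curvature_eval[OF x, of \<omega> \<Omega> m "s x"] x by (simp add: coeff_def coord_def in_chart_def)

lemma curvature_trace_nonneg:
  assumes s: "s \<in> H0 X E" and z: "z \<in> dom"
  shows "Re (contract (curv_form z (\<lambda>i. coord s i z)) (coeff z)) \<ge> 0"
proof -
  from z obtain x where x: "x \<in> fst c" "x \<in> fst t" "z = snd c x" by (rule domE)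
  have xX: "x \<in> topspace (mtop X)" using chart_subset x(1) by blast
  have "top_nonneg (m_curvature_form \<omega> \<Omega> m E h c t x (s x))"
    using semi xX c t x section_fibre[OF s xX] unfolding m_semi_negative_at_def by blast
  then have "Re (m_curvature_form \<omega> \<Omega> m E h c t x (s x) std_frame) \<ge> 0"
    using complex_basis_std unfolding top_nonneg_def by blast
  then show ?thesis unfolding curvature_trace[OF s x(1,2)] x(3) .
qed

lemma levi_trace:
  assumes "z \<in> dom"
  shows "contract (levi_form gram_c (coord s) z) (coeff z) =
    contract (grad_form (coord s) z) (coeff z) +
    contract (curv_form z (\<lambda>i. coord s i z)) (coeff z)"
  unfolding bochner[OF assms] by (simp only: distrib_right sum.distrib)

text \<open>The trace of the Levi form is a gradient term, nonnegative by ellipticity, plus a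
  curvature term, nonnegative by semi-negativity; this makes the squared norm a subsolution.\<close>

lemma norm2_local_max:
  assumes s: "s \<in> H0 X E" and p: "p \<in> dom" "\<And>z. z \<in> dom \<Longrightarrow> norm2 s z \<le> norm2 s p"
  shows "\<forall>\<^sub>F z in nhds p. norm2 s z = norm2 s p"
proof -
  interpret subsolution dom "norm2 s" coeff "levi_form gram_c (coord s)"
  proof
    fix z assume z: "z \<in> dom"
    show "0 \<le> Re (contract (levi_form gram_c (coord s) z) (coeff z))"
      unfolding levi_trace[OF z] plus_complex.sel
      by (intro add_nonneg_nonneg curvature_trace_nonneg[OF s z] pos_trace_nonneg(2)[OF coeff_pos[OF z] grad_form_pos_semidef[OF z]])
  qed (rule open_dom norm2_continuous[OF s] coeff_continuous coeff_pos norm2_levi[OF s]; assumption?)+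
  show ?thesis by (rule strong_maximum_principle[OF p])
qed

text \<open>A locally constant function has a local maximum, so the trace of its Levi form is at
  most 0. Both summands are nonnegative and hence vanish, and for the gradient term equality in the
  elliptic pairing kills the whole matrix.\<close>

lemma norm2_constant:
  assumes s: "s \<in> H0 X E" and z: "z \<in> dom" and const: "\<forall>\<^sub>F y in nhds z. norm2 s y = norm2 s z"
  shows "cov_deriv (coord s) z a l = 0"
    "Re (contract (curv_form z (\<lambda>i. coord s i z)) (coeff z)) \<le> 0"
proof -
  let ?F = "levi_form gram_c (coord s) z"
  have "\<forall>\<^sub>F y in nhds z. norm2 s y \<le> norm2 s z" using const by eventually_elim simp
  from has_levi_local_max[OF norm2_levi[OF s z] this]
  have "pos_semidef_on UNIV (\<lambda>j k. - ?F j k)" .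
  from pos_trace_nonneg(2)[OF coeff_pos[OF z] this]
  have F: "Re (contract ?F (coeff z)) \<le> 0" by (simp add: sum_negf)
  have G: "Re (contract (grad_form (coord s) z) (coeff z)) \<ge> 0"
    by (rule pos_trace_nonneg(2)[OF coeff_pos[OF z] grad_form_pos_semidef[OF z]])
  note K = curvature_trace_nonneg[OF s z]
  show "Re (contract (curv_form z (\<lambda>i. coord s i z)) (coeff z)) \<le> 0"
    using F G unfolding levi_trace[OF z] plus_complex.sel by linarith
  have "Re (contract (grad_form (coord s) z) (coeff z)) \<le> 0"
    using F K unfolding levi_trace[OF z] plus_complex.sel by linarith
  from pos_trace_eq_0[OF coeff_pos[OF z] grad_form_pos_semidef[OF z] this]
  show "cov_deriv (coord s) z a l = 0" by (rule grad_form_zero[OF z])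
qed

lemma dom_chart: "x \<in> fst c \<Longrightarrow> snd c x \<in> dom \<Longrightarrow> x \<in> fst t"
  by (metis chart_inv_chart domE)

lemma openin_chart_dom:
  assumes "open S" "x \<in> fst c" "x \<in> fst t" "snd c x \<in> S"
  shows "\<exists>V. openin (mtop X) V \<and> x \<in> V \<and> (\<forall>y\<in>V. y \<in> fst c \<and> y \<in> fst t \<and> snd c y \<in> S)"
proof (intro exI conjI)
  show "openin (mtop X) {y \<in> fst c. snd c y \<in> S \<inter> dom}"
    by (intro openin_chart_preimage open_Int open_dom assms(1))
  show "x \<in> {y \<in> fst c. snd c y \<in> S \<inter> dom}" using assms by (auto simp: dom_def)
  show "\<forall>y\<in>{y \<in> fst c. snd c y \<in> S \<inter> dom}. y \<in> fst c \<and> y \<in> fst t \<and> snd c y \<in> S"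
    using dom_chart by blast
qed

end

section \<open>From local charts to the compact connected manifold\<close>

locale bochner_bundle =
  fixes X :: "('x, 'n::finite) cmfd" and E :: "('x, 'e, 'r::finite) vbundle" and h
    and \<omega> \<Omega> :: "('x, 'n) mform" and m :: nat
  assumes X: "complex_manifold X" and E: "holo_vector_bundle X E" and h: "hermitian_metric X E h"
    and kaehler: "kaehler_form X \<omega>"
    and m: "m \<in> {1..CARD('n)}"
    and \<Omega>: "Cinf_form X (CARD('n) - m) (CARD('n) - m) \<Omega>"
    and pos: "metrically_weakly_pos X \<omega> (CARD('n) - m) \<Omega>"
    and semi: "\<forall>x\<in>topspace (mtop X). m_semi_negative_at X \<omega> \<Omega> m E h x"
    and compact: "compact_space (mtop X)" and connected: "connected_space (mtop X)"
begin

lemma chart: "c \<in> atlas X \<Longrightarrow> t \<in> trivs E \<Longrightarrow> bochner_chart X E h c t \<omega> \<Omega> m"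
  unfolding bochner_chart_def bundle_chart_def bochner_chart_axioms_def
  using X E h kaehler m \<Omega> pos semi by blast

lemma chart_exists:
  assumes "x \<in> topspace (mtop X)"
  obtains c t where "c \<in> atlas X" "t \<in> trivs E" "x \<in> fst c" "x \<in> fst t"
proof -
  have "\<Union>(fst ` atlas X) = topspace (mtop X)" using X unfolding complex_manifold_def by (elim conjE)
  then obtain c where c: "c \<in> atlas X" "x \<in> fst c" using assms by blast
  have "\<Union>(fst ` trivs E) = topspace (mtop X)" using E unfolding holo_vector_bundle_def by (elim conjE)
  then obtain t where t: "t \<in> trivs E" "x \<in> fst t" using assms by blast
  show thesis using that c t by blast
qed

abbreviation sqnorm :: "('x \<Rightarrow> 'e) \<Rightarrow> 'x \<Rightarrow> real" where
  "sqnorm s x \<equiv> Re (h (s x) (s x))"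

lemma sqnorm_continuous:
  assumes s: "s \<in> H0 X E"
  shows "continuous_map (mtop X) euclideanreal (sqnorm s)"
  unfolding continuous_map_def
proof (intro conjI allI impI)
  fix S :: "real set" assume "openin euclidean S"
  then have S: "open S" by simp
  show "openin (mtop X) {x \<in> topspace (mtop X). sqnorm s x \<in> S}"
  proof (subst openin_subopen, intro ballI)
    fix x assume x: "x \<in> {x \<in> topspace (mtop X). sqnorm s x \<in> S}"
    then obtain c t where ct: "c \<in> atlas X" "t \<in> trivs E" "x \<in> fst c" "x \<in> fst t"
      using chart_exists by blast
    interpret bochner_chart X E h c t \<omega> \<Omega> m by (rule chart[OF ct(1,2)])
    have "open (norm2 s -` S \<inter> dom)"
      using norm2_continuous[OF s] S open_dom by (simp add: continuous_on_open_vimage)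
    moreover have "snd c x \<in> norm2 s -` S \<inter> dom"
      using x ct norm2_chart[OF ct(3,4) s] by (auto simp: dom_def)
    ultimately obtain V where V: "openin (mtop X) V" "x \<in> V"
      "\<forall>y\<in>V. y \<in> fst c \<and> y \<in> fst t \<and> snd c y \<in> norm2 s -` S \<inter> dom"
      using openin_chart_dom[OF _ ct(3,4)] by blast
    moreover have "V \<subseteq> {x \<in> topspace (mtop X). sqnorm s x \<in> S}"
      using V(3) norm2_chart[OF _ _ s] chart_subset by fastforce
    ultimately show "\<exists>T. openin (mtop X) T \<and> x \<in> T \<and> T \<subseteq> {x \<in> topspace (mtop X). sqnorm s x \<in> S}" by blast
  qed
qed simp

text \<open>Compactness provides a maximum. The set where it is attained is closed by continuity and
  open by the strong maximum principle in charts, hence everything by connectedness.\<close>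

lemma sqnorm_constant:
  assumes s: "s \<in> H0 X E" and x: "x \<in> topspace (mtop X)" "y \<in> topspace (mtop X)"
  shows "sqnorm s x = sqnorm s y"
proof -
  let ?f = "sqnorm s" and ?T = "topspace (mtop X)"
  have "compactin euclideanreal (?f ` ?T)"
    using compact sqnorm_continuous[OF s] unfolding compact_space_def by (rule image_compactin)
  then have "compact (?f ` ?T)" by simp
  from compact_attains_sup[OF this] x obtain p where p: "p \<in> ?T" "\<And>y. y \<in> ?T \<Longrightarrow> ?f y \<le> ?f p" by blast
  define S where "S = {y \<in> ?T. ?f y \<in> {?f p}}"
  have "closedin (mtop X) S" unfolding S_def
    by (rule closedin_continuous_map_preimage[OF sqnorm_continuous[OF s]]) simp
  moreover have "openin (mtop X) S"
  proof (subst openin_subopen, intro ballI)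
    fix q assume q: "q \<in> S"
    then obtain c t where ct: "c \<in> atlas X" "t \<in> trivs E" "q \<in> fst c" "q \<in> fst t"
      using chart_exists unfolding S_def by blast
    interpret bochner_chart X E h c t \<omega> \<Omega> m by (rule chart[OF ct(1,2)])
    have qd: "snd c q \<in> dom" using ct by (auto simp: dom_def)
    have nq: "norm2 s (snd c q) = ?f p" using q norm2_chart[OF ct(3,4) s] by (simp add: S_def)
    have "norm2 s z \<le> norm2 s (snd c q)" if "z \<in> dom" for z
    proof -
      from that obtain y where y: "y \<in> fst c" "y \<in> fst t" "z = snd c y" by (rule domE)
      then have "?f y \<le> ?f p" using p(2) chart_subset by blast
      then show ?thesis using norm2_chart[OF y(1,2) s] nq y(3) by simp
    qed
    from norm2_local_max[OF s qd this] obtain U where U: "open U" "snd c q \<in> U"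
      "\<And>z. z \<in> U \<Longrightarrow> norm2 s z = norm2 s (snd c q)"
      unfolding eventually_nhds by blast
    obtain V where V: "openin (mtop X) V" "q \<in> V" "\<forall>y\<in>V. y \<in> fst c \<and> y \<in> fst t \<and> snd c y \<in> U"
      using openin_chart_dom[OF U(1) ct(3,4) U(2)] by blast
    have "V \<subseteq> S"
    proof
      fix y assume "y \<in> V"
      then have y: "y \<in> fst c" "y \<in> fst t" "snd c y \<in> U" using V(3) by blast+
      show "y \<in> S" using norm2_chart[OF y(1,2) s] U(3)[OF y(3)] nq y(1) chart_subset
        by (auto simp: S_def)
    qed
    with V show "\<exists>T. openin (mtop X) T \<and> q \<in> T \<and> T \<subseteq> S" by blast
  qed
  moreover have "p \<in> S" using p(1) by (simp add: S_def)
  ultimately have "S = ?T" using connected unfolding connected_space_clopen_in by blast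
  then have "?f w = ?f p" if "w \<in> ?T" for w using that S_def by auto
  then show ?thesis using x by simp
qed

lemma norm2_locally_constant:
  assumes s: "s \<in> H0 X E" and ct: "c \<in> atlas X" "t \<in> trivs E" "x \<in> fst c" "x \<in> fst t"
  shows "snd c x \<in> bundle_chart.dom c t"
    "\<forall>\<^sub>F y in nhds (snd c x). bundle_chart.norm2 E h c t s y = bundle_chart.norm2 E h c t s (snd c x)"
proof -
  interpret bochner_chart X E h c t \<omega> \<Omega> m by (rule chart[OF ct(1,2)])
  show z: "snd c x \<in> dom" using ct by (auto simp: dom_def)
  show "\<forall>\<^sub>F y in nhds (snd c x). norm2 s y = norm2 s (snd c x)"
    using eventually_nhds_in_open[OF open_dom z]
  proof eventually_elim
    case (elim z)
    then obtain y where y: "y \<in> fst c" "y \<in> fst t" "z = snd c y" by (rule domE)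
    have "sqnorm s y = sqnorm s x" by (rule sqnorm_constant[OF s]) (use chart_subset y ct in blast)+
    then show ?case using norm2_chart[OF y(1,2) s] norm2_chart[OF ct(3,4) s] y(3) by simp
  qed
qed

lemma parallel:
  assumes s: "s \<in> H0 X E" shows "parallel_section X E h s"
  unfolding parallel_section_def
proof (intro ballI allI)
  fix c t x i vs
  assume ct: "c \<in> atlas X" "t \<in> trivs E" and "x \<in> fst c \<inter> fst t"
  then have x: "x \<in> fst c" "x \<in> fst t" by auto
  interpret bochner_chart X E h c t \<omega> \<Omega> m by (rule chart[OF ct])
  show "chern_deriv E h c t s x i vs = 0"
    unfolding chern_deriv_eq[OF x s] norm2_constant(1)[OF s norm2_locally_constant[OF s ct x]] by simp
qed

text \<open>Transition maps are linear in the fibre, so a vector with zero coordinates in one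
  trivialization has zero coordinates in all. This justifies the description in
  \<open>zero_section\<close>.\<close>

lemma zero_section_unique:
  assumes x: "x \<in> topspace (mtop X)"
  shows "\<exists>!e. e \<in> fibre E x \<and> (\<forall>(V, \<psi>)\<in>trivs E. x \<in> V \<longrightarrow> \<psi> e = 0)"
proof -
  obtain c t where ct: "c \<in> atlas X" "t \<in> trivs E" "x \<in> fst c" "x \<in> fst t" using chart_exists[OF x] .
  note b = fibre_coord_bij[OF E ct(2,4)]
  have "0 \<in> snd t ` fibre E x" using bij_betw_imp_surj_on[OF b] by simp
  then obtain e where e: "e \<in> fibre E x" "snd t e = 0" by (metis imageE)
  have tr: "\<forall>(V, \<psi>)\<in>trivs E. \<forall>(V', \<psi>')\<in>trivs E. \<exists>g :: 'x \<Rightarrow> complex^'r^'r.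
        (\<forall>x\<in>V \<inter> V'. invertible (g x) \<and> (\<forall>e\<in>fibre E x. \<psi>' e = g x *v \<psi> e)) \<and>
        (\<forall>i j. holo_fun X (V \<inter> V') (\<lambda>x. g x $ i $ j))"
    using E unfolding holo_vector_bundle_def by (elim conjE)
  have Z: "snd t' e = 0" if t': "t' \<in> trivs E" "x \<in> fst t'" for t'
  proof -
    from bspec[OF bspec[OF tr ct(2), unfolded case_prod_beta] t'(1)]
    obtain g :: "'x \<Rightarrow> complex^'r^'r" where
      "\<forall>x\<in>fst t \<inter> fst t'. invertible (g x) \<and> (\<forall>e\<in>fibre E x. snd t' e = g x *v snd t e)"
      by blast
    moreover have "x \<in> fst t \<inter> fst t'" using ct(4) t'(2) by simp
    ultimately have "snd t' e = g x *v snd t e" using e(1) by blast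
    then show ?thesis using e(2) by simp
  qed
  then have "\<forall>(V, \<psi>)\<in>trivs E. x \<in> V \<longrightarrow> \<psi> e = 0" by (auto simp: case_prod_beta)
  with e(1) have "e \<in> fibre E x \<and> (\<forall>(V, \<psi>)\<in>trivs E. x \<in> V \<longrightarrow> \<psi> e = 0)" by (rule conjI)
  moreover have "e' = e" if p: "e' \<in> fibre E x \<and> (\<forall>(V, \<psi>)\<in>trivs E. x \<in> V \<longrightarrow> \<psi> e' = 0)" for e'
  proof -
    have "snd t e' = 0" using bspec[OF conjunct2[OF p] ct(2)] ct(4) by (simp add: case_prod_beta)
    then have "snd t e' = snd t e" using e(2) by simp
    then show ?thesis by (rule inj_onD[OF bij_betw_imp_inj_on[OF b] _ conjunct1[OF p] e(1)])
  qed
  ultimately show ?thesis by (rule ex1I)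
qed

lemma zero_section_props:
  assumes x: "x \<in> topspace (mtop X)"
  shows "zero_section X E x \<in> fibre E x" "\<And>t. t \<in> trivs E \<Longrightarrow> x \<in> fst t \<Longrightarrow> snd t (zero_section X E x) = 0"
  using theI'[OF zero_section_unique[OF x]] x unfolding zero_section_def by (auto simp: case_prod_beta)

lemma zero_sectionI:
  assumes "x \<in> topspace (mtop X)" "e \<in> fibre E x" "t \<in> trivs E" "x \<in> fst t" "snd t e = 0"
  shows "e = zero_section X E x"
  using inj_onD[OF bij_betw_imp_inj_on[OF fibre_coord_bij[OF E assms(3,4)]]] zero_section_props[OF assms(1)] assms
  by simp

lemma zero_section_in_H0: "zero_section X E \<in> H0 X E"
proof -
  have "holo_fun X V (\<lambda>x. \<psi> (zero_section X E x) $ i)" if t: "(V, \<psi>) \<in> trivs E" for V i and \<psi> :: "'e \<Rightarrow> complex^'r"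
    unfolding holo_fun_def
  proof
    fix c assume c: "c \<in> atlas X"
    interpret bochner_chart X E h c "(V, \<psi>)" \<omega> \<Omega> m by (rule chart[OF c t])
    have z: "in_chart c (\<lambda>x. \<psi> (zero_section X E x) $ i) z = 0" if "z \<in> dom" for z
    proof -
      from that obtain x where "x \<in> fst c" "x \<in> fst (V, \<psi>)" "chart_inv c z = x" by (rule domE)
      then show ?thesis using zero_section_props(2)[OF _ t, of x] chart_subset
        by (auto simp: in_chart_def)
    qed
    have "(in_chart c (\<lambda>x. \<psi> (zero_section X E x) $ i) has_derivative (\<lambda>v. 0)) (at z)" if "z \<in> dom" for z
      by (rule has_derivative_transform_within_open[OF has_derivative_const open_dom that]) (simp add: z)
    then show "holo_on (snd c ` (fst c \<inter> V)) (in_chart c (\<lambda>x. \<psi> (zero_section X E x) $ i))"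
      unfolding holo_on_def dom_def fst_conv by (metis mult_zero_right)
  qed
  moreover have "zero_section X E \<in> (\<Pi>\<^sub>E x\<in>topspace (mtop X). fibre E x)"
    using zero_section_props(1) by (auto simp: zero_section_def)
  ultimately show ?thesis unfolding H0_def by blast
qed

text \<open>A nonzero value at x0 would make the curvature trace positive there, whereas constancy
  of the norm bounds it by 0. The constant norm is therefore 0, and definiteness of the metric gives
  the zero section.\<close>

lemma vanishing:
  assumes x0: "x0 \<in> topspace (mtop X)" "m_negative_at X \<omega> \<Omega> m E h x0"
  shows "H0 X E = {zero_section X E}"
proof -
  have "s = zero_section X E" if s: "s \<in> H0 X E" for s
  proof -
    have s0: "s x0 = zero_section X E x0"
    proof (rule ccontr)
      assume ne: "s x0 \<noteq> zero_section X E x0"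
      obtain c t where ct: "c \<in> atlas X" "t \<in> trivs E" "x0 \<in> fst c" "x0 \<in> fst t" using chart_exists[OF x0(1)] .
      interpret bochner_chart X E h c t \<omega> \<Omega> m by (rule chart[OF ct(1,2)])
      have "s x0 \<in> fibre E x0 - {zero_section X E x0}" using section_fibre[OF s x0(1)] ne by blast
      then have "top_pos (m_curvature_form \<omega> \<Omega> m E h c t x0 (s x0))"
        using x0(2) ct unfolding m_negative_at_def by blast
      then have "Re (m_curvature_form \<omega> \<Omega> m E h c t x0 (s x0) std_frame) > 0"
        using complex_basis_std unfolding top_pos_def by blast
      then show False
        using norm2_constant(2)[OF s norm2_locally_constant[OF s ct]] unfolding curvature_trace[OF s ct(3,4)] by linarith
    qed
    show ?thesis
    proof (rule PiE_ext[of _ "topspace (mtop X)" "fibre E"])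
      show "s \<in> (\<Pi>\<^sub>E x\<in>topspace (mtop X). fibre E x)" "zero_section X E \<in> (\<Pi>\<^sub>E x\<in>topspace (mtop X). fibre E x)"
        using s zero_section_in_H0 unfolding H0_def by blast+
      fix x assume x: "x \<in> topspace (mtop X)"
      obtain c0 t0 where ct0: "c0 \<in> atlas X" "t0 \<in> trivs E" "x0 \<in> fst c0" "x0 \<in> fst t0" using chart_exists[OF x0(1)] .
      obtain c t where ct: "c \<in> atlas X" "t \<in> trivs E" "x \<in> fst c" "x \<in> fst t" using chart_exists[OF x] .
      interpret A: bochner_chart X E h c0 t0 \<omega> \<Omega> m by (rule chart[OF ct0(1,2)])
      interpret B: bochner_chart X E h c t \<omega> \<Omega> m by (rule chart[OF ct(1,2)])
      have f: "s x \<in> fibre E x" "s x0 \<in> fibre E x0" using B.section_fibre[OF s] x x0(1) by blast+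
      have "sqnorm s x0 = 0"
        using A.h_gram(1)[OF ct0(4) f(2) f(2)] zero_section_props(2)[OF x0(1) ct0(2,4)] unfolding s0 by simp
      then have "sqnorm s x = 0" using sqnorm_constant[OF s x x0(1)] by simp
      then have "snd t (s x) = 0" using B.h_gram(3)[OF ct(4) f(1) f(1)] by force
      then show "s x = zero_section X E x" by (rule zero_sectionI[OF x f(1) ct(2,4)])
    qed
  qed
  then show ?thesis using zero_section_in_H0 by blast
qed

end

theorem theorem1p1:
  fixes X :: "('x, 'n::finite) cmfd"
    and \<omega> \<Omega> :: "('x, 'n) mform"
    and m :: nat
    and E :: "('x, 'e, 'r::finite) vbundle"
  assumes "complex_manifold X"
    and "compact_space (mtop X)"
    and "connected_space (mtop X)"
    and "kaehler_form X \<omega>"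
    and "m \<in> {1..CARD('n)}"
    and "Cinf_form X (CARD('n) - m) (CARD('n) - m) \<Omega>"
    and "real_mform X \<Omega>"
    and "del_delbar_closed X \<Omega>"
    and "metrically_weakly_pos X \<omega> (CARD('n) - m) \<Omega>"
    and "holo_vector_bundle X E"
  shows "((\<exists>h. hermitian_metric X E h \<and>
             (\<forall>x\<in>topspace (mtop X). m_semi_negative_at X \<omega> \<Omega> m E h x) \<and>
             (\<exists>x0\<in>topspace (mtop X). m_negative_at X \<omega> \<Omega> m E h x0))
           \<longrightarrow> H0 X E = {zero_section X E}) \<and>
         (\<forall>h. hermitian_metric X E h \<and>
             (\<forall>x\<in>topspace (mtop X). m_semi_negative_at X \<omega> \<Omega> m E h x)
           \<longrightarrow> (\<forall>s\<in>H0 X E. parallel_section X E h s))"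
proof -
  have B: "bochner_bundle X E h \<omega> \<Omega> m"
    if "hermitian_metric X E h" "\<forall>x\<in>topspace (mtop X). m_semi_negative_at X \<omega> \<Omega> m E h x" for h
    using assms that by (intro bochner_bundle.intro)
  show ?thesis
  proof (intro conjI impI allI ballI)
    assume "\<exists>h. hermitian_metric X E h \<and>
             (\<forall>x\<in>topspace (mtop X). m_semi_negative_at X \<omega> \<Omega> m E h x) \<and>
             (\<exists>x0\<in>topspace (mtop X). m_negative_at X \<omega> \<Omega> m E h x0)"
    then obtain h x0 where h: "hermitian_metric X E h" "\<forall>x\<in>topspace (mtop X). m_semi_negative_at X \<omega> \<Omega> m E h x"
      and x0: "x0 \<in> topspace (mtop X)" "m_negative_at X \<omega> \<Omega> m E h x0" by blast
    show "H0 X E = {zero_section X E}" by (rule bochner_bundle.vanishing[OF B[OF h] x0])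
  next
    fix h s assume h: "hermitian_metric X E h \<and> (\<forall>x\<in>topspace (mtop X). m_semi_negative_at X \<omega> \<Omega> m E h x)"
      and s: "s \<in> H0 X E"
    show "parallel_section X E h s"
      by (rule bochner_bundle.parallel[OF B[OF conjunct1[OF h] conjunct2[OF h]] s])
  qed
qed

end
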